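(* Let $0<\alpha<1$, $\alpha\ne1/2$, $\lambda\in\mathbb R$, $\nu=\min\{\alpha,1-\alpha\}$, and let $m_\nu=0$ if $0<\alpha<1/2$ and $m_\nu=-1$ if $1/2<\alpha<1$, so that $|m_\nu+\alpha|=\nu$. Choose a radial cutoff $\chi\in C_c^\infty([0,\infty))$ with $0\le\chi\le1$ which is one near zero, and let $$\phi(r,\theta)=c\,\chi(r)\,r^\nu e^{im_\nu\theta},\qquad c\in\mathbb C,\ \lambda c\ne0,$$ so that $\phi\in\operatorname{dom}(H_\alpha)\setminus\mathcal D^\sharp_\alpha$. Set $b_0=1/2+\nu/2$, assume $\|\phi\|_{L^\infty}<\varepsilon_{b_0,\alpha,\lambda}$, and let $u$ be the corresponding final state solution, i.e. the unique global solution of $i\partial_tu=H_\alpha u+\lambda|u|u$ satisfying the bound $(\mathrm B_{b_0})$ for some $T\ge1$. Then the bound $$(\mathrm B_b)\qquad\sup_{\tau\ge T}\tau^b\Bigl(\|u-u_{\mathrm{ap}}\|_{L^\infty([\tau,\infty);L^2)}+\|u-u_{\mathrm{ap}}\|_{L^4([\tau,\infty);L^4)}\Bigr)<\infty$$ fails for every $b\ge\frac12+\nu$ and every $T\ge1$. More generally, no global solution of $i\partial_tu=H_\alpha u+\lambda|u|u$ satisfies $(\mathrm B_b)$ for this profile $\phi$ and any $b\ge\frac12+\nu$, $T\ge1$.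
   Context: For $0<\alpha<1$ let $A_\alpha(x)=\alpha\,(-x_2,x_1)/|x|^2$ on $\mathbb R^2\setminus\{0\}$, and let $H_\alpha$ be the Friedrichs realization in $L^2(\mathbb R^2)$ of $(-i\nabla+A_\alpha)^2$ (the self-adjoint operator of the closure of the form $\int|(\nabla+iA_\alpha)v|^2dx$ on $C_c^\infty(\mathbb R^2\setminus\{0\})$), with domain $\operatorname{dom}(H_\alpha)$. Polar coordinates are $x=(r\cos\theta,r\sin\theta)$. Let $\mathcal Y$ be the closure of $C_c^\infty(\mathbb R^2\setminus\{0\})$ in the norm $\|\phi\|_{H^2}+\|\nabla\phi/|x|\|_{L^2}+\|\phi/|x|^2\|_{L^2}$. With a radial cutoff $\chi_{\mathrm{tr}}\in C_c^\infty([0,\infty))$ equal to one near zero, every $\phi\in\operatorname{dom}(H_\alpha)$ decomposes uniquely as $\phi=\psi+c_0\chi_{\mathrm{tr}}r^\alpha+c_{-1}\chi_{\mathrm{tr}}r^{1-\alpha}e^{-i\theta}$ with $\psi\in\mathcal Y$; the coefficients $c_m(\phi)$ do not depend on $\chi_{\mathrm{tr}}$. $\mathcal D_\alpha^\sharp$ is the set of $\phi\in\operatorname{dom}(H_\alpha)$ with $c_m(\phi)=0$ for every $m\in\{0,-1\}$ with $|m+\alpha|\le\frac12$. For every $u_0\in L^2(\mathbb R^2)$ the equation $i\partial_tu=H_\alpha u+\lambda|u|u$, $u(0)=u_0$, has a unique (Duhamel) solution $u\in C(\mathbb R;L^2)\cap L^6_{\mathrm{loc}}(\mathbb R;L^3)$;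 "global solution" means a solution in this class. For $t>0$, $$u_{\mathrm{ap}}(t,x)=\frac1{2it}e^{i|x|^2/(4t)}\phi\Bigl(\frac x{2t}\Bigr)\exp\Bigl[-\frac{i\lambda}2\Bigl|\phi\Bigl(\frac x{2t}\Bigr)\Bigr|\log t\Bigr].$$ The constant $\varepsilon_{b_0,\alpha,\lambda}>0$ is one such that every $\phi\in\operatorname{dom}(H_\alpha)$ with $\|\phi\|_{L^\infty}<\varepsilon_{b_0,\alpha,\lambda}$ admits a unique global solution $u$ satisfying $(\mathrm B_{b_0})$ for some $T\ge1$ (such a constant exists because $1/2<b_0<1/2+\nu$). *)

theory Defs
  imports "HOL-Probability.Probability"
begin

text \<open>
  Elements of \<open>L\<^sup>p(\<real>\<^sup>2)\<close> are represented by Borel functions \<open>real^2 \<Rightarrow> complex\<close>; equality in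
  \<open>L\<^sup>p\<close> is equality almost everywhere, and the notions below that concern such classes are invariant under it.
\<close>

type_synonym fld = "real^2 \<Rightarrow> complex"

section \<open>Lebesgue norms\<close>

text \<open>All norms are \<open>ennreal\<close>-valued, so that finiteness is a genuine condition.\<close>

definition eroot :: "nat \<Rightarrow> ennreal \<Rightarrow> ennreal" where
  "eroot p y = (if y = top then top else ennreal (root p (enn2real y)))"

definition eLp :: "'a measure \<Rightarrow> nat \<Rightarrow> ('a \<Rightarrow> ennreal) \<Rightarrow> ennreal" where
  "eLp M p g = eroot p (\<integral>\<^sup>+ x. g x ^ p \<partial>M)"

definition Lp_norm :: "nat \<Rightarrow> fld \<Rightarrow> ennreal" where
  "Lp_norm p f = eLp lborel p (\<lambda>x. ennreal (norm (f x)))"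

definition Linf_norm :: "fld \<Rightarrow> ennreal" where
  "Linf_norm f = esssup lborel (\<lambda>x. ennreal (norm (f x)))"

definition L2 :: "fld set" where
  "L2 = {f. f \<in> borel_measurable lborel \<and> Lp_norm 2 f < top}"

definition pairing :: "fld \<Rightarrow> fld \<Rightarrow> complex" where
  "pairing f g = (\<integral> x. f x * cnj (g x) \<partial>lborel)"

section \<open>Smooth functions\<close>

text \<open>Meant for open \<open>S\<close>.\<close>

primrec Ck_on :: "nat \<Rightarrow> 'a::euclidean_space set \<Rightarrow> ('a \<Rightarrow> 'b::real_normed_vector) \<Rightarrow> bool" where
  "Ck_on 0 S f \<longleftrightarrow> continuous_on S f"
| "Ck_on (Suc k) S f \<longleftrightarrow> f differentiable_on S \<and>
     (\<forall>e\<in>Basis. Ck_on k S (\<lambda>x. frechet_derivative f (at x) e))"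

definition smooth_on :: "'a::euclidean_space set \<Rightarrow> ('a \<Rightarrow> 'b::real_normed_vector) \<Rightarrow> bool" where
  "smooth_on S f \<longleftrightarrow> (\<forall>k. Ck_on k S f)"

definition partial :: "2 \<Rightarrow> fld \<Rightarrow> fld" where
  "partial j f x = frechet_derivative f (at x) (axis j 1)"

text \<open>The space \<open>C\<^sub>c\<^sup>\<infinity>(\<real>\<^sup>2 - {0})\<close>, extended by zero to the origin.\<close>

definition test_funs :: "fld set" where
  "test_funs = {f. smooth_on UNIV f \<and> compact (closure {x. f x \<noteq> 0}) \<and> 0 \<notin> closure {x. f x \<noteq> 0}}"

text \<open>
  Cutoffs in \<open>C\<^sub>c\<^sup>\<infinity>([0,\<infinity>))\<close> equal to one near zero; smoothness up to the endpoint \<open>0\<close> follows from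
  being constant there, and values at negative arguments are irrelevant.
\<close>

definition radial_cutoff :: "(real \<Rightarrow> real) \<Rightarrow> bool" where
  "radial_cutoff \<eta> \<longleftrightarrow> smooth_on {0<..} \<eta> \<and> (\<exists>d>0. \<forall>r. 0 \<le> r \<and> r < d \<longrightarrow> \<eta> r = 1) \<and>
     (\<exists>R. \<forall>r\<ge>R. \<eta> r = 0)"

text \<open>
  \<open>ang m\<close> is the function \<open>exp (i m \<theta>)\<close> in polar coordinates (with the irrelevant value \<open>0 powi m\<close> at
  the origin).
\<close>

definition ang :: "int \<Rightarrow> fld" where
  "ang m x = sgn (Complex (x$1) (x$2)) powi m"

lemma ang_polar:
  assumes "r > 0"
  shows "ang m (vector [r * cos \<theta>, r * sin \<theta>]) = cis (of_int m * \<theta>)"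
proof -
  have "Complex (r * cos \<theta>) (r * sin \<theta>) = of_real r * cis \<theta>"
    by (simp add: complex_eq_iff)
  then have "sgn (Complex (r * cos \<theta>) (r * sin \<theta>)) = cis \<theta>"
    using assms by (simp add: sgn_mult sgn_of_real sgn_cis)
  then show ?thesis
    by (simp add: ang_def cis_power_int)
qed

section \<open>Closures of the test functions inside \<open>L\<^sup>2\<close>\<close>

text \<open>
  \<open>w\<close> is a sequence of test functions that is Cauchy for \<open>N\<close> and converges to \<open>v\<close> in \<open>L\<^sup>2\<close>. For the
  two norms used below (the closable magnetic form norm and the norm of \<open>\<Y>\<close>) the \<open>v\<close> with such a \<open>w\<close>
  form the closure of the test functions in \<open>\<parallel>\<cdot>\<parallel>\<^sub>2 + N\<close>, realized as a subspace of \<open>L\<^sup>2\<close>.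
\<close>

definition approximates :: "(fld \<Rightarrow> ennreal) \<Rightarrow> (nat \<Rightarrow> fld) \<Rightarrow> fld \<Rightarrow> bool" where
  "approximates N w v \<longleftrightarrow> (\<forall>n. w n \<in> test_funs) \<and> v \<in> L2 \<and>
     (\<lambda>n. Lp_norm 2 (\<lambda>x. w n x - v x)) \<longlonglongrightarrow> 0 \<and>
     (\<forall>e::real. e > 0 \<longrightarrow>
        (\<exists>K. \<forall>m\<ge>K. \<forall>n\<ge>K. N (\<lambda>x. w m x - w n x) < ennreal e))"

definition test_closure :: "(fld \<Rightarrow> ennreal) \<Rightarrow> fld set" where
  "test_closure N = {v. \<exists>w. approximates N w v}"

section \<open>The Friedrichs realization \<open>H\<^sub>\<alpha>\<close>\<close>

definition A_pot :: "real \<Rightarrow> real^2 \<Rightarrow> real^2" where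
  "A_pot \<alpha> x = (\<alpha> / (norm x)\<^sup>2) *\<^sub>R vector [- (x$2), x$1]"

definition cov_partial :: "real \<Rightarrow> 2 \<Rightarrow> fld \<Rightarrow> fld" where
  "cov_partial \<alpha> j f x = partial j f x + \<i> * of_real (A_pot \<alpha> x $ j) * f x"

definition core_form :: "real \<Rightarrow> fld \<Rightarrow> fld \<Rightarrow> complex" where
  "core_form \<alpha> f g = (\<integral> x. (\<Sum>j\<in>UNIV. cov_partial \<alpha> j f x * cnj (cov_partial \<alpha> j g x)) \<partial>lborel)"

definition form_seminorm :: "real \<Rightarrow> fld \<Rightarrow> ennreal" where
  "form_seminorm \<alpha> f =
     eLp lborel 2 (\<lambda>x. ennreal (sqrt (\<Sum>j\<in>UNIV. (norm (cov_partial \<alpha> j f x))\<^sup>2)))"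

definition form_dom :: "real \<Rightarrow> fld set" where
  "form_dom \<alpha> = test_closure (form_seminorm \<alpha>)"

definition closed_form :: "real \<Rightarrow> fld \<Rightarrow> fld \<Rightarrow> complex" where
  "closed_form \<alpha> f g = (THE z. \<forall>F G.
     approximates (form_seminorm \<alpha>) F f \<and> approximates (form_seminorm \<alpha>) G g \<longrightarrow>
       (\<lambda>n. core_form \<alpha> (F n) (G n)) \<longlonglongrightarrow> z)"

text \<open>\<open>H_graph \<alpha> f g\<close> says that \<open>f \<in> dom(H\<^sub>\<alpha>)\<close> and \<open>H\<^sub>\<alpha> f = g\<close>.\<close>

definition H_graph :: "real \<Rightarrow> fld \<Rightarrow> fld \<Rightarrow> bool" where
  "H_graph \<alpha> f g \<longleftrightarrow> f \<in> form_dom \<alpha> \<and> g \<in> L2 \<and>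
     (\<forall>v\<in>form_dom \<alpha>. closed_form \<alpha> f v = pairing g v)"

definition H_dom :: "real \<Rightarrow> fld set" where
  "H_dom \<alpha> = {f. \<exists>g. H_graph \<alpha> f g}"

section \<open>Singular coefficients and \<open>\<D>\<^sub>\<alpha>\<^sup>\<sharp>\<close>\<close>

definition Y_norm :: "fld \<Rightarrow> ennreal" where
  "Y_norm f =
     eLp lborel 2 (\<lambda>x. ennreal (sqrt ((norm (f x))\<^sup>2 + (\<Sum>j\<in>UNIV. (norm (partial j f x))\<^sup>2)
        + (\<Sum>j\<in>UNIV. \<Sum>k\<in>UNIV. (norm (partial j (partial k f) x))\<^sup>2))))
   + eLp lborel 2 (\<lambda>x. ennreal (sqrt (\<Sum>j\<in>UNIV. (norm (partial j f x))\<^sup>2) / norm x))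
   + eLp lborel 2 (\<lambda>x. ennreal (norm (f x) / (norm x)\<^sup>2))"

definition Y_space :: "fld set" where
  "Y_space = test_closure Y_norm"

definition decomposes :: "real \<Rightarrow> (real \<Rightarrow> real) \<Rightarrow> fld \<Rightarrow> fld \<Rightarrow> complex \<Rightarrow> complex \<Rightarrow> bool" where
  "decomposes \<alpha> \<eta> \<phi> \<psi> c0 cm1 \<longleftrightarrow> \<psi> \<in> Y_space \<and>
     (AE x in lborel. \<phi> x = \<psi> x
        + c0 * of_real (\<eta> (norm x) * norm x powr \<alpha>)
        + cm1 * of_real (\<eta> (norm x) * norm x powr (1 - \<alpha>)) * ang (-1) x)"

text \<open>
  The coefficient \<open>c\<^sub>m(\<phi>)\<close> for \<open>m \<in> {0,-1}\<close> and \<open>\<phi> \<in> dom(H\<^sub>\<alpha>)\<close>; the decomposition is unique and its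
  coefficients do not depend on the cutoff.
\<close>

definition sing_coeff :: "real \<Rightarrow> int \<Rightarrow> fld \<Rightarrow> complex" where
  "sing_coeff \<alpha> m \<phi> = (THE c. \<exists>\<eta> \<psi> c0 cm1. radial_cutoff \<eta> \<and> decomposes \<alpha> \<eta> \<phi> \<psi> c0 cm1 \<and>
     c = (if m = 0 then c0 else cm1))"

definition D_sharp :: "real \<Rightarrow> fld set" where
  "D_sharp \<alpha> = {\<phi> \<in> H_dom \<alpha>. \<forall>m\<in>{0,-1::int}. \<bar>of_int m + \<alpha>\<bar> \<le> 1/2 \<longrightarrow> sing_coeff \<alpha> m \<phi> = 0}"

section \<open>Global solutions\<close>

text \<open>
  \<open>propagator \<alpha> U\<close>: \<open>U t\<close> is \<open>exp (-i t H\<^sub>\<alpha>)\<close>, i.e. \<open>U\<close> is the strongly continuous unitary group with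
  generator \<open>-i H\<^sub>\<alpha>\<close>. By Stone's theorem it exists and is unique (up to null sets).
\<close>

definition propagator :: "real \<Rightarrow> (real \<Rightarrow> fld \<Rightarrow> fld) \<Rightarrow> bool" where
  "propagator \<alpha> U \<longleftrightarrow>
     (\<forall>t. \<forall>f\<in>L2. U t f \<in> L2 \<and> Lp_norm 2 (U t f) = Lp_norm 2 f) \<and>
     (\<forall>t a b. \<forall>f\<in>L2. \<forall>g\<in>L2.
        AE x in lborel. U t (\<lambda>y. a * f y + b * g y) x = a * U t f x + b * U t g x) \<and>
     (\<forall>f\<in>L2. AE x in lborel. U 0 f x = f x) \<and>
     (\<forall>s t. \<forall>f\<in>L2. AE x in lborel. U (s + t) f x = U s (U t f) x) \<and>
     (\<forall>f\<in>L2. ((\<lambda>t. Lp_norm 2 (\<lambda>x. U t f x - f x)) \<longlongrightarrow> 0) (at 0)) \<and>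
     (\<forall>f\<in>L2. \<forall>g\<in>L2. H_graph \<alpha> f g \<longleftrightarrow>
        ((\<lambda>h. Lp_norm 2 (\<lambda>x. (U h f x - f x) / of_real h + \<i> * g x)) \<longlongrightarrow> 0) (at 0))"

definition nonlin :: "fld \<Rightarrow> fld" where
  "nonlin v x = of_real (norm (v x)) * v x"

text \<open>
  Duhamel's formula \<open>u(t) = U(t)u(0) - i \<lambda> \<integral>\<^sub>0\<^sup>t U(t-s) (|u|u)(s) ds\<close>. In the class
  \<open>C(\<real>;L\<^sup>2) \<inter> L\<^sup>6_loc(\<real>;L\<^sup>3)\<close> the nonlinearity lies in \<open>L\<^sup>3_loc(\<real>;L^(3/2))\<close> but not necessarily in \<open>L\<^sup>2\<close>, and
  the integral is the element of \<open>L\<^sup>2\<close> given by duality with \<open>U(s-t)g \<in> L\<^sup>6(\<real>;L\<^sup>3)\<close>, \<open>g \<in> L\<^sup>2\<close>. The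
  integrability conditions hold automatically by the Strichartz estimates; stating them rules out
  the default value of non-convergent integrals.
\<close>

definition duhamel :: "real \<Rightarrow> (real \<Rightarrow> fld \<Rightarrow> fld) \<Rightarrow> (real \<Rightarrow> fld) \<Rightarrow> bool" where
  "duhamel lam U u \<longleftrightarrow> (\<forall>t. \<forall>g\<in>L2.
     (AE s in lborel. s \<in> closed_segment 0 t \<longrightarrow>
        integrable lborel (\<lambda>x. nonlin (u s) x * cnj (U (s - t) g x))) \<and>
     interval_lebesgue_integrable lborel (ereal 0) (ereal t)
        (\<lambda>s. pairing (nonlin (u s)) (U (s - t) g)) \<and>
     pairing (u t) g = pairing (U t (u 0)) g
        - \<i> * of_real lam * (CLBINT s=ereal 0..ereal t. pairing (nonlin (u s)) (U (s - t) g)))"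

definition global_solution :: "real \<Rightarrow> real \<Rightarrow> (real \<Rightarrow> fld) \<Rightarrow> bool" where
  "global_solution \<alpha> lam u \<longleftrightarrow>
     (\<forall>t. u t \<in> L2) \<and>
     (\<forall>t. ((\<lambda>s. Lp_norm 2 (\<lambda>x. u s x - u t x)) \<longlongrightarrow> 0) (at t)) \<and>
     (\<forall>R. eLp (restrict_space lborel {-R..R}) 6 (\<lambda>t. Lp_norm 3 (u t)) < top) \<and>
     (\<exists>U. propagator \<alpha> U \<and> duhamel lam U u)"

section \<open>Asymptotics\<close>

definition u_ap :: "real \<Rightarrow> fld \<Rightarrow> real \<Rightarrow> fld" where
  "u_ap lam \<phi> t x =
     1 / (2 * \<i> * of_real t) * exp (\<i> * of_real ((norm x)\<^sup>2 / (4 * t))) * \<phi> ((1 / (2 * t)) *\<^sub>R x)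
     * exp (- (\<i> * of_real lam / 2) * of_real (norm (\<phi> ((1 / (2 * t)) *\<^sub>R x)) * ln t))"

definition B_bound :: "real \<Rightarrow> fld \<Rightarrow> real \<Rightarrow> real \<Rightarrow> (real \<Rightarrow> fld) \<Rightarrow> bool" where
  "B_bound lam \<phi> b T u \<longleftrightarrow>
     (SUP \<tau>\<in>{T..}. ennreal (\<tau> powr b) *
        (esssup (restrict_space lborel {\<tau>..}) (\<lambda>t. Lp_norm 2 (\<lambda>x. u t x - u_ap lam \<phi> t x))
         + eLp (restrict_space lborel {\<tau>..}) 4 (\<lambda>t. Lp_norm 4 (\<lambda>x. u t x - u_ap lam \<phi> t x)))) < top"

definition final_state_solution :: "real \<Rightarrow> real \<Rightarrow> real \<Rightarrow> fld \<Rightarrow> (real \<Rightarrow> fld) \<Rightarrow> bool" where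
  "final_state_solution \<alpha> lam b \<phi> u \<longleftrightarrow>
     global_solution \<alpha> lam u \<and> (\<exists>T\<ge>1. B_bound lam \<phi> b T u)"

definition final_state_const :: "real \<Rightarrow> real \<Rightarrow> real \<Rightarrow> real \<Rightarrow> bool" where
  "final_state_const \<alpha> lam b \<epsilon> \<longleftrightarrow> \<epsilon> > 0 \<and>
     (\<forall>\<phi>\<in>H_dom \<alpha>. Linf_norm \<phi> < ennreal \<epsilon> \<longrightarrow>
        (\<exists>u. final_state_solution \<alpha> lam b \<phi> u) \<and>
        (\<forall>u v. final_state_solution \<alpha> lam b \<phi> u \<and> final_state_solution \<alpha> lam b \<phi> v \<longrightarrow>
           (\<forall>t. AE x in lborel. u t x = v t x)))"

end

theory Submission
  imports Defs
begin

text \<open>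
  The functions \<open>q\<^sub>a(t,x) = (2it)\<^sup>-\<^sup>1 exp (i\<bar>x\<bar>\<^sup>2/4t) (\<bar>x\<bar>/2t)\<^sup>a exp (im\<theta>)\<close> satisfy
  \<open>i\<partial>\<^sub>tq\<^sub>a = H q\<^sub>a + (a\<^sup>2 - \<nu>\<^sup>2) q\<^sub>a/\<bar>x\<bar>\<^sup>2\<close>. On the region \<open>\<bar>x\<bar> \<lesssim> \<surd>S\<close>, \<open>S \<le> t \<le> 2S\<close>, where \<open>\<phi>(x/2t)\<close> is a pure power,
  expanding the logarithmic phase gives \<open>u\<^sub>a\<^sub>p \<approx> v = c q\<^sub>\<nu> - (i\<lambda>/2)\<bar>c\<bar>c ln S q\<^bsub>2\<nu>\<^esub>\<close>. Here \<open>q\<^sub>\<nu>\<close> solves the linear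
  equation exactly but \<open>q\<^bsub>2\<nu>\<^esub>\<close> does not. Test \<open>u - v\<close> against \<open>G(x) = g(\<bar>x\<bar>/\<surd>S) exp (im\<theta>)\<close>, with \<open>g\<close> supported
  away from zero, and integrate its time derivative over \<open>[S,2S]\<close>. If \<open>\<parallel>u - u\<^sub>a\<^sub>p\<parallel>\<^sub>2 = O(t\<^bsup>-1/2-\<nu>\<^esup>)\<close>, then the boundary terms,
  the term with \<open>HG\<close> and the nonlinear term are all \<open>O(S\<^bsup>-\<nu>\<^esup>)\<close>, whereas the defect of \<open>q\<^bsub>2\<nu>\<^esub>\<close> contributes a
  quantity of exact order \<open>S\<^bsup>-\<nu>\<^esup> ln S\<close>.
\<close>

subsection \<open>Calculus of smooth functions\<close>

text \<open>Why the scale is \<surd>S: for a test function of width \<rho> the boundary terms are of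
  order \<rho> S^(-1/2-\<nu>) and the term with HG is of order S^(1/2-\<nu>)/\<rho>. Their sum is
  smallest at \<rho> = \<surd>S. The defect contributes S^(-2\<nu>) \<rho>^(2\<nu>) ln S, which at
  this scale has the same power of S and wins by the logarithm alone. All other errors must
  therefore be free of logarithms: this is why the logarithm in v is frozen at t = S and why the
  quadratic term of the phase is reabsorbed into a power of S.

  Two obstacles shape the rest. The equation is given as Duhamel's formula in duality form, so the
  time derivative of the pairing of u with G has to be derived first. There exp(-ihH)G - G is known
  to be small in L^2 only, and the L^4 half of the assumed bound supplies the matching control of
  |u|u in L^2. Moreover the assumed L^2 bound holds at almost every time, whereas the argument
  evaluates at S, at 2S and at an intermediate time; continuity of the pairings closes this
  gap.\<close>

lemma differentiable_on_open_at:
  "open S \<Longrightarrow> f differentiable_on S \<longleftrightarrow> (\<forall>x\<in>S. f differentiable (at x))"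
  unfolding differentiable_on_def by (metis at_within_open)

lemma frechet_derivative_cong_open:
  assumes "open S" "x \<in> S" "\<And>y. y \<in> S \<Longrightarrow> f y = g y"
  shows "frechet_derivative f (at x) = frechet_derivative g (at x)"
proof -
  have "(f has_derivative D) (at x) \<longleftrightarrow> (g has_derivative D) (at x)" for D
    using assms has_derivative_transform_within_open[of f D x UNIV S g]
      has_derivative_transform_within_open[of g D x UNIV S f] by auto
  then show ?thesis
    by (simp add: frechet_derivative_def)
qed

lemma differentiable_cong_open:
  assumes "open S" "x \<in> S" "\<And>y. y \<in> S \<Longrightarrow> f y = g y" "f differentiable (at x)"
  shows "g differentiable (at x)"
  using assms has_derivative_transform_within_open[of f _ x UNIV S g]
  unfolding differentiable_def by blast

lemma Ck_on_cong:
  assumes "open S" "\<And>x. x \<in> S \<Longrightarrow> f x = g x" "Ck_on k S f"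
  shows "Ck_on k S g"
  using assms(2,3)
proof (induction k arbitrary: f g)
  case 0
  then show ?case by (metis Ck_on.simps(1) continuous_on_cong)
next
  case (Suc k)
  have "g differentiable_on S"
    using Suc.prems differentiable_cong_open[OF \<open>open S\<close> _ Suc.prems(1)]
    by (auto simp: differentiable_on_open_at[OF \<open>open S\<close>])
  moreover have "Ck_on k S (\<lambda>x. frechet_derivative g (at x) e)" if "e \<in> Basis" for e
  proof (rule Suc.IH)
    show "Ck_on k S (\<lambda>x. frechet_derivative f (at x) e)" using Suc.prems that by auto
    show "frechet_derivative f (at x) e = frechet_derivative g (at x) e" if "x \<in> S" for x
      using frechet_derivative_cong_open[OF \<open>open S\<close> that Suc.prems(1)] by simp
  qed
  ultimately show ?case by simp
qed

lemma Ck_on_SucD: "Ck_on (Suc k) S f \<Longrightarrow> Ck_on k S f"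
proof (induction k arbitrary: f)
  case 0
  then show ?case by (simp add: differentiable_imp_continuous_on)
qed auto

lemma Ck_on_subset: "Ck_on k S f \<Longrightarrow> T \<subseteq> S \<Longrightarrow> Ck_on k T f"
proof (induction k arbitrary: f)
  case 0
  then show ?case using continuous_on_subset by auto
next
  case (Suc k)
  then show ?case using differentiable_on_subset by auto
qed

lemma Ck_on_Un:
  assumes "open S" "open T" "Ck_on k S f" "Ck_on k T f"
  shows "Ck_on k (S \<union> T) f"
  using assms(3,4)
proof (induction k arbitrary: f)
  case 0
  then show ?case using continuous_on_open_Un[OF assms(1,2)] by auto
next
  case (Suc k)
  then show ?case
    by (auto simp: differentiable_on_open_at assms(1,2) open_Un)
qed

text \<open>Lets an explicit derivative \<open>D\<close> stand in for the chosen
  \<open>frechet_derivative\<close> in the recursion that defines \<open>Ck_on\<close>. The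
  inductions for sums, products and compositions go through this rule.\<close>

lemma Ck_on_SucI:
  assumes "open S" "\<And>x. x \<in> S \<Longrightarrow> (f has_derivative D x) (at x)"
    and "\<And>e. e \<in> Basis \<Longrightarrow> Ck_on k S (\<lambda>x. D x e)"
  shows "Ck_on (Suc k) S f"
proof -
  have "f differentiable_on S"
    using assms(2) by (auto simp: differentiable_on_open_at[OF assms(1)] intro: differentiableI)
  moreover have "Ck_on k S (\<lambda>x. frechet_derivative f (at x) e)" if "e \<in> Basis" for e
  proof (rule Ck_on_cong[OF assms(1) _ assms(3)[OF that]])
    show "D x e = frechet_derivative f (at x) e" if "x \<in> S" for x
      using frechet_derivative_at[OF assms(2)[OF that]] by simp
  qed
  ultimately show ?thesis by simp
qed

lemma Ck_on_SucE:
  assumes "Ck_on (Suc k) S f" "open S"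
  shows "\<And>x. x \<in> S \<Longrightarrow> (f has_derivative frechet_derivative f (at x)) (at x)"
    and "\<And>e. e \<in> Basis \<Longrightarrow> Ck_on k S (\<lambda>x. frechet_derivative f (at x) e)"
  using assms by (auto simp: differentiable_on_open_at frechet_derivative_works)

lemma Ck_on_const: "Ck_on k S (\<lambda>x. c)"
  by (induction k arbitrary: c) (auto simp: frechet_derivative_const)

lemma Ck_on_bounded_linear:
  assumes h: "bounded_linear h" and S: "open S" and "Ck_on k S f"
  shows "Ck_on k S (\<lambda>x. h (f x))"
  using assms(3)
proof (induction k arbitrary: f)
  case 0
  then show ?case
    using bounded_linear.continuous_on[OF h] by auto
next
  case (Suc k)
  note f = Ck_on_SucE[OF Suc.prems S]
  show ?case
    by (rule Ck_on_SucI[OF S bounded_linear.has_derivative[OF h f(1)] Suc.IH[OF f(2)]])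
qed

lemma Ck_on_add:
  assumes S: "open S" and "Ck_on k S f" "Ck_on k S g"
  shows "Ck_on k S (\<lambda>x. f x + g x)"
  using assms(2,3)
proof (induction k arbitrary: f g)
  case 0
  then show ?case by (auto intro: continuous_on_add)
next
  case (Suc k)
  note f = Ck_on_SucE[OF Suc.prems(1) S] and g = Ck_on_SucE[OF Suc.prems(2) S]
  show ?case
    by (rule Ck_on_SucI[OF S has_derivative_add[OF f(1) g(1)] Suc.IH[OF f(2) g(2)]])
qed

text \<open>Serves products, scalings and inner products at once. In the induction step each summand
  pairs one derivative with one undifferentiated factor, whose surplus order is given up by
  \<open>Ck_on_SucD\<close>.\<close>

lemma Ck_on_bilinear:
  fixes f :: "'a::euclidean_space \<Rightarrow> 'b::real_normed_vector"
    and g :: "'a \<Rightarrow> 'c::real_normed_vector"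
    and b :: "'b \<Rightarrow> 'c \<Rightarrow> 'd::real_normed_vector"
  assumes b: "bounded_bilinear b" and S: "open S" and "Ck_on k S f" "Ck_on k S g"
  shows "Ck_on k S (\<lambda>x. b (f x) (g x))"
proof -
  have "\<forall>f g. Ck_on k S f \<longrightarrow> Ck_on k S g \<longrightarrow> Ck_on k S (\<lambda>x. b (f x) (g x))"
  proof (induct k)
    case 0
    show ?case by (simp add: bounded_bilinear.continuous_on[OF b])
  next
    case (Suc k)
    show ?case
    proof (intro allI impI)
      fix f :: "'a \<Rightarrow> 'b" and g :: "'a \<Rightarrow> 'c"
      assume fS: "Ck_on (Suc k) S f" and gS: "Ck_on (Suc k) S g"
      note f = Ck_on_SucE[OF fS S] and g = Ck_on_SucE[OF gS S]
      show "Ck_on (Suc k) S (\<lambda>x. b (f x) (g x))"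
      proof (rule Ck_on_SucI[where D="\<lambda>x e. b (f x) (frechet_derivative g (at x) e)
              + b (frechet_derivative f (at x) e) (g x)", OF S])
        show "((\<lambda>x. b (f x) (g x)) has_derivative (\<lambda>e. b (f x) (frechet_derivative g (at x) e)
            + b (frechet_derivative f (at x) e) (g x))) (at x)" if "x \<in> S" for x
          by (rule bounded_bilinear.FDERIV[OF b f(1)[OF that] g(1)[OF that]])
        show "Ck_on k S (\<lambda>x. b (f x) (frechet_derivative g (at x) e) + b (frechet_derivative f (at x) e) (g x))"
          if e: "e \<in> Basis" for e
          using Suc f(2)[OF e] g(2)[OF e] Ck_on_SucD[OF fS] Ck_on_SucD[OF gS]
          by (intro Ck_on_add[OF S]) blast+
      qed
    qed
  qed
  with assms(3,4) show ?thesis by blast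
qed

lemma Ck_on_mult:
  fixes f g :: "'a::euclidean_space \<Rightarrow> 'b::real_normed_algebra"
  shows "open S \<Longrightarrow> Ck_on k S f \<Longrightarrow> Ck_on k S g \<Longrightarrow> Ck_on k S (\<lambda>x. f x * g x)"
  by (rule Ck_on_bilinear[OF bounded_bilinear_mult])

lemma Ck_on_scaleR:
  "open S \<Longrightarrow> Ck_on k S f \<Longrightarrow> Ck_on k S g \<Longrightarrow> Ck_on k S (\<lambda>x. f x *\<^sub>R g x)"
  by (rule Ck_on_bilinear[OF bounded_bilinear_scaleR])

lemma Ck_on_linear:
  assumes "bounded_linear h" "open S"
  shows "Ck_on k S h"
proof (cases k)
  case 0
  then show ?thesis using linear_continuous_on[OF assms(1)] by simp
next
  case (Suc k)
  show ?thesis unfolding Suc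
    by (rule Ck_on_SucI[OF assms(2) bounded_linear_imp_has_derivative[OF assms(1)] Ck_on_const])
qed

text \<open>Since the inner function is real, the derivative of \<open>h\<close> just scales one
  vector. The chain rule is then a \<open>scaleR\<close> product, and the induction never meets
  compositions of linear maps.\<close>

lemma Ck_on_compose_real:
  fixes f :: "'a::euclidean_space \<Rightarrow> real" and h :: "real \<Rightarrow> 'b::real_normed_vector"
  assumes S: "open S" and R: "open R" and fS: "f ` S \<subseteq> R" and "Ck_on k S f" "Ck_on k R h"
  shows "Ck_on k S (\<lambda>x. h (f x))"
  using assms(4,5)
proof (induction k arbitrary: h)
  case 0
  then show ?case
    using continuous_on_compose2[of R h S f] assms(3) by auto
next
  case (Suc k)
  note f = Ck_on_SucE[OF Suc.prems(1) S] and h = Ck_on_SucE[OF Suc.prems(2) R]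
  have d: "((\<lambda>x. h (f x)) has_derivative
      (\<lambda>e. frechet_derivative f (at x) e *\<^sub>R frechet_derivative h (at (f x)) 1)) (at x)"
    if "x \<in> S" for x
  proof -
    have hd: "(h has_derivative frechet_derivative h (at (f x))) (at (f x))"
      using h(1) fS that by auto
    have lin: "frechet_derivative h (at (f x)) r = r *\<^sub>R frechet_derivative h (at (f x)) 1" for r
      using linear_scale[OF has_derivative_linear[OF hd], of r 1]
      by (simp only: real_scaleR_def mult_1_right)
    show ?thesis
      using diff_chain_at[OF f(1)[OF that] hd] unfolding o_def by (subst (asm) lin)
  qed
  have "Ck_on k S (\<lambda>x. frechet_derivative h (at (f x)) 1)"
    using Suc.IH[OF Ck_on_SucD[OF Suc.prems(1)] h(2)[of 1]] by simp
  then show ?case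
    using f(2) by (intro Ck_on_SucI[OF S d] Ck_on_scaleR[OF S]) auto
qed

lemma Ck_on_powr: "Ck_on k {0<..} (\<lambda>r::real. r powr a)"
proof (induction k arbitrary: a)
  case 0
  then show ?case by (auto intro!: continuous_on_powr continuous_on_id continuous_on_const)
next
  case (Suc k)
  have d: "((\<lambda>r. r powr a) has_derivative (\<lambda>e. (e * a) * r powr (a - 1))) (at r)" if "r \<in> {0<..}" for r :: real
  proof -
    have "(\<lambda>e. (e * a) * r powr (a - 1)) = (*) (a * r powr (a - 1))" by (auto simp: mult_ac)
    then show ?thesis
      using has_real_derivative_powr[of r a] that unfolding has_field_derivative_def by simp
  qed
  have "Ck_on k {0<..} (\<lambda>r. e * a * r powr (a - 1))" for e :: real
    by (rule Ck_on_mult[OF _ Ck_on_const Suc.IH]) auto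
  with Ck_on_SucI[where D="\<lambda>r e. (e * a) * r powr (a - 1)", OF _ d]
  show ?case by (metis open_greaterThan)
qed

text \<open>The norm is the power 1/2 of the smooth function x \<bullet> x, which is positive off
  the origin.\<close>

lemma Ck_on_norm:
  "Ck_on k (- {0}) (norm :: 'a::euclidean_space \<Rightarrow> real)"
proof -
  have "Ck_on k (- {0}) (\<lambda>x::'a. x \<bullet> x)"
    using Ck_on_bilinear[OF bounded_bilinear_inner _ Ck_on_linear Ck_on_linear,
        OF _ bounded_linear_ident _ bounded_linear_ident, of "- {0}"] by auto
  moreover have "(\<lambda>x::'a. x \<bullet> x) ` (- {0}) \<subseteq> {0<..}" by auto
  ultimately have "Ck_on k (- {0}) (\<lambda>x::'a. (x \<bullet> x) powr (1/2))"
    using Ck_on_compose_real[of "- {0}" "{0<..}" "\<lambda>x::'a. x \<bullet> x" k "\<lambda>r. r powr (1/2)"]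
      Ck_on_powr by auto
  then show ?thesis
    by (rule Ck_on_cong[rotated 2]) (auto simp: norm_eq_sqrt_inner powr_half_sqrt)
qed

section \<open>Covariant derivatives in polar form\<close>

lemma sum_UNIV_2: "sum f (UNIV :: 2 set) = f 1 + f 2"
  by (simp add: UNIV_2)

lemma norm_real2: "(norm (x::real^2))\<^sup>2 = (x$1)\<^sup>2 + (x$2)\<^sup>2"
  by (simp add: norm_eq_sqrt_inner inner_vec_def sum_UNIV_2 power2_eq_square)

lemma partial_eqI: "(f has_derivative D) (at x) \<Longrightarrow> partial j f x = D (axis j 1)"
  unfolding partial_def using frechet_derivative_at by metis

lemma partial_cong_open:
  assumes "open S" "x \<in> S" "\<And>y. y \<in> S \<Longrightarrow> f y = g y"
  shows "partial j f x = partial j g x"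
  unfolding partial_def using frechet_derivative_cong_open[OF assms] by simp

lemma cov_partial_cong_open:
  assumes "open S" "x \<in> S" "\<And>y. y \<in> S \<Longrightarrow> f y = g y"
  shows "cov_partial \<alpha> j f x = cov_partial \<alpha> j g x"
  unfolding cov_partial_def using partial_cong_open[OF assms] assms(2,3) by simp

text \<open>The position vector rotated by a right angle. Divided by |x|^2 it is the gradient of the
  polar angle, and \<alpha> times that gradient is the potential.\<close>

definition tang :: "real^2 \<Rightarrow> real^2" where
  "tang x = vector [- (x$2), x$1]"

lemma tang_nth [simp]: "tang x $ 1 = - (x$2)" "tang x $ 2 = x$1"
  by (simp_all add: tang_def)

lemma A_pot_nth: "A_pot \<alpha> x $ j = \<alpha> * tang x $ j / (norm x)\<^sup>2"
  by (simp add: A_pot_def tang_def)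

lemma ang_0 [simp]: "ang 0 x = 1"
  by (simp add: ang_def)

text \<open>A number of modulus one has its conjugate as inverse; at the origin both sides are 0
  because \<open>inverse 0 = 0\<close>. Smoothness of the mode -1 is read off from this
  formula.\<close>

lemma ang_m1: "ang (-1) x = (of_real (x$1) - \<i> * of_real (x$2)) * of_real (inverse (norm x))"
proof -
  have n: "cmod (Complex (x$1) (x$2)) = norm x"
    by (simp add: cmod_def norm_real2[symmetric])
  have "ang (-1) x = inverse (sgn (Complex (x$1) (x$2)))"
    by (simp add: ang_def power_int_minus)
  also have "\<dots> = cnj (sgn (Complex (x$1) (x$2)))"
  proof (cases "Complex (x$1) (x$2) = 0")
    case False
    then have "sgn (Complex (x$1) (x$2)) * cnj (sgn (Complex (x$1) (x$2))) = 1"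
      by (simp add: complex_norm_square[symmetric] norm_sgn)
    then show ?thesis by (rule inverse_unique)
  qed simp
  also have "\<dots> = (of_real (x$1) - \<i> * of_real (x$2)) * of_real (inverse (norm x))"
    unfolding sgn_eq n by (auto simp: complex_eq_iff divide_simps)
  finally show ?thesis .
qed

lemma has_derivative_norm_at:
  "(x::'a::real_inner) \<noteq> 0 \<Longrightarrow> (norm has_derivative (\<lambda>e. (x \<bullet> e) / norm x)) (at x)"
  using has_derivative_norm[of x] by (simp add: sgn_div_norm inner_commute divide_inverse mult.commute)

lemma has_derivative_compose_norm:
  fixes h :: "real \<Rightarrow> 'b::real_normed_vector"
  assumes "(x::real^2) \<noteq> 0" "(h has_vector_derivative h') (at (norm x))"
  shows "((\<lambda>y. h (norm y)) has_derivative (\<lambda>e. ((x \<bullet> e) / norm x) *\<^sub>R h')) (at x)"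
  using diff_chain_at[OF has_derivative_norm_at[OF assms(1)] assms(2)[unfolded has_vector_derivative_def]]
  by (simp add: o_def)

text \<open>The function is exp (i m \<theta>), so its derivative is i m d\<theta> times itself, and
  d\<theta> is the pairing with \<open>tang x\<close> over |x|^2.\<close>

lemma has_derivative_ang:
  assumes m: "m = 0 \<or> m = -1" and x: "x \<noteq> 0"
  shows "(ang m has_derivative (\<lambda>e. \<i> * of_real (of_int m * (tang x \<bullet> e) / (norm x)\<^sup>2) * ang m x)) (at x)"
proof (cases "m = 0")
  case True
  have "ang 0 = (\<lambda>x. 1)" by auto
  with True show ?thesis by simp
next
  case False
  with m have m: "m = -1" by simp
  have inv: "((\<lambda>r. inverse r) has_vector_derivative (- inverse (norm x ^ 2))) (at (norm x))"
    using DERIV_inverse[of "norm x" UNIV] x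
    by (simp add: has_real_derivative_iff_has_vector_derivative numeral_2_eq_2)
  have d: "(ang (-1) has_derivative
      (\<lambda>e. (of_real (x$1) - \<i> * of_real (x$2)) * of_real (((x \<bullet> e) / norm x) *\<^sub>R (- inverse (norm x ^ 2)))
         + (of_real (e$1) - \<i> * of_real (e$2)) * of_real (inverse (norm x)))) (at x)"
    unfolding ang_m1[abs_def]
    by (rule has_derivative_mult[OF _ bounded_linear.has_derivative[OF bounded_linear_of_real has_derivative_compose_norm[OF x inv]]])
       (intro derivative_intros bounded_linear.has_derivative[OF bounded_linear_of_real]
          bounded_linear_imp_has_derivative bounded_linear_vec_nth)
  have n: "norm x > 0" using x by simp
  have e: "(of_real (x$1) - \<i> * of_real (x$2)) * of_real (((x \<bullet> e) / norm x) *\<^sub>R (- inverse (norm x ^ 2)))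
         + (of_real (e$1) - \<i> * of_real (e$2)) * of_real (inverse (norm x))
      = \<i> * of_real (of_int m * (tang x \<bullet> e) / (norm x)\<^sup>2) * ang m x" for e
  proof -
    \<comment> \<open>With x and e read as complex numbers this is |x|^2 conj(e) = conj(x) (x
      conj(e)): the product x conj(e) has real part x \<bullet> e and imaginary part minus
      \<open>tang x \<bullet> e\<close>.\<close>
    have 1: "(of_real (e$1) - \<i> * of_real (e$2)) * of_real ((norm x)\<^sup>2)
      = (of_real (x$1) - \<i> * of_real (x$2)) * (of_real (x \<bullet> e) - \<i> * of_real (tang x \<bullet> e))"
      unfolding norm_real2 by (simp add: inner_vec_def sum_UNIV_2 complex_eq_iff algebra_simps power2_eq_square)
    then have 2: "(of_real (e$1) - \<i> * of_real (e$2))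
      = (of_real (x$1) - \<i> * of_real (x$2)) * (of_real (x \<bullet> e) - \<i> * of_real (tang x \<bullet> e)) / of_real ((norm x)\<^sup>2)"
      using n by (simp add: field_simps)
    show ?thesis unfolding 2 m ang_m1 using n
      by (simp add: field_simps power2_eq_square)
  qed
  show ?thesis using d unfolding e unfolding m .
qed

text \<open>The gradient of the angle and the potential are both multiples of \<open>tang x\<close>
  over |x|^2, so splitting off the mode m only shifts \<alpha> to m + \<alpha>.\<close>

lemma cov_partial_ang:
  assumes m: "m = 0 \<or> m = -1" and x: "x \<noteq> 0" and P: "P differentiable (at x)"
  shows "cov_partial \<alpha> j (\<lambda>y. P y * ang m y) x
    = (partial j P x + \<i> * of_real ((of_int m + \<alpha>) * tang x $ j / (norm x)\<^sup>2) * P x) * ang m x"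
proof -
  obtain D where D: "(P has_derivative D) (at x)" using P unfolding differentiable_def by auto
  have t: "tang x \<bullet> axis j 1 = tang x $ j" by (simp add: inner_axis)
  show ?thesis
    unfolding cov_partial_def partial_eqI[OF D] A_pot_nth
      partial_eqI[OF has_derivative_mult[OF D has_derivative_ang[OF m x]]] t
    by (simp add: algebra_simps add_divide_distrib)
qed

lemma cov_partial_radial:
  fixes h :: "real \<Rightarrow> complex"
  assumes m: "m = 0 \<or> m = -1" and x: "x \<noteq> 0" and h: "(h has_vector_derivative h') (at (norm x))"
  shows "cov_partial \<alpha> j (\<lambda>y. h (norm y) * ang m y) x
    = (of_real (x$j / norm x) * h'
       + \<i> * of_real ((of_int m + \<alpha>) * tang x $ j / (norm x)\<^sup>2) * h (norm x)) * ang m x"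
proof -
  note d = has_derivative_compose_norm[OF x h]
  have "partial j (\<lambda>y. h (norm y)) x = of_real (x$j / norm x) * h'"
    unfolding partial_eqI[OF d] by (simp add: inner_axis scaleR_conv_of_real)
  moreover have "(\<lambda>y. h (norm y)) differentiable (at x)" using d by (auto simp: differentiable_def)
  ultimately show ?thesis
    using cov_partial_ang[OF m x, of "\<lambda>y. h (norm y)" \<alpha> j] by simp
qed

text \<open>The differential expression (-i\<nabla> + A)^2 = -(\<nabla> + iA)^2, evaluated pointwise
  on any field. The link to the Friedrichs operator is made by \<open>H_graphI\<close>.\<close>

definition Hop :: "real \<Rightarrow> fld \<Rightarrow> fld" where
  "Hop \<alpha> f x = - (\<Sum>j\<in>UNIV. cov_partial \<alpha> j (cov_partial \<alpha> j f) x)"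

text \<open>The Laplacian in polar coordinates with angular momentum m + \<alpha>. The first
  derivative of \<open>h\<close> is required at all radii, because the inner covariant derivative
  must be known on a neighbourhood before it is differentiated again.\<close>

lemma Hop_radial:
  fixes h :: "real \<Rightarrow> complex"
  assumes m: "m = 0 \<or> m = -1" and x: "x \<noteq> 0"
    and h1: "\<And>r. r > 0 \<Longrightarrow> (h has_vector_derivative h' r) (at r)"
    and h2: "(h' has_vector_derivative h'') (at (norm x))"
  shows "Hop \<alpha> (\<lambda>y. h (norm y) * ang m y) x
    = - (h'' + h' (norm x) / of_real (norm x)
         - of_real ((of_int m + \<alpha>)\<^sup>2 / (norm x)\<^sup>2) * h (norm x)) * ang m x"
proof -
  define \<mu> where "\<mu> = of_int m + \<alpha>"
  \<comment> \<open>What remains of the first covariant derivative once the angular factor is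
    removed: a radial field with coefficient h'/r and a tangential field with coefficient i \<mu>
    h/r^2.\<close>
  define P where "P j y = of_real (y$j) * (of_real (inverse (norm y)) * h' (norm y))
       + \<i> * of_real (\<mu> * tang y $ j) * (of_real (inverse ((norm y)\<^sup>2)) * h (norm y))" for j and y :: "real^2"
  have n: "norm x > 0" using x by simp
  define k' where "k' = of_real (inverse (norm x)) * h'' + of_real (- inverse ((norm x)\<^sup>2)) * h' (norm x)"
  define l' where "l' = of_real (inverse ((norm x)\<^sup>2)) * h' (norm x) + of_real (- 2 * inverse ((norm x)^3)) * h (norm x)"
  have i1: "((\<lambda>r. of_real (inverse r) :: complex) has_vector_derivative of_real (- inverse ((norm x)\<^sup>2))) (at (norm x))"
    by (rule has_vector_derivative_of_real)
       (use n in \<open>auto intro!: derivative_eq_intros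
        simp: has_real_derivative_iff_has_vector_derivative[symmetric] power2_eq_square\<close>)
  have i2: "((\<lambda>r. of_real (inverse (r\<^sup>2)) :: complex) has_vector_derivative of_real (- 2 * inverse ((norm x)^3))) (at (norm x))"
    by (rule has_vector_derivative_of_real)
       (use n in \<open>auto intro!: derivative_eq_intros
        simp: has_real_derivative_iff_has_vector_derivative[symmetric] field_simps eval_nat_numeral\<close>)
  have k: "((\<lambda>r. of_real (inverse r) * h' r) has_vector_derivative k') (at (norm x))"
    unfolding k'_def by (rule has_vector_derivative_mult[OF i1 h2])
  have l: "((\<lambda>r. of_real (inverse (r\<^sup>2)) * h r) has_vector_derivative l') (at (norm x))"
    unfolding l'_def by (rule has_vector_derivative_mult[OF i2 h1[OF n]])
  have P_eq: "cov_partial \<alpha> j (\<lambda>y. h (norm y) * ang m y) y = P j y * ang m y" if "y \<noteq> 0" for j y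
    using cov_partial_radial[OF m that h1, of \<alpha> j] that
    by (simp add: P_def \<mu>_def field_simps)
  have dP: "(P j has_derivative (\<lambda>e. (of_real (x$j) * (((x \<bullet> e) / norm x) *\<^sub>R k')
        + of_real (e$j) * (of_real (inverse (norm x)) * h' (norm x)))
      + (\<i> * of_real (\<mu> * tang x $ j) * (((x \<bullet> e) / norm x) *\<^sub>R l')
        + \<i> * of_real (\<mu> * tang e $ j) * (of_real (inverse ((norm x)\<^sup>2)) * h (norm x))))) (at x)" for j
  proof -
    have bl: "bounded_linear (\<lambda>y. of_real (y$j) :: complex)"
      by (intro bounded_linear_compose[OF bounded_linear_of_real] bounded_linear_vec_nth)
    have "linear (\<lambda>y. \<i> * of_real (\<mu> * tang y $ j) :: complex)"
      using exhaust_2[of j] by (intro linearI) (auto simp: algebra_simps scaleR_conv_of_real[where 'a=complex])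
    then have bt: "bounded_linear (\<lambda>y. \<i> * of_real (\<mu> * tang y $ j) :: complex)"
      by (rule linear_conv_bounded_linear[THEN iffD1])
    show ?thesis unfolding P_def
      by (intro has_derivative_add has_derivative_mult bounded_linear_imp_has_derivative[OF bl]
          bounded_linear_imp_has_derivative[OF bt] has_derivative_compose_norm[OF x k] has_derivative_compose_norm[OF x l])
  qed
  have "cov_partial \<alpha> j (cov_partial \<alpha> j (\<lambda>y. h (norm y) * ang m y)) x
     = (partial j (P j) x + \<i> * of_real (\<mu> * tang x $ j / (norm x)\<^sup>2) * P j x) * ang m x" for j
  proof -
    have "cov_partial \<alpha> j (cov_partial \<alpha> j (\<lambda>y. h (norm y) * ang m y)) x = cov_partial \<alpha> j (\<lambda>y. P j y * ang m y) x"
      by (rule cov_partial_cong_open[of "- {0}"]) (use x P_eq in auto)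
    moreover have "P j differentiable (at x)" using dP[of j] unfolding differentiable_def by blast
    ultimately show ?thesis using cov_partial_ang[OF m x, of "P j" \<alpha> j] unfolding \<mu>_def by simp
  qed
  then have H: "Hop \<alpha> (\<lambda>y. h (norm y) * ang m y) x
     = - (\<Sum>j\<in>UNIV. partial j (P j) x + \<i> * of_real (\<mu> * tang x $ j / (norm x)\<^sup>2) * P j x) * ang m x"
    by (simp add: Hop_def sum_distrib_right)
  have sq: "x$2 * x$2 = norm x * norm x - x$1 * x$1" using norm_real2[of x] by (simp add: power2_eq_square)
  \<comment> \<open>The tangential field has divergence zero, so only the radial one
    contributes.\<close>
  have a: "(\<Sum>j\<in>UNIV. partial j (P j) x) = h'' + h' (norm x) / of_real (norm x)"
  proof -
    have "(\<Sum>j\<in>UNIV. partial j (P j) x) = of_real (norm x) * k' + 2 * (of_real (inverse (norm x)) * h' (norm x))"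
    proof -
      have ax: "axis 1 (1::real) $ (2::2) = 0" "axis 2 (1::real) $ (1::2) = 0" by (simp_all add: axis_def)
      have "(\<Sum>j\<in>UNIV. partial j (P j) x)
        = of_real ((x$1 * x$1 + x$2 * x$2) / norm x) * k' + 2 * (of_real (inverse (norm x)) * h' (norm x))"
        unfolding partial_eqI[OF dP] by (simp add: sum_UNIV_2 inner_axis ax scaleR_conv_of_real add_divide_distrib algebra_simps)
      then show ?thesis using n by (simp add: sq)
    qed
    then show ?thesis unfolding k'_def using n by (simp add: field_simps power2_eq_square)
  qed
  \<comment> \<open>Here the radial field drops out, since \<open>tang x\<close> is orthogonal to x;
    the equal lengths of the two vectors give the factor |x|^2.\<close>
  have b: "(\<Sum>j\<in>UNIV. \<i> * of_real (\<mu> * tang x $ j / (norm x)\<^sup>2) * P j x)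
      = - of_real (\<mu>\<^sup>2 / (norm x)\<^sup>2) * h (norm x)"
  proof -
    have "(\<Sum>j\<in>UNIV. \<i> * of_real (\<mu> * tang x $ j / (norm x)\<^sup>2) * P j x)
       = - of_real (\<mu>\<^sup>2 * (x$1 * x$1 + x$2 * x$2) / (norm x)\<^sup>2 * inverse ((norm x)\<^sup>2)) * h (norm x)"
      unfolding P_def by (simp add: sum_UNIV_2 algebra_simps add_divide_distrib power2_eq_square)
    then show ?thesis using n by (simp add: sq power2_eq_square field_simps)
  qed
  show ?thesis unfolding H sum.distrib a b \<mu>_def[symmetric] by (simp add: algebra_simps)
qed

subsection \<open>Test functions\<close>

lemma Ck_on_nth: "Ck_on k (- {0}) (\<lambda>x::real^2. x $ j)"
  by (rule Ck_on_linear) (auto intro: bounded_linear_vec_nth)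

lemma Ck_on_of_real: "open S \<Longrightarrow> Ck_on k S f \<Longrightarrow> Ck_on k S (\<lambda>x. complex_of_real (f x))"
  by (rule Ck_on_bounded_linear[OF bounded_linear_of_real])

lemma Ck_on_cnj: "open S \<Longrightarrow> Ck_on k S f \<Longrightarrow> Ck_on k S (\<lambda>x. cnj (f x))"
  by (rule Ck_on_bounded_linear[OF bounded_linear_cnj])

lemma Ck_on_norm_powr: "Ck_on k (- {0}) (\<lambda>x::'a::euclidean_space. norm x powr a)"
  by (rule Ck_on_compose_real[OF _ _ _ Ck_on_norm Ck_on_powr]) auto

lemma Ck_on_ang:
  assumes m: "m = 0 \<or> m = -1"
  shows "Ck_on k (- {0}) (ang m)"
proof (cases "m = 0")
  case True
  have "ang 0 = (\<lambda>x. 1)" by auto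
  with True show ?thesis by (simp add: Ck_on_const)
next
  case False
  with m have m: "m = -1" by simp
  have "Ck_on k (- {0}) (\<lambda>x::real^2. (of_real (x$1) + (- \<i>) * of_real (x$2)) * complex_of_real (norm x powr (-1)))"
    by (intro Ck_on_mult Ck_on_add Ck_on_of_real Ck_on_nth Ck_on_const Ck_on_norm_powr) auto
  then show ?thesis unfolding m ang_m1[abs_def] by (simp add: divide_inverse)
qed

lemma Ck_on_radial:
  fixes h :: "real \<Rightarrow> complex"
  assumes m: "m = 0 \<or> m = -1" and h: "Ck_on k {0<..} h"
  shows "Ck_on k (- {0}) (\<lambda>x. h (norm x) * ang m x)"
proof (rule Ck_on_mult[OF _ _ Ck_on_ang[OF m]])
  show "Ck_on k (- {0}) (\<lambda>x::real^2. h (norm x))"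
    by (rule Ck_on_compose_real[OF _ _ _ Ck_on_norm h]) auto
qed auto

text \<open>A form of \<open>test_funs\<close> that records the order of differentiability and one
  compact set outside which the function vanishes. The same set can be kept under
  differentiation.\<close>

definition tst :: "nat \<Rightarrow> (real^2) set \<Rightarrow> fld \<Rightarrow> bool" where
  "tst k K f \<longleftrightarrow> Ck_on k UNIV f \<and> compact K \<and> 0 \<notin> K \<and> (\<forall>x. x \<notin> K \<longrightarrow> f x = 0)"

text \<open>Smoothness is checked only off the origin: near the origin the function is zero, and the
  complements of {0} and of \<open>K\<close> cover the plane.\<close>

lemma tstI:
  assumes "Ck_on k (- {0}) f" "compact K" "0 \<notin> K" "\<And>x. x \<notin> K \<Longrightarrow> f x = 0"
  shows "tst k K f"
proof -
  have o: "open (- K)" using assms(2) compact_imp_closed by blast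
  have "Ck_on k (- K) f"
    by (rule Ck_on_cong[OF o _ Ck_on_const[where c=0]]) (use assms(4) in auto)
  then have "Ck_on k (- {0} \<union> - K) f" using o assms(1) by (intro Ck_on_Un) auto
  moreover have "- {0} \<union> - K = UNIV" using assms(3) by auto
  ultimately show ?thesis using assms by (simp add: tst_def)
qed

lemma tst_radial:
  fixes h :: "real \<Rightarrow> complex"
  assumes m: "m = 0 \<or> m = -1" and h: "Ck_on k {0<..} h" and d: "d > 0"
    and h0: "\<And>r. 0 \<le> r \<Longrightarrow> r < d \<Longrightarrow> h r = 0" and hR: "\<And>r. r \<ge> R \<Longrightarrow> h r = 0"
  shows "tst k {x. d \<le> norm x \<and> norm x \<le> R} (\<lambda>x. h (norm x) * ang m x)"
proof (rule tstI[OF Ck_on_radial[OF m h]])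
  have "{x::real^2. d \<le> norm x \<and> norm x \<le> R} = cball 0 R - ball 0 d" by auto
  then show "compact {x::real^2. d \<le> norm x \<and> norm x \<le> R}" by (simp add: compact_diff)
qed (use d h0 hR in \<open>auto simp: not_le\<close>)

lemma tst_imp_test_funs:
  assumes "\<And>k. tst k K f"
  shows "f \<in> test_funs"
proof -
  have K: "compact K" "0 \<notin> K" "\<And>x. x \<notin> K \<Longrightarrow> f x = 0" using assms by (auto simp: tst_def)
  have c: "closure {x. f x \<noteq> 0} \<subseteq> K"
    using K by (intro closure_minimal compact_imp_closed) auto
  moreover have "compact (closure {x. f x \<noteq> 0})"
    using c K(1) by (metis closed_Int_compact closed_closure inf.absorb_iff1)
  ultimately show ?thesis using K assms by (auto simp: test_funs_def smooth_on_def tst_def)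
qed

lemma test_funs_imp_tst:
  assumes "f \<in> test_funs"
  obtains K where "\<And>k. tst k K f"
proof
  show "tst k (closure {x. f x \<noteq> 0}) f" for k
    using assms closure_subset[of "{x. f x \<noteq> 0}"] by (auto simp: test_funs_def smooth_on_def tst_def)
qed

lemma test_funs_radial:
  fixes h :: "real \<Rightarrow> complex"
  assumes "m = 0 \<or> m = -1" "smooth_on {0<..} h" "d > 0"
    "\<And>r. 0 \<le> r \<Longrightarrow> r < d \<Longrightarrow> h r = 0" "\<And>r. r \<ge> R \<Longrightarrow> h r = 0"
  shows "(\<lambda>x. h (norm x) * ang m x) \<in> test_funs"
proof (rule tst_imp_test_funs)
  show "tst k {x. d \<le> norm x \<and> norm x \<le> R} (\<lambda>x. h (norm x) * ang m x)" for k
    by (rule tst_radial[OF assms(1) _ assms(3-5)]) (use assms(2) in \<open>auto simp: smooth_on_def\<close>)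
qed

lemma Ck_on_partial: "Ck_on (Suc k) S f \<Longrightarrow> Ck_on k S (partial j f)"
  unfolding partial_def[abs_def] by (simp add: axis_in_Basis_iff)

lemma partial_zero:
  assumes "closed K" "\<And>x. x \<notin> K \<Longrightarrow> f x = 0" "x \<notin> K"
  shows "partial j f x = 0"
proof -
  have "partial j f x = partial j (\<lambda>x. 0) x"
    by (rule partial_cong_open[of "- K"]) (use assms in auto)
  then show ?thesis by (simp add: partial_def frechet_derivative_const)
qed

lemma Ck_on_cov_partial:
  assumes "Ck_on (Suc k) (- {0}) f"
  shows "Ck_on k (- {0}) (cov_partial \<alpha> j f)"
proof -
  have bt: "bounded_linear (\<lambda>y. \<alpha> * tang y $ j)"
    using exhaust_2[of j] by (intro linear_conv_bounded_linear[THEN iffD1] linearI) (auto simp: algebra_simps)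
  have "Ck_on k (- {0}) (\<lambda>x. partial j f x + \<i> * of_real (\<alpha> * tang x $ j * norm x powr (-2)) * f x)"
    by (intro Ck_on_add Ck_on_mult Ck_on_const Ck_on_of_real Ck_on_norm_powr Ck_on_partial[OF assms]
        Ck_on_SucD[OF assms] Ck_on_linear[OF bt]) auto
  then show ?thesis
    by (rule Ck_on_cong[rotated 2]) (auto simp: cov_partial_def A_pot_nth powr_minus divide_inverse)
qed

lemma tst_cov_partial:
  assumes "tst (Suc k) K f"
  shows "tst k K (cov_partial \<alpha> j f)"
proof (rule tstI)
  show "Ck_on k (- {0}) (cov_partial \<alpha> j f)"
    using assms Ck_on_subset[of "Suc k" UNIV f "- {0}"] by (intro Ck_on_cov_partial) (auto simp: tst_def)
  show "cov_partial \<alpha> j f x = 0" if "x \<notin> K" for x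
    using assms that partial_zero[of K f x j] compact_imp_closed
    by (auto simp: cov_partial_def tst_def)
qed (use assms in \<open>auto simp: tst_def\<close>)

lemma tst_subset0: "tst k K f \<Longrightarrow> Ck_on k (- {0}) f"
  using Ck_on_subset[of k UNIV f "- {0}"] by (auto simp: tst_def)

lemma tst_SucD: "tst (Suc k) K f \<Longrightarrow> tst k K f"
  unfolding tst_def by (meson Ck_on_SucD)

text \<open>Multiplication by a test function removes any singularity at the origin. Integrability
  of products with singular functions is obtained this way throughout.\<close>

lemma tst_mult_cnj:
  assumes "Ck_on k (- {0}) f" "tst k K g"
  shows "tst k K (\<lambda>x. f x * cnj (g x))"
  using assms(2) by (intro tstI Ck_on_mult Ck_on_cnj assms(1) tst_subset0[OF assms(2)]) (auto simp: tst_def)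

subsection \<open>Integration by parts\<close>

lemma tst_continuous: "tst k K f \<Longrightarrow> continuous_on UNIV f"
proof (induction k)
  case (Suc k)
  then show ?case by (metis tst_SucD)
qed (simp add: tst_def)

lemma tst_bounded:
  assumes "tst k K f"
  obtains B where "\<And>x. norm (f x) \<le> B" "B \<ge> 0"
proof -
  have "compact (f ` K)"
    using assms continuous_on_subset[OF tst_continuous[OF assms], of K]
    by (intro compact_continuous_image) (auto simp: tst_def)
  then obtain B where B: "\<And>y. y \<in> f ` K \<Longrightarrow> norm y \<le> B"
    using compact_imp_bounded bounded_iff by metis
  have "norm (f x) \<le> max B 0" for x
  proof (cases "x \<in> K")
    case True
    then show ?thesis using B[of "f x"] by auto
  next
    case False
    then show ?thesis using assms by (auto simp: tst_def)
  qed
  then show ?thesis using that[of "max B 0"] by auto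
qed

lemma tst_integrable:
  assumes "tst k K f"
  shows "integrable lborel f"
proof -
  have "integrable lborel (\<lambda>x. indicator K x *\<^sub>R f x)"
    using assms continuous_on_subset[OF tst_continuous[OF assms], of K]
    by (intro borel_integrable_compact) (auto simp: tst_def)
  moreover have "(\<lambda>x. indicator K x *\<^sub>R f x) = f"
    using assms by (auto simp: tst_def indicator_def fun_eq_iff)
  ultimately show ?thesis by simp
qed

lemma integral_translate:
  fixes F :: "'a::euclidean_space \<Rightarrow> 'b::{banach,second_countable_topology}"
  assumes "integrable lborel F"
  shows "integrable lborel (\<lambda>x. F (x + e))" "integral\<^sup>L lborel (\<lambda>x. F (x + e)) = integral\<^sup>L lborel F"
proof -
  have m: "F \<in> borel_measurable borel" using assms by auto
  have *: "integrable (distr lborel borel ((+) e)) F" using assms by (simp add: lborel_distr_plus)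
  then show "integrable lborel (\<lambda>x. F (x + e))"
    by (subst (asm) integrable_distr_eq) (use m in \<open>auto simp: add.commute\<close>)
  have "integral\<^sup>L lborel F = integral\<^sup>L (distr lborel borel ((+) e)) F" by (simp add: lborel_distr_plus)
  also have "\<dots> = integral\<^sup>L lborel (\<lambda>x. F (x + e))"
    by (subst integral_distr) (use m in \<open>auto simp: add.commute\<close>)
  finally show "integral\<^sup>L lborel (\<lambda>x. F (x + e)) = integral\<^sup>L lborel F" by simp
qed

lemma tst_partial:
  assumes "tst (Suc k) K f"
  shows "tst k K (partial j f)"
  using assms Ck_on_partial[of k UNIV f j] partial_zero[of K f _ j] compact_imp_closed
  by (auto simp: tst_def)

text \<open>Dominated convergence and the increments of Duhamel's formula both deal with difference
  quotients, hence this form of the vector derivative.\<close>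

lemma has_vector_derivative_iff_tendsto:
  fixes f :: "real \<Rightarrow> 'a::real_normed_vector"
  shows "(f has_vector_derivative d) (at x) \<longleftrightarrow> ((\<lambda>y. (f y - f x) /\<^sub>R (y - x)) \<longlongrightarrow> d) (at x)"
proof -
  have eq: "norm ((f y - f x) - (y - x) *\<^sub>R d) / norm (y - x) = norm ((f y - f x) /\<^sub>R (y - x) - d)"
    if "y \<noteq> x" for y
  proof -
    have "(f y - f x) /\<^sub>R (y - x) - d = ((f y - f x) - (y - x) *\<^sub>R d) /\<^sub>R (y - x)"
      using that by (simp add: scaleR_right_diff_distrib)
    then show ?thesis by (simp add: divide_inverse)
  qed
  have "(f has_vector_derivative d) (at x) \<longleftrightarrow>
      ((\<lambda>y. norm ((f y - f x) - (y - x) *\<^sub>R d) / norm (y - x)) \<longlongrightarrow> 0) (at x)"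
    by (simp add: has_vector_derivative_def has_derivative_iff_norm bounded_linear_scaleR_left)
  also have "\<dots> \<longleftrightarrow> ((\<lambda>y. norm ((f y - f x) /\<^sub>R (y - x) - d)) \<longlongrightarrow> 0) (at x)"
    using eq by (intro tendsto_cong) (auto simp: eventually_at_filter)
  also have "\<dots> \<longleftrightarrow> ((\<lambda>y. (f y - f x) /\<^sub>R (y - x)) \<longlongrightarrow> d) (at x)"
    by (simp add: tendsto_norm_zero_iff LIM_zero_iff)
  finally show ?thesis .
qed

text \<open>By translation invariance every difference quotient has integral zero.\<close>

lemma integral_partial_zero:
  assumes F: "tst 1 K F"
  shows "integral\<^sup>L lborel (partial j F) = 0"
proof -
  define e :: "real^2" where "e = axis j 1"
  have ne: "norm e = 1" by (simp add: e_def)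
  have F': "tst (Suc 0) K F" using F by simp
  obtain B where B: "\<And>x. norm (partial j F x) \<le> B" "B \<ge> 0"
    using tst_bounded[OF tst_partial[OF F']] by metis
  have dF: "(F has_derivative frechet_derivative F (at x)) (at x)" for x
    using F' by (intro Ck_on_SucE(1)[where S=UNIV and k=0]) (auto simp: tst_def)
  have dl: "((\<lambda>s. F (x + s *\<^sub>R e)) has_vector_derivative partial j F (x + s *\<^sub>R e)) (at s)" for x s
  proof -
    have "((\<lambda>s. x + s *\<^sub>R e) has_derivative (\<lambda>r. r *\<^sub>R e)) (at s)"
      by (auto intro!: derivative_eq_intros)
    from diff_chain_at[OF this dF] have
      "((\<lambda>s. F (x + s *\<^sub>R e)) has_derivative (\<lambda>r. frechet_derivative F (at (x + s *\<^sub>R e)) (r *\<^sub>R e))) (at s)"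
      by (simp add: o_def)
    then show ?thesis
      using linear_scale[OF has_derivative_linear[OF dF]]
      by (simp add: has_vector_derivative_def partial_def e_def)
  qed
  define q where "q n x = (F (x + (1 / Suc n) *\<^sub>R e) - F x) /\<^sub>R (1 / Suc n)" for n :: nat and x
  have lim: "(\<lambda>n. q n x) \<longlonglongrightarrow> partial j F x" for x
  proof -
    have "((\<lambda>s. (F (x + s *\<^sub>R e) - F x) /\<^sub>R s) \<longlongrightarrow> partial j F x) (at 0)"
      using has_vector_derivative_iff_tendsto[THEN iffD1, OF dl[of x 0]] by simp
    moreover have "filterlim (\<lambda>n. 1 / real (Suc n)) (at 0) sequentially"
      unfolding filterlim_at using LIMSEQ_inverse_real_of_nat
      by (auto simp: inverse_eq_divide)
    ultimately show ?thesis unfolding q_def by (rule filterlim_compose)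
  qed
  obtain R where R: "\<And>x. x \<in> K \<Longrightarrow> norm x \<le> R"
    using F compact_imp_bounded[of K] bounded_iff unfolding tst_def by metis
  \<comment> \<open>A dominating function: the mean value theorem bounds the quotient by
    \<open>B\<close>, and a shift of length at most 1 keeps its support in the ball of radius R +
    1.\<close>
  have bound: "norm (q n x) \<le> B * indicator (cball 0 (R + 1)) x" for n x
  proof (cases "x \<in> cball 0 (R + 1)")
    case True
    have "norm (F (x + (1 / Suc n) *\<^sub>R e) - F (x + 0 *\<^sub>R e)) \<le> B * norm (1 / real (Suc n) - 0)"
    proof (rule differentiable_bound[where S=UNIV and f="\<lambda>s. F (x + s *\<^sub>R e)"])
      show "((\<lambda>s. F (x + s *\<^sub>R e)) has_derivative (\<lambda>r. r *\<^sub>R partial j F (x + s *\<^sub>R e))) (at s within UNIV)" for s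
        using dl[of x s] by (simp add: has_vector_derivative_def)
      show "onorm (\<lambda>r. r *\<^sub>R partial j F (x + s *\<^sub>R e)) \<le> B" for s
        using B by (intro onorm_bound) (auto simp: mult.commute[of B] mult_left_mono)
    qed auto
    then have "norm (F (x + (1 / Suc n) *\<^sub>R e) - F x) * real (Suc n) \<le> B"
      by (simp add: pos_le_divide_eq[symmetric])
    moreover have "norm (q n x) = norm (F (x + (1 / Suc n) *\<^sub>R e) - F x) * real (Suc n)"
      unfolding q_def norm_scaleR by simp
    ultimately show ?thesis using True by simp
  next
    case False
    have "norm ((1 / Suc n) *\<^sub>R e) \<le> 1" by (simp add: ne)
    then have "norm (x + (1 / Suc n) *\<^sub>R e) > R" "norm x > R"
      using False norm_diff_ineq[of x "(1 / Suc n) *\<^sub>R e"] unfolding mem_cball_0 by linarith+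
    then have "x + (1 / Suc n) *\<^sub>R e \<notin> K" "x \<notin> K" using R by force+
    then show ?thesis using F False by (simp add: q_def tst_def)
  qed
  have int: "integrable lborel F" by (rule tst_integrable[OF F])
  have z: "integral\<^sup>L lborel (q n) = 0" for n
    unfolding q_def using integral_translate[OF int, of "(1 / Suc n) *\<^sub>R e"] int by simp
  have "(\<lambda>n. integral\<^sup>L lborel (q n)) \<longlonglongrightarrow> integral\<^sup>L lborel (partial j F)"
  proof (rule integral_dominated_convergence)
    show "partial j F \<in> borel_measurable lborel"
      using tst_integrable[OF tst_partial[OF F']] by auto
    show "q n \<in> borel_measurable lborel" for n
      unfolding q_def using int integral_translate(1)[OF int] by measurable
    have "integrable lborel (\<lambda>x. indicator (cball (0::real^2) (R + 1)) x *\<^sub>R B)"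
      by (intro borel_integrable_compact) auto
    then show "integrable lborel (\<lambda>x. B * indicator (cball (0::real^2) (R + 1)) x)"
      by (simp add: mult.commute)
    show "AE x in lborel. (\<lambda>n. q n x) \<longlonglongrightarrow> partial j F x" using lim by auto
    show "AE x in lborel. norm (q n x) \<le> B * indicator (cball 0 (R + 1)) x" for n
      using bound by auto
  qed
  with z show ?thesis by (simp add: LIMSEQ_const_iff)
qed

text \<open>The potential enters as iA, which is purely imaginary, so its two contributions cancel
  in the product rule for f times the conjugate of g. The total derivative then integrates to zero.
  The behaviour of \<open>f\<close> at the origin does not matter, because \<open>g\<close> vanishes
  nearby.\<close>

lemma cov_partial_ibp:
  assumes f: "Ck_on 1 (- {0}) f" and g: "tst 1 K g"
  shows "pairing (cov_partial \<alpha> j f) g = - pairing f (cov_partial \<alpha> j g)"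
proof -
  have f': "Ck_on (Suc 0) (- {0}) f" and g': "tst (Suc 0) K g" using f g by simp_all
  have K: "closed K" "0 \<notin> K" "\<And>x. x \<notin> K \<Longrightarrow> g x = 0"
    using g compact_imp_closed by (auto simp: tst_def)
  have eq: "partial j (\<lambda>x. f x * cnj (g x)) x = cov_partial \<alpha> j f x * cnj (g x) + f x * cnj (cov_partial \<alpha> j g x)" for x
  proof (cases "x \<in> K")
    case True
    then have x: "x \<in> - {0}" using K by auto
    have df: "(f has_derivative frechet_derivative f (at x)) (at x)"
      by (rule Ck_on_SucE(1)[OF f' _ x]) auto
    have dg: "(g has_derivative frechet_derivative g (at x)) (at x)"
      by (rule Ck_on_SucE(1)[OF tst_subset0[OF g'] _ x]) auto
    show ?thesis
      unfolding partial_eqI[OF has_derivative_mult[OF df bounded_linear.has_derivative[OF bounded_linear_cnj dg]]]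
      by (simp add: cov_partial_def partial_def algebra_simps)
  next
    case False
    then show ?thesis
      using partial_zero[OF K(1,3)] partial_zero[OF K(1), of "\<lambda>x. f x * cnj (g x)"] K(3)
      by (simp add: cov_partial_def)
  qed
  have i1: "integrable lborel (\<lambda>x. cov_partial \<alpha> j f x * cnj (g x))"
    by (rule tst_integrable[OF tst_mult_cnj[OF Ck_on_cov_partial[OF f'] tst_SucD[OF g']]])
  have i2: "integrable lborel (\<lambda>x. f x * cnj (cov_partial \<alpha> j g x))"
    by (rule tst_integrable[OF tst_mult_cnj[OF Ck_on_SucD[OF f'] tst_cov_partial[OF g']]])
  show ?thesis
    using integral_partial_zero[OF tst_mult_cnj[OF f g], of j] i1 i2
    unfolding eq[abs_def] pairing_def by (simp add: Bochner_Integration.integral_add add_eq_0_iff)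
qed

text \<open>Both derivatives end up on \<open>g\<close>, so one derivative of \<open>f\<close> off
  the origin is enough.\<close>

lemma core_form_eq_pairing_Hop:
  assumes f: "Ck_on 1 (- {0}) f" and g: "tst 2 K g"
  shows "(\<integral> x. (\<Sum>j\<in>UNIV. cov_partial \<alpha> j f x * cnj (cov_partial \<alpha> j g x)) \<partial>lborel) = pairing f (Hop \<alpha> g)"
proof -
  have g': "tst (Suc (Suc 0)) K g" using g by (simp add: numeral_2_eq_2)
  have f': "Ck_on (Suc 0) (- {0}) f" using f by simp
  note gj = tst_cov_partial[OF g', of \<alpha>]
  have i1: "integrable lborel (\<lambda>x. cov_partial \<alpha> j f x * cnj (cov_partial \<alpha> j g x))" for j
    by (rule tst_integrable[OF tst_mult_cnj[OF Ck_on_cov_partial[OF f'] tst_SucD[OF gj]]])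
  have i2: "integrable lborel (\<lambda>x. f x * cnj (cov_partial \<alpha> j (cov_partial \<alpha> j g) x))" for j
    by (rule tst_integrable[OF tst_mult_cnj[OF Ck_on_SucD[OF f'] tst_cov_partial[OF gj]]])
  have "(\<integral> x. (\<Sum>j\<in>UNIV. cov_partial \<alpha> j f x * cnj (cov_partial \<alpha> j g x)) \<partial>lborel)
    = (\<Sum>j\<in>UNIV. pairing (cov_partial \<alpha> j f) (cov_partial \<alpha> j g))"
    unfolding pairing_def by (rule Bochner_Integration.integral_sum) (use i1 in auto)
  also have "\<dots> = (\<Sum>j\<in>UNIV. - pairing f (cov_partial \<alpha> j (cov_partial \<alpha> j g)))"
    using cov_partial_ibp[OF f, of K] gj by (simp add: One_nat_def)
  also have "\<dots> = pairing f (Hop \<alpha> g)"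
  proof -
    have eq: "f x * cnj (Hop \<alpha> g x) = - (f x * cnj (cov_partial \<alpha> 1 (cov_partial \<alpha> 1 g) x))
        + - (f x * cnj (cov_partial \<alpha> 2 (cov_partial \<alpha> 2 g) x))" for x
      by (simp add: Hop_def sum_UNIV_2 algebra_simps)
    show ?thesis unfolding pairing_def eq
      by (subst Bochner_Integration.integral_add) (use i2 in \<open>auto simp: sum_UNIV_2\<close>)
  qed
  finally show ?thesis .
qed

text \<open>No boundary term arises at the origin because \<open>g\<close> vanishes nearby. It is
  applied among others to the profile and to the explicit waves, which are not smooth there.\<close>

lemma pairing_Hop_sym:
  assumes f: "Ck_on 2 (- {0}) f" and g: "tst 2 K g"
  shows "pairing f (Hop \<alpha> g) = pairing (Hop \<alpha> f) g"
proof -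
  have g': "tst (Suc (Suc 0)) K g" using g by (simp add: numeral_2_eq_2)
  have f': "Ck_on (Suc (Suc 0)) (- {0}) f" using f by (simp add: numeral_2_eq_2)
  note gj = tst_cov_partial[OF g', of \<alpha>] and fj = Ck_on_cov_partial[OF f', of \<alpha>]
  have i1: "integrable lborel (\<lambda>x. cov_partial \<alpha> j f x * cnj (cov_partial \<alpha> j g x))" for j
    by (rule tst_integrable[OF tst_mult_cnj[OF Ck_on_SucD[OF fj] tst_SucD[OF gj]]])
  have i2: "integrable lborel (\<lambda>x. cov_partial \<alpha> j (cov_partial \<alpha> j f) x * cnj (g x))" for j
    by (rule tst_integrable[OF tst_mult_cnj[OF Ck_on_cov_partial[OF fj] tst_SucD[OF tst_SucD[OF g']]]])
  have "pairing f (Hop \<alpha> g) = (\<integral> x. (\<Sum>j\<in>UNIV. cov_partial \<alpha> j f x * cnj (cov_partial \<alpha> j g x)) \<partial>lborel)"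
    by (rule core_form_eq_pairing_Hop[OF Ck_on_SucD[OF f', folded One_nat_def] g, symmetric])
  also have "\<dots> = (\<Sum>j\<in>UNIV. pairing (cov_partial \<alpha> j f) (cov_partial \<alpha> j g))" unfolding pairing_def
    by (rule Bochner_Integration.integral_sum) (use i1 in auto)
  also have "\<dots> = (\<Sum>j\<in>UNIV. - pairing (cov_partial \<alpha> j (cov_partial \<alpha> j f)) g)"
    using cov_partial_ibp[of "cov_partial \<alpha> _ f" K g] fj tst_SucD[OF g'] by (simp add: One_nat_def)
  also have "\<dots> = pairing (Hop \<alpha> f) g"
  proof -
    have eq: "Hop \<alpha> f x * cnj (g x) = - (cov_partial \<alpha> 1 (cov_partial \<alpha> 1 f) x * cnj (g x))
        + - (cov_partial \<alpha> 2 (cov_partial \<alpha> 2 f) x * cnj (g x))" for x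
      by (simp add: Hop_def sum_UNIV_2 algebra_simps)
    show ?thesis unfolding pairing_def eq
      by (subst Bochner_Integration.integral_add) (use i2 in \<open>auto simp: sum_UNIV_2\<close>)
  qed
  finally show ?thesis .
qed

subsection \<open>The Hilbert space norm\<close>

lemma eroot_less_top [simp]: "eroot p y < top \<longleftrightarrow> y < top"
  by (auto simp: eroot_def less_top[symmetric])

lemma eroot_ennreal: "a \<ge> 0 \<Longrightarrow> eroot p (ennreal a) = ennreal (root p a)"
  by (simp add: eroot_def)

lemma eroot_power: "p > 0 \<Longrightarrow> (eroot p y) ^ p = y"
  by (cases y rule: ennreal_cases)
     (auto simp: eroot_def ennreal_power top_power_ennreal)

lemma eLp_power: "p > 0 \<Longrightarrow> eLp M p g ^ p = (\<integral>\<^sup>+ x. g x ^ p \<partial>M)"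
  by (simp add: eLp_def eroot_power)

lemma ennreal_power_less_iff:
  fixes y :: ennreal
  assumes "p > 0" "e \<ge> 0"
  shows "y < ennreal e \<longleftrightarrow> y ^ p < ennreal (e ^ p)"
proof (cases y rule: ennreal_cases)
  case (real r)
  then show ?thesis using assms power_mono_iff[of e r p]
    by (simp add: ennreal_power ennreal_less_iff) (metis not_le power_mono_iff)
next
  case top
  then show ?thesis using assms by (auto simp: top_power_ennreal)
qed

lemma ennreal_power_le_iff:
  fixes y :: ennreal
  assumes "p > 0" "e \<ge> 0"
  shows "y \<le> ennreal e \<longleftrightarrow> y ^ p \<le> ennreal (e ^ p)"
proof (cases y rule: ennreal_cases)
  case (real r)
  then show ?thesis using assms power_mono_iff[of r e p]
    by (auto simp: ennreal_power)
next
  case top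
  then show ?thesis using assms by (auto simp: top_power_ennreal top_unique)
qed

text \<open>A real-valued norm for arithmetic with inequalities. It agrees with
  \<open>Lp_norm 2\<close> on \<open>L2\<close>; outside, the Bochner integral may take its default
  value 0.\<close>

definition l2 :: "fld \<Rightarrow> real" where
  "l2 f = sqrt (\<integral> x. (norm (f x))\<^sup>2 \<partial>lborel)"

lemma l2_nonneg [simp]: "l2 f \<ge> 0"
  by (simp add: l2_def)

lemma l2_sq: "(l2 f)\<^sup>2 = (\<integral> x. (norm (f x))\<^sup>2 \<partial>lborel)"
  by (simp add: l2_def)

lemma Lp_norm_2: "Lp_norm 2 f = eroot 2 (\<integral>\<^sup>+ x. ennreal ((norm (f x))\<^sup>2) \<partial>lborel)"
  by (simp add: Lp_norm_def eLp_def ennreal_power)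

lemma L2_iff: "f \<in> L2 \<longleftrightarrow> f \<in> borel_measurable lborel \<and> integrable lborel (\<lambda>x. (norm (f x))\<^sup>2)"
  by (auto simp: L2_def Lp_norm_2 integrable_iff_bounded)

lemma L2_measurable: "f \<in> L2 \<Longrightarrow> f \<in> borel_measurable borel"
  by (simp add: L2_def)

lemma Lp_norm_l2: "f \<in> L2 \<Longrightarrow> Lp_norm 2 f = ennreal (l2 f)"
  unfolding Lp_norm_2 l2_def L2_iff by (simp add: nn_integral_eq_integral eroot_ennreal sqrt_def)

lemma cnj_measurable [measurable]:
  "f \<in> borel_measurable M \<Longrightarrow> (\<lambda>x. cnj (f x)) \<in> borel_measurable M"
  by (rule borel_measurable_continuous_on[OF continuous_on_cnj[OF continuous_on_id]])

lemma L2_add: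
  assumes "f \<in> L2" "g \<in> L2" shows "(\<lambda>x. f x + g x) \<in> L2"
proof -
  have [measurable]: "f \<in> borel_measurable borel" "g \<in> borel_measurable borel" using assms by (auto simp: L2_def)
  have "integrable lborel (\<lambda>x. 2 * (norm (f x))\<^sup>2 + 2 * (norm (g x))\<^sup>2)"
    using assms by (auto simp: L2_iff)
  then have "integrable lborel (\<lambda>x. (norm (f x + g x))\<^sup>2)"
  proof (rule Bochner_Integration.integrable_bound)
    have "(norm (f x + g x))\<^sup>2 \<le> 2 * (norm (f x))\<^sup>2 + 2 * (norm (g x))\<^sup>2" for x
      using power_mono[OF norm_triangle_ineq[of "f x" "g x"], of 2] sum_squares_bound[of "norm (f x)" "norm (g x)"]
      by (simp add: power2_sum)
    then show "AE x in lborel. norm ((norm (f x + g x))\<^sup>2) \<le> norm (2 * (norm (f x))\<^sup>2 + 2 * (norm (g x))\<^sup>2)"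
      by (auto intro!: AE_I2 order_trans[OF _ abs_ge_self])
  qed simp
  then show ?thesis by (simp add: L2_iff)
qed

lemma L2_scale: "f \<in> L2 \<Longrightarrow> (\<lambda>x. c * f x) \<in> L2"
  by (auto simp: L2_iff norm_mult power_mult_distrib)

lemma L2_minus: "f \<in> L2 \<Longrightarrow> (\<lambda>x. - f x) \<in> L2"
  using L2_scale[of f "-1"] by simp

lemma L2_diff: "f \<in> L2 \<Longrightarrow> g \<in> L2 \<Longrightarrow> (\<lambda>x. f x - g x) \<in> L2"
  using L2_add[of f "\<lambda>x. - g x"] L2_minus[of g] by simp

lemma l2_scale: "l2 (\<lambda>x. c * f x) = norm c * l2 f"
  by (simp add: l2_def norm_mult power_mult_distrib real_sqrt_mult)

lemma l2_cong_AE: "f \<in> L2 \<Longrightarrow> g \<in> L2 \<Longrightarrow> AE x in lborel. f x = g x \<Longrightarrow> l2 f = l2 g"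
  unfolding l2_def L2_def by (intro arg_cong[where f=sqrt] integral_cong_AE) auto

lemma pairing_integrable:
  assumes "f \<in> L2" "g \<in> L2"
  shows "integrable lborel (\<lambda>x. f x * cnj (g x))" "norm (pairing f g) \<le> l2 f * l2 g"
proof -
  have [measurable]: "f \<in> borel_measurable borel" "g \<in> borel_measurable borel" using assms by (auto simp: L2_def)
  have c: "(\<integral>\<^sup>+ x. ennreal (norm (f x)) * ennreal (norm (g x)) \<partial>lborel)\<^sup>2 \<le> ennreal ((l2 f * l2 g)\<^sup>2)"
  proof -
    have "(\<integral>\<^sup>+ x. ennreal (norm (f x)) * ennreal (norm (g x)) \<partial>lborel)\<^sup>2
       \<le> (\<integral>\<^sup>+ x. ennreal (norm (f x)) ^ 2 \<partial>lborel) * (\<integral>\<^sup>+ x. ennreal (norm (g x)) ^ 2 \<partial>lborel)"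
      by (rule Cauchy_Schwarz_nn_integral) auto
    also have "\<dots> = ennreal ((l2 f * l2 g)\<^sup>2)"
      using assms by (simp add: ennreal_power nn_integral_eq_integral L2_iff l2_sq power_mult_distrib ennreal_mult)
    finally show ?thesis .
  qed
  have n: "(\<integral>\<^sup>+ x. ennreal (norm (f x * cnj (g x))) \<partial>lborel) \<le> ennreal (l2 f * l2 g)"
    using c by (subst ennreal_power_le_iff[of 2]) (auto simp: norm_mult ennreal_mult)
  show i: "integrable lborel (\<lambda>x. f x * cnj (g x))"
    unfolding integrable_iff_bounded using n by (auto intro: le_less_trans)
  have "norm (pairing f g) \<le> (\<integral> x. norm (f x * cnj (g x)) \<partial>lborel)"
    unfolding pairing_def by (rule integral_norm_bound)
  also have "\<dots> \<le> l2 f * l2 g"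
    using n i by (subst (asm) nn_integral_eq_integral) (auto simp: ennreal_le_iff)
  finally show "norm (pairing f g) \<le> l2 f * l2 g" .
qed

lemma pairing_add_left:
  "f \<in> L2 \<Longrightarrow> g \<in> L2 \<Longrightarrow> h \<in> L2 \<Longrightarrow> pairing (\<lambda>x. f x + g x) h = pairing f h + pairing g h"
  unfolding pairing_def by (simp add: distrib_right pairing_integrable)

lemma pairing_add_right:
  "f \<in> L2 \<Longrightarrow> g \<in> L2 \<Longrightarrow> h \<in> L2 \<Longrightarrow> pairing h (\<lambda>x. f x + g x) = pairing h f + pairing h g"
  unfolding pairing_def by (simp add: distrib_left pairing_integrable)

lemma pairing_diff_left:
  "f \<in> L2 \<Longrightarrow> g \<in> L2 \<Longrightarrow> h \<in> L2 \<Longrightarrow> pairing (\<lambda>x. f x - g x) h = pairing f h - pairing g h"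
  unfolding pairing_def by (simp add: left_diff_distrib pairing_integrable)

lemma pairing_diff_right:
  "f \<in> L2 \<Longrightarrow> g \<in> L2 \<Longrightarrow> h \<in> L2 \<Longrightarrow> pairing h (\<lambda>x. f x - g x) = pairing h f - pairing h g"
  unfolding pairing_def by (simp add: right_diff_distrib pairing_integrable)

lemma pairing_scale_left: "pairing (\<lambda>x. c * f x) g = c * pairing f g"
  unfolding pairing_def by (simp add: mult.assoc)

lemma pairing_scale_right: "pairing f (\<lambda>x. c * g x) = cnj c * pairing f g"
  unfolding pairing_def by (simp add: mult.left_commute)

lemma pairing_cong_AE:
  assumes "f \<in> borel_measurable borel" "f' \<in> borel_measurable borel" "g \<in> borel_measurable borel" "g' \<in> borel_measurable borel"
    and "AE x in lborel. f x = f' x" "AE x in lborel. g x = g' x"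
  shows "pairing f g = pairing f' g'"
proof -
  note [measurable] = assms(1-4)
  show ?thesis unfolding pairing_def by (rule integral_cong_AE) (use assms(5,6) in auto)
qed

lemma pairing_cnj: "pairing g f = cnj (pairing f g)"
  unfolding pairing_def by (subst Bochner_Integration.integral_cnj[symmetric]) (simp add: mult.commute)

lemma pairing_self: "f \<in> L2 \<Longrightarrow> pairing f f = of_real ((l2 f)\<^sup>2)"
  unfolding pairing_def l2_sq complex_norm_square[symmetric]
  by (simp add: of_real_power[symmetric] del: of_real_power)

lemma l2_triangle:
  assumes "f \<in> L2" "g \<in> L2"
  shows "l2 (\<lambda>x. f x + g x) \<le> l2 f + l2 g"
proof (rule power2_le_imp_le)
  have "complex_of_real ((l2 (\<lambda>x. f x + g x))\<^sup>2) = of_real ((l2 f)\<^sup>2) + pairing f g + pairing g f + of_real ((l2 g)\<^sup>2)"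
    using assms L2_add[OF assms]
    by (simp add: pairing_self[symmetric] pairing_add_left pairing_add_right del: of_real_power)
  moreover have "norm (complex_of_real ((l2 f)\<^sup>2) + pairing f g + pairing g f + of_real ((l2 g)\<^sup>2))
      \<le> (l2 f)\<^sup>2 + l2 f * l2 g + l2 g * l2 f + (l2 g)\<^sup>2"
    by (intro norm_triangle_mono pairing_integrable(2) assms) (simp_all add: norm_power)
  ultimately have "norm (complex_of_real ((l2 (\<lambda>x. f x + g x))\<^sup>2)) \<le> (l2 f)\<^sup>2 + l2 f * l2 g + l2 g * l2 f + (l2 g)\<^sup>2"
    by metis
  then show "(l2 (\<lambda>x. f x + g x))\<^sup>2 \<le> (l2 f + l2 g)\<^sup>2"
    by (simp add: power2_sum norm_power)
qed simp

lemma l2_triangle_diff: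
  assumes "f \<in> L2" "g \<in> L2"
  shows "l2 f \<le> l2 g + l2 (\<lambda>x. f x - g x)"
  using l2_triangle[OF assms(2) L2_diff[OF assms]] by simp

lemma tst_L2: "tst k K f \<Longrightarrow> f \<in> L2"
proof -
  assume a: "tst k K f"
  then have t: "tst 0 K f" using tst_continuous[OF a] by (simp add: tst_def)
  have "tst 0 K (\<lambda>x. f x * cnj (f x))" by (rule tst_mult_cnj[OF tst_subset0[OF t] t])
  from integrable_norm[OF tst_integrable[OF this]] tst_integrable[OF a]
  show ?thesis by (auto simp: L2_iff norm_mult power2_eq_square)
qed

lemma test_funs_L2: "f \<in> test_funs \<Longrightarrow> f \<in> L2"
  by (meson test_funs_imp_tst tst_L2)

lemma tst_Hop_L2: "tst 2 K f \<Longrightarrow> tst 0 K (Hop \<alpha> f)"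
proof -
  assume "tst 2 K f"
  then have f: "tst (Suc (Suc 0)) K f" by (simp add: numeral_2_eq_2)
  have *: "tst 0 K (cov_partial \<alpha> j (cov_partial \<alpha> j f))" for j
    by (rule tst_cov_partial[OF tst_cov_partial[OF f]])
  show ?thesis using *[of 1] *[of 2]
    by (auto simp: tst_def Hop_def[abs_def] sum_UNIV_2 intro!: continuous_intros)
qed

lemma test_funs_Hop_L2: "f \<in> test_funs \<Longrightarrow> Hop \<alpha> f \<in> L2"
  by (meson test_funs_imp_tst tst_L2 tst_Hop_L2)

lemma test_funs_cov_partial_L2: "f \<in> test_funs \<Longrightarrow> cov_partial \<alpha> j f \<in> L2"
  by (meson test_funs_imp_tst tst_L2 tst_cov_partial)

lemma test_funs_differentiable: "f \<in> test_funs \<Longrightarrow> f differentiable (at x)"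
  using Ck_on.simps(2)[of 0 UNIV f]
  by (auto simp: test_funs_def smooth_on_def differentiable_on_open_at simp del: Ck_on.simps)

lemma cov_partial_diff:
  assumes "f differentiable (at x)" "g differentiable (at x)"
  shows "cov_partial \<alpha> j (\<lambda>x. f x - g x) x = cov_partial \<alpha> j f x - cov_partial \<alpha> j g x"
proof -
  from assms obtain F G where d: "(f has_derivative F) (at x)" "(g has_derivative G) (at x)"
    by (auto simp: differentiable_def)
  show ?thesis
    unfolding cov_partial_def partial_eqI[OF d(1)] partial_eqI[OF d(2)] partial_eqI[OF has_derivative_diff[OF d]]
    by (simp add: algebra_simps)
qed

subsection \<open>The graph of the Friedrichs operator\<close>

lemma core_form_pairing:
  assumes "f \<in> test_funs" "g \<in> test_funs"
  shows "core_form \<alpha> f g = (\<Sum>j\<in>UNIV. pairing (cov_partial \<alpha> j f) (cov_partial \<alpha> j g))"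
  unfolding core_form_def pairing_def
  by (rule Bochner_Integration.integral_sum)
     (intro pairing_integrable(1) test_funs_cov_partial_L2 assms)

lemma core_form_Hop:
  assumes "f \<in> test_funs" "g \<in> test_funs"
  shows "core_form \<alpha> f g = pairing f (Hop \<alpha> g)"
proof -
  obtain K where "\<And>k. tst k K g" using test_funs_imp_tst[OF assms(2)] by metis
  moreover have "Ck_on 1 (- {0}) f" using test_funs_imp_tst[OF assms(1)] tst_subset0 by metis
  ultimately show ?thesis unfolding core_form_def by (intro core_form_eq_pairing_Hop) auto
qed

lemma form_seminorm_power2:
  "(form_seminorm \<alpha> f)\<^sup>2 = (\<integral>\<^sup>+ x. ennreal (\<Sum>j\<in>UNIV. (norm (cov_partial \<alpha> j f x))\<^sup>2) \<partial>lborel)"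
  unfolding form_seminorm_def by (subst eLp_power) (auto simp: ennreal_power sum_nonneg)

lemma l2_cov_partial_less:
  assumes "f \<in> L2" "cov_partial \<alpha> j f \<in> L2" "form_seminorm \<alpha> f < ennreal e" "e > 0"
  shows "l2 (cov_partial \<alpha> j f) < e"
proof -
  have "ennreal ((l2 (cov_partial \<alpha> j f))\<^sup>2) = (\<integral>\<^sup>+ x. ennreal ((norm (cov_partial \<alpha> j f x))\<^sup>2) \<partial>lborel)"
    using assms(2) by (simp add: l2_sq L2_iff nn_integral_eq_integral)
  also have "\<dots> \<le> (form_seminorm \<alpha> f)\<^sup>2"
    unfolding form_seminorm_power2
    by (intro nn_integral_mono ennreal_leI member_le_sum) auto
  also have "\<dots> < ennreal (e\<^sup>2)" using ennreal_power_less_iff[of 2 e] assms by simp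
  finally have "(l2 (cov_partial \<alpha> j f))\<^sup>2 < e\<^sup>2" by (simp add: ennreal_less_iff)
  then show ?thesis using assms(4) power2_less_imp_less by force
qed

lemma test_funs_diff: "f \<in> test_funs \<Longrightarrow> g \<in> test_funs \<Longrightarrow> (\<lambda>x. f x - g x) \<in> test_funs"
proof -
  assume "f \<in> test_funs" "g \<in> test_funs"
  then obtain K L where K: "\<And>k. tst k K f" and L: "\<And>k. tst k L g" by (metis test_funs_imp_tst)
  have "tst k (K \<union> L) (\<lambda>x. f x - g x)" for k
  proof -
    have "Ck_on k UNIV (\<lambda>x. f x + (-1) * g x)"
      using K L by (intro Ck_on_add Ck_on_mult Ck_on_const) (auto simp: tst_def)
    then show ?thesis using K[of k] L[of k] by (auto simp: tst_def compact_Un)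
  qed
  then show ?thesis by (rule tst_imp_test_funs)
qed

lemma approximates_tendsto:
  assumes "approximates N w v"
  shows "(\<lambda>n. l2 (\<lambda>x. w n x - v x)) \<longlonglongrightarrow> 0"
proof -
  have "(\<lambda>x. w n x - v x) \<in> L2" for n
    using assms by (intro L2_diff) (auto simp: approximates_def intro: test_funs_L2)
  then have "(\<lambda>n. ennreal (l2 (\<lambda>x. w n x - v x))) \<longlonglongrightarrow> ennreal 0"
    using assms by (simp add: approximates_def Lp_norm_l2)
  then show ?thesis by (subst (asm) tendsto_ennreal_iff) auto
qed

text \<open>The weak equation on the core suffices. Since \<open>closed_form\<close> is a definite
  description over all approximating pairs, every such pair has to be shown to have the limit
  \<open>pairing g v\<close>. The second sequence is frozen at an index m: the form changes little
  by the Cauchy property, and for fixed m it moves over to \<open>Hop\<close> of a test function,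
  where L^2 convergence is enough.\<close>

lemma H_graphI:
  assumes f: "f \<in> form_dom \<alpha>" and g: "g \<in> L2"
    and weak: "\<And>\<psi>. \<psi> \<in> test_funs \<Longrightarrow> pairing f (Hop \<alpha> \<psi>) = pairing g \<psi>"
  shows "H_graph \<alpha> f g"
proof -
  have lim: "(\<lambda>n. core_form \<alpha> (F n) (G n)) \<longlonglongrightarrow> pairing g v"
    if F: "approximates (form_seminorm \<alpha>) F f" and G: "approximates (form_seminorm \<alpha>) G v" for F G v
  proof -
    have tF: "F n \<in> test_funs" and tG: "G n \<in> test_funs" for n using F G by (auto simp: approximates_def)
    have fL: "f \<in> L2" and vL: "v \<in> L2" using F G by (auto simp: approximates_def)
    note L = test_funs_L2[OF tF] test_funs_L2[OF tG] fL vL g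
    have cauchy: "\<exists>K. \<forall>m\<ge>K. \<forall>n\<ge>K. \<forall>j. l2 (cov_partial \<alpha> j (\<lambda>x. W m x - W n x)) < e"
      if W: "approximates (form_seminorm \<alpha>) W w" and "e > 0" for W w e
    proof -
      have t: "(\<lambda>x. W m x - W n x) \<in> test_funs" for m n using W by (auto simp: approximates_def intro: test_funs_diff)
      obtain K where "\<forall>m\<ge>K. \<forall>n\<ge>K. form_seminorm \<alpha> (\<lambda>x. W m x - W n x) < ennreal e"
        using W \<open>e > 0\<close> unfolding approximates_def by blast
      then show ?thesis
        using l2_cov_partial_less[OF test_funs_L2[OF t] test_funs_cov_partial_L2[OF t] _ \<open>e > 0\<close>] by blast
    qed
    obtain K where K: "\<And>m n j. m \<ge> K \<Longrightarrow> n \<ge> K \<Longrightarrow> l2 (cov_partial \<alpha> j (\<lambda>x. F m x - F n x)) < 1"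
      using cauchy[OF F, of 1] by auto
    define B where "B = l2 (cov_partial \<alpha> 1 (F K)) + l2 (cov_partial \<alpha> 2 (F K)) + 1"
    have B: "l2 (cov_partial \<alpha> j (F n)) \<le> B" if "n \<ge> K" for n j
    proof -
      have "l2 (cov_partial \<alpha> j (F n)) \<le> l2 (cov_partial \<alpha> j (F K)) + l2 (\<lambda>x. cov_partial \<alpha> j (F n) x - cov_partial \<alpha> j (F K) x)"
        by (intro l2_triangle_diff test_funs_cov_partial_L2 tF)
      moreover have "l2 (\<lambda>x. cov_partial \<alpha> j (F n) x - cov_partial \<alpha> j (F K) x) = l2 (cov_partial \<alpha> j (\<lambda>x. F n x - F K x))"
        by (rule arg_cong[where f=l2]) (simp add: fun_eq_iff cov_partial_diff test_funs_differentiable tF)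
      moreover have "l2 (cov_partial \<alpha> j (F K)) \<le> l2 (cov_partial \<alpha> 1 (F K)) + l2 (cov_partial \<alpha> 2 (F K))"
        using exhaust_2[of j] by auto
      ultimately show ?thesis using K[OF that order_refl, of j] unfolding B_def by linarith
    qed
    have B0: "B > 0"
      using l2_nonneg[of "cov_partial \<alpha> 1 (F K)"] l2_nonneg[of "cov_partial \<alpha> 2 (F K)"] unfolding B_def by linarith
    show ?thesis
    proof (rule LIMSEQ_I)
      fix e :: real assume e: "e > 0"
      \<comment> \<open>Two components, each at most B d, make e/4 the cost of passing from
        \<open>G n\<close> to \<open>G m\<close>.\<close>
      define d where "d = e / (8 * B)"
      have d: "d > 0" using e B0 by (simp add: d_def)
      obtain M where M: "\<And>m n j. m \<ge> M \<Longrightarrow> n \<ge> M \<Longrightarrow> l2 (cov_partial \<alpha> j (\<lambda>x. G m x - G n x)) < d"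
        using cauchy[OF G d] by auto
      have "(\<lambda>n. l2 g * l2 (\<lambda>x. G n x - v x)) \<longlonglongrightarrow> 0"
        using tendsto_mult_left[OF approximates_tendsto[OF G], of "l2 g"] by simp
      then have "\<forall>\<^sub>F n in sequentially. l2 g * l2 (\<lambda>x. G n x - v x) < e / 4"
        using e by (intro order_tendstoD) auto
      then obtain M' where "\<And>n. n \<ge> M' \<Longrightarrow> l2 g * l2 (\<lambda>x. G n x - v x) < e / 4"
        unfolding eventually_sequentially by auto
      \<comment> \<open>The index m is fixed before n, since the norm of
        \<open>Hop \<alpha> (G m)\<close> need not be bounded in m.\<close>
      then obtain m where m: "m \<ge> M" "l2 g * l2 (\<lambda>x. G m x - v x) < e / 4"
        using that[of "max M M'"] by simp
      have "(\<lambda>n. l2 (\<lambda>x. F n x - f x) * l2 (Hop \<alpha> (G m))) \<longlonglongrightarrow> 0"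
        using tendsto_mult_right[OF approximates_tendsto[OF F], of "l2 (Hop \<alpha> (G m))"] by simp
      then have "\<forall>\<^sub>F n in sequentially. l2 (\<lambda>x. F n x - f x) * l2 (Hop \<alpha> (G m)) < e / 4"
        using e by (intro order_tendstoD) auto
      then obtain N where N: "\<And>n. n \<ge> N \<Longrightarrow> l2 (\<lambda>x. F n x - f x) * l2 (Hop \<alpha> (G m)) < e / 4"
        unfolding eventually_sequentially by auto
      have "norm (core_form \<alpha> (F n) (G n) - pairing g v) < e" if n: "n \<ge> max N (max M K)" for n
      proof -
        have "core_form \<alpha> (F n) (G n) - core_form \<alpha> (F n) (G m)
          = (\<Sum>j\<in>UNIV. pairing (cov_partial \<alpha> j (F n)) (cov_partial \<alpha> j (\<lambda>x. G n x - G m x)))"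
        proof -
          have "cov_partial \<alpha> j (\<lambda>x. G n x - G m x) = (\<lambda>x. cov_partial \<alpha> j (G n) x - cov_partial \<alpha> j (G m) x)" for j
            by (simp add: fun_eq_iff cov_partial_diff test_funs_differentiable tG)
          then show ?thesis
            by (simp add: core_form_pairing tF tG pairing_diff_right test_funs_cov_partial_L2 sum_subtractf)
        qed
        also have "norm \<dots> \<le> (\<Sum>j\<in>(UNIV::2 set). B * d)"
        proof (rule sum_norm_le)
          fix j :: 2
          have t: "(\<lambda>x. G n x - G m x) \<in> test_funs" by (intro test_funs_diff tG)
          have "norm (pairing (cov_partial \<alpha> j (F n)) (cov_partial \<alpha> j (\<lambda>x. G n x - G m x)))
            \<le> l2 (cov_partial \<alpha> j (F n)) * l2 (cov_partial \<alpha> j (\<lambda>x. G n x - G m x))"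
            by (intro pairing_integrable(2) test_funs_cov_partial_L2 tF t)
          also have "\<dots> \<le> B * d"
            using B[of n j] M[of n m j] n m B0 by (intro mult_mono) auto
          finally show "norm (pairing (cov_partial \<alpha> j (F n)) (cov_partial \<alpha> j (\<lambda>x. G n x - G m x))) \<le> B * d" .
        qed
        also have "\<dots> = e / 4" using B0 by (simp add: d_def)
        finally have 1: "norm (core_form \<alpha> (F n) (G n) - core_form \<alpha> (F n) (G m)) \<le> e / 4" .
        have "core_form \<alpha> (F n) (G m) - pairing g (G m) = pairing (\<lambda>x. F n x - f x) (Hop \<alpha> (G m))"
          by (simp add: core_form_Hop tF tG weak[symmetric] pairing_diff_left L test_funs_Hop_L2)
        moreover have "norm \<dots> \<le> l2 (\<lambda>x. F n x - f x) * l2 (Hop \<alpha> (G m))"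
          by (intro pairing_integrable(2) L2_diff L test_funs_Hop_L2 tG)
        ultimately have 2: "norm (core_form \<alpha> (F n) (G m) - pairing g (G m)) < e / 4"
          using N[of n] n by simp
        have "pairing g (G m) - pairing g v = pairing g (\<lambda>x. G m x - v x)"
          by (simp add: pairing_diff_right L)
        moreover have "norm \<dots> \<le> l2 g * l2 (\<lambda>x. G m x - v x)"
          by (intro pairing_integrable(2) L2_diff L)
        ultimately have 3: "norm (pairing g (G m) - pairing g v) < e / 4" using m by simp
        have "norm ((core_form \<alpha> (F n) (G n) - core_form \<alpha> (F n) (G m))
          + (core_form \<alpha> (F n) (G m) - pairing g (G m)) + (pairing g (G m) - pairing g v)) \<le> e / 4 + e / 4 + e / 4"
          using 1 2 3 by (intro norm_triangle_mono) auto
        then show ?thesis using e by simp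
      qed
      then show "\<exists>no. \<forall>n\<ge>no. norm (core_form \<alpha> (F n) (G n) - pairing g v) < e"
        by (intro exI[of _ "max N (max M K)"]) auto
    qed
  qed
  have "closed_form \<alpha> f v = pairing g v" if v: "v \<in> form_dom \<alpha>" for v
  proof -
    obtain F G where F: "approximates (form_seminorm \<alpha>) F f" and G: "approximates (form_seminorm \<alpha>) G v"
      using f v by (auto simp: form_dom_def test_closure_def)
    show ?thesis unfolding closed_form_def
    proof (rule the_equality)
      show "\<forall>F G. approximates (form_seminorm \<alpha>) F f \<and> approximates (form_seminorm \<alpha>) G v \<longrightarrow>
          (\<lambda>n. core_form \<alpha> (F n) (G n)) \<longlonglongrightarrow> pairing g v"
        using lim by simp
      fix z assume "\<forall>F G. approximates (form_seminorm \<alpha>) F f \<and> approximates (form_seminorm \<alpha>) G v \<longrightarrow>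
          (\<lambda>n. core_form \<alpha> (F n) (G n)) \<longlonglongrightarrow> z"
      then have "(\<lambda>n. core_form \<alpha> (F n) (G n)) \<longlonglongrightarrow> z" using F G by simp
      then show "z = pairing g v" using lim[OF F G] by (rule LIMSEQ_unique)
    qed
  qed
  then show ?thesis using f g by (simp add: H_graph_def)
qed

lemma test_funs_form_dom:
  assumes "f \<in> test_funs"
  shows "f \<in> form_dom \<alpha>"
proof -
  have "form_seminorm \<alpha> (\<lambda>x. 0) ^ 2 = 0"
    unfolding form_seminorm_power2 by (simp add: cov_partial_def partial_def frechet_derivative_const)
  then have "approximates (form_seminorm \<alpha>) (\<lambda>n. f) f"
    using assms test_funs_L2[OF assms] by (auto simp: approximates_def Lp_norm_2 eroot_def)
  then show ?thesis by (auto simp: form_dom_def test_closure_def)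
qed

lemma test_funs_H_graph:
  assumes "f \<in> test_funs"
  shows "H_graph \<alpha> f (Hop \<alpha> f)"
proof (rule H_graphI)
  fix \<psi> assume "\<psi> \<in> test_funs"
  then obtain K where "\<And>k. tst k K \<psi>" by (metis test_funs_imp_tst)
  moreover have "Ck_on 2 (- {0}) f" using assms test_funs_imp_tst tst_subset0 by metis
  ultimately show "pairing f (Hop \<alpha> \<psi>) = pairing (Hop \<alpha> f) \<psi>" by (intro pairing_Hop_sym) auto
qed (use assms in \<open>auto intro: test_funs_form_dom test_funs_Hop_L2\<close>)

subsection \<open>Bounded functions with small support\<close>

definition vol2 :: real where "vol2 = unit_ball_vol 2"

lemma vol2_pos: "vol2 > 0"
  by (simp add: vol2_def unit_ball_vol_def Gamma_real_pos)

lemma emeasure_ball_2: "r \<ge> 0 \<Longrightarrow> emeasure lborel (ball (c::real^2) r) = ennreal (vol2 * r\<^sup>2)"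
  using emeasure_ball[of r c] by (simp add: vol2_def)

lemma L2_bounded_support:
  assumes m: "f \<in> borel_measurable borel" and B: "\<And>x. norm (f x) \<le> B" and r: "r \<ge> 0"
    and s: "\<And>x. norm x \<ge> r \<Longrightarrow> f x = 0"
  shows "f \<in> L2" "l2 f \<le> B * (sqrt vol2 * r)"
proof -
  note [measurable] = m
  have B0: "B \<ge> 0" using B[of 0] norm_ge_zero order_trans by blast
  have "(\<integral>\<^sup>+ x. ennreal ((norm (f x))\<^sup>2) \<partial>lborel) \<le> (\<integral>\<^sup>+ x. ennreal (B\<^sup>2) * indicator (ball (0::real^2) r) x \<partial>lborel)"
    using s B by (intro nn_integral_mono) (auto simp: indicator_def power_mono not_less)
  also have "\<dots> = ennreal (B\<^sup>2 * (vol2 * r\<^sup>2))"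
    using r by (simp add: nn_integral_cmult_indicator emeasure_ball_2 ennreal_mult vol2_pos less_imp_le)
  finally have n: "(\<integral>\<^sup>+ x. ennreal ((norm (f x))\<^sup>2) \<partial>lborel) \<le> ennreal (B\<^sup>2 * (vol2 * r\<^sup>2))" .
  have i: "integrable lborel (\<lambda>x. (norm (f x))\<^sup>2)"
    unfolding integrable_iff_bounded using n by (auto intro: le_less_trans)
  then show "f \<in> L2" using m by (simp add: L2_iff)
  have "(l2 f)\<^sup>2 \<le> B\<^sup>2 * (vol2 * r\<^sup>2)"
    using n i vol2_pos unfolding l2_sq by (subst (asm) nn_integral_eq_integral) auto
  also have "\<dots> = (B * (sqrt vol2 * r))\<^sup>2" using vol2_pos by (simp add: power_mult_distrib)
  finally show "l2 f \<le> B * (sqrt vol2 * r)"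
    by (rule power2_le_imp_le) (use B0 r vol2_pos in auto)
qed

lemma continuous_off_0_measurable:
  fixes f :: "real^2 \<Rightarrow> 'b::topological_space"
  assumes "continuous_on (- {0}) f"
  shows "f \<in> borel_measurable borel"
proof -
  have "(\<lambda>x. if x \<in> - {0} then f x else f 0) \<in> borel_measurable borel"
    by (rule borel_measurable_continuous_on_if) (use assms in auto)
  moreover have "(\<lambda>x. if x \<in> - {0} then f x else f 0) = f" by auto
  ultimately show ?thesis by simp
qed

lemma Ck_on_imp_continuous: "Ck_on k S f \<Longrightarrow> continuous_on S f"
proof (induction k)
  case (Suc k)
  then show ?case by (metis Ck_on_SucD)
qed simp

lemma Ck_on_real_deriv:
  fixes h :: "real \<Rightarrow> 'b::real_normed_vector"
  assumes "Ck_on (Suc k) {0<..} h"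
  shows "\<And>r. r > 0 \<Longrightarrow> (h has_vector_derivative frechet_derivative h (at r) 1) (at r)"
    and "Ck_on k {0<..} (\<lambda>r. frechet_derivative h (at r) 1)"
proof -
  note d = Ck_on_SucE[OF assms]
  show "(h has_vector_derivative frechet_derivative h (at r) 1) (at r)" if "r > 0" for r
  proof -
    have D: "(h has_derivative frechet_derivative h (at r)) (at r)" using d(1) that by auto
    have "frechet_derivative h (at r) = (\<lambda>x. x *\<^sub>R frechet_derivative h (at r) 1)"
    proof
      show "frechet_derivative h (at r) x = x *\<^sub>R frechet_derivative h (at r) 1" for x
        using linear_scale[OF has_derivative_linear[OF D], of x 1] by (simp only: real_scaleR_def mult_1_right)
    qed
    with D show ?thesis unfolding has_vector_derivative_def by metis
  qed
  show "Ck_on k {0<..} (\<lambda>r. frechet_derivative h (at r) 1)" using d(2)[of 1] by auto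
qed

lemma norm_ang: "norm (ang m x) \<le> 1"
proof -
  have "norm (ang m x) = norm (sgn (Complex (x$1) (x$2))) powi m" by (simp add: ang_def norm_power_int)
  then show ?thesis by (cases "m = 0") (auto simp: norm_sgn power_int_0_left_if)
qed

lemma norm_ang_eq: "x \<noteq> 0 \<Longrightarrow> norm (ang m x) = 1"
proof -
  assume "x \<noteq> 0"
  then have "Complex (x$1) (x$2) \<noteq> 0" by (auto simp: vec_eq_iff forall_2 complex_eq_iff)
  then show ?thesis by (simp add: ang_def norm_power_int norm_sgn)
qed

lemma ang_measurable [measurable]: "m = 0 \<or> m = -1 \<Longrightarrow> ang m \<in> borel_measurable borel"
  by (rule continuous_off_0_measurable[OF Ck_on_imp_continuous[OF Ck_on_ang[of m 0]]])

text \<open>The hypotheses give the radial derivative and the angular quotient h/r the same bound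
  \<open>B\<close>; each of the two components is then at most (1 + |m + \<alpha>|) B.\<close>

lemma gradient_radial_bound:
  fixes h :: "real \<Rightarrow> complex"
  assumes m: "m = 0 \<or> m = -1" and x: "x \<noteq> 0" and h: "(h has_vector_derivative h') (at (norm x))"
    and B: "norm h' \<le> B" "norm (h (norm x)) \<le> B * norm x"
  shows "(\<Sum>j\<in>UNIV. (norm (cov_partial \<alpha> j (\<lambda>y. h (norm y) * ang m y) x))\<^sup>2) \<le> 2 * (1 + \<bar>of_int m + \<alpha>\<bar>)\<^sup>2 * B\<^sup>2"
proof -
  define \<mu> where "\<mu> = \<bar>of_int m + \<alpha>\<bar>"
  have n: "norm x > 0" using x by simp
  have B0: "B \<ge> 0" using B(1) norm_ge_zero order_trans by blast
  have c: "\<bar>x $ j\<bar> / norm x \<le> 1" "\<bar>tang x $ j\<bar> / norm x \<le> 1" for j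
    using n exhaust_2[of j] component_le_norm_cart[of x] by auto
  have "norm (cov_partial \<alpha> j (\<lambda>y. h (norm y) * ang m y) x) \<le> (1 + \<mu>) * B" for j
  proof -
    have "norm (cov_partial \<alpha> j (\<lambda>y. h (norm y) * ang m y) x)
        \<le> norm (of_real (x$j / norm x) * h' + \<i> * of_real ((of_int m + \<alpha>) * tang x $ j / (norm x)\<^sup>2) * h (norm x))"
      unfolding cov_partial_radial[OF m x h] norm_mult[of _ "ang m x"] norm_ang_eq[OF x] by simp
    also have "\<dots> \<le> 1 * B + \<mu> * B"
    proof (rule norm_triangle_mono)
      show "norm (of_real (x$j / norm x) * h') \<le> 1 * B"
        unfolding norm_mult using c(1)[of j] B(1) by (intro mult_mono) (auto simp: norm_divide)
      have "norm (\<i> * of_real ((of_int m + \<alpha>) * tang x $ j / (norm x)\<^sup>2) * h (norm x))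
        = \<mu> * ((\<bar>tang x $ j\<bar> / norm x) * (norm (h (norm x)) / norm x))"
        unfolding \<mu>_def norm_mult norm_of_real by (simp add: abs_mult power2_eq_square)
      also have "\<dots> \<le> \<mu> * (1 * B)"
        using c(2)[of j] B n by (intro mult_left_mono mult_mono) (auto simp: \<mu>_def field_simps)
      finally show "norm (\<i> * of_real ((of_int m + \<alpha>) * tang x $ j / (norm x)\<^sup>2) * h (norm x)) \<le> \<mu> * B" by simp
    qed
    finally show ?thesis by (simp add: algebra_simps)
  qed
  then have "(\<Sum>j\<in>UNIV. (norm (cov_partial \<alpha> j (\<lambda>y. h (norm y) * ang m y) x))\<^sup>2) \<le> (\<Sum>j\<in>(UNIV::2 set). ((1 + \<mu>) * B)\<^sup>2)"
    by (intro sum_mono power_mono) auto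
  then show ?thesis by (simp add: \<mu>_def power_mult_distrib)
qed

text \<open>A dyadic sum replaces integration in polar coordinates: on the ring \<rho>/2^(k+1) \<le>
  |x| < \<rho>/2^k the weight is at most \<open>a k\<close>, and \<open>a k\<close> times the area
  of the k-th disc forms a geometric series of ratio 4^(-\<nu>) < 1.\<close>

lemma nn_integral_norm_powr:
  assumes "0 < \<nu>" "\<nu> < 1"
  obtains C where "C \<ge> 0" "\<And>\<rho>. \<rho> > 0 \<Longrightarrow>
    (\<integral>\<^sup>+ x. indicator (ball 0 \<rho>) x * ennreal (norm (x::real^2) powr (2 * \<nu> - 2)) \<partial>lborel) \<le> ennreal (C * \<rho> powr (2 * \<nu>))"
proof
  define q where "q = 2 powr (- 2 * \<nu>)"
  have q: "0 < q" "q < 1" using assms by (auto simp: q_def powr_less_one)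
  define C where "C = vol2 * 2 powr (2 - 2 * \<nu>) / (1 - q)"
  show "C \<ge> 0" using q vol2_pos by (auto simp: C_def)
  fix \<rho> :: real assume \<rho>: "\<rho> > 0"
  define a where "a k = (\<rho> / 2 ^ Suc k) powr (2 * \<nu> - 2)" for k :: nat
  have pt: "indicator (ball 0 \<rho>) x * ennreal (norm x powr (2 * \<nu> - 2))
      \<le> (\<Sum>k. ennreal (a k) * indicator (ball 0 (\<rho> / 2 ^ k)) x)" for x :: "real^2"
  proof (cases "x \<noteq> 0 \<and> norm x < \<rho>")
    case True
    have "\<exists>k. \<rho> / 2 ^ Suc k \<le> norm x"
    proof -
      obtain k :: nat where "\<rho> / norm x < 2 ^ k" using real_arch_pow[of 2] by auto
      then have "\<rho> / 2 ^ Suc k \<le> norm x" using True \<rho> by (simp add: field_simps)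
      then show ?thesis by blast
    qed
    \<comment> \<open>Minimality of k gives |x| < \<rho>/2^k; for k = 0 this is |x| <
      \<rho>.\<close>
    then obtain k where k: "\<rho> / 2 ^ Suc k \<le> norm x" "\<And>j. j < k \<Longrightarrow> \<not> \<rho> / 2 ^ Suc j \<le> norm x"
      by (meson exists_least_iff)
    have "norm x < \<rho> / 2 ^ k" using k(2)[of "k - 1"] True by (cases k) auto
    then have "ennreal (norm x powr (2 * \<nu> - 2)) \<le> ennreal (a k) * indicator (ball 0 (\<rho> / 2 ^ k)) x"
      using k(1) assms \<rho> by (auto simp: a_def intro!: ennreal_leI powr_mono2')
    also have "\<dots> \<le> (\<Sum>k. ennreal (a k) * indicator (ball 0 (\<rho> / 2 ^ k)) x)"
    proof -
      have "f k \<le> (\<Sum>k. f k)" for f :: "nat \<Rightarrow> ennreal" using sum_le_suminf[of f "{k}"] by simp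
      then show ?thesis .
    qed
    finally show ?thesis using True by simp
  qed auto
  have val: "a k * (vol2 * (\<rho> / 2 ^ k)\<^sup>2) = vol2 * 2 powr (2 - 2 * \<nu>) * \<rho> powr (2 * \<nu>) * q ^ k" for k
  proof -
    have t: "\<rho> / 2 ^ n = \<rho> * 2 powr (- real n)" for n
      by (simp add: powr_minus powr_realpow divide_inverse)
    have a: "a k = \<rho> powr (2 * \<nu> - 2) * 2 powr (- real (Suc k) * (2 * \<nu> - 2))"
      unfolding a_def t using \<rho> by (subst powr_mult) (auto simp only: powr_powr powr_ge_zero less_imp_le)
    have b: "(\<rho> / 2 ^ k)\<^sup>2 = \<rho> powr 2 * 2 powr (- real k * 2)"
    proof -
      have "(\<rho> / 2 ^ k)\<^sup>2 = \<rho>\<^sup>2 * (2 powr (- real k))\<^sup>2" unfolding t power_mult_distrib ..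
      moreover have "(2 powr (- real k))\<^sup>2 = (2::real) powr (- real k * 2)" by (subst powr_power) (auto simp: mult.commute)
      ultimately show ?thesis using \<rho> by simp
    qed
    have "a k * (\<rho> / 2 ^ k)\<^sup>2 = (\<rho> powr (2 * \<nu> - 2) * \<rho> powr 2) * (2 powr (- real (Suc k) * (2 * \<nu> - 2)) * 2 powr (- real k * 2))"
      unfolding a b by (simp only: mult_ac)
    also have "\<dots> = \<rho> powr (2 * \<nu>) * (2 powr (2 - 2 * \<nu>) * q powr (real k))"
      unfolding q_def powr_powr powr_add[symmetric] by (simp add: algebra_simps)
    finally have "a k * (\<rho> / 2 ^ k)\<^sup>2 = \<rho> powr (2 * \<nu>) * (2 powr (2 - 2 * \<nu>) * q ^ k)"
      using q by (simp only: powr_realpow)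
    then show ?thesis by (simp only: mult.left_commute[of _ vol2] mult.assoc mult.left_commute[of "2 powr (2 - 2 * \<nu>)"])
  qed
  have "(\<integral>\<^sup>+ x. indicator (ball 0 \<rho>) x * ennreal (norm (x::real^2) powr (2 * \<nu> - 2)) \<partial>lborel)
     \<le> (\<integral>\<^sup>+ x. (\<Sum>k. ennreal (a k) * indicator (ball (0::real^2) (\<rho> / 2 ^ k)) x) \<partial>lborel)"
    by (intro nn_integral_mono pt)
  also have "\<dots> = (\<Sum>k. (\<integral>\<^sup>+ x. ennreal (a k) * indicator (ball (0::real^2) (\<rho> / 2 ^ k)) x \<partial>lborel))"
    by (rule nn_integral_suminf) (auto intro!: borel_measurable_times_ennreal borel_measurable_indicator)
  also have "\<dots> = (\<Sum>k. ennreal (vol2 * 2 powr (2 - 2 * \<nu>) * \<rho> powr (2 * \<nu>) * q ^ k))"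
  proof (rule suminf_cong)
    fix k
    show "(\<integral>\<^sup>+ x. ennreal (a k) * indicator (ball (0::real^2) (\<rho> / 2 ^ k)) x \<partial>lborel)
       = ennreal (vol2 * 2 powr (2 - 2 * \<nu>) * \<rho> powr (2 * \<nu>) * q ^ k)"
      using \<rho> unfolding val[symmetric]
      by (subst nn_integral_cmult_indicator) (auto simp: emeasure_ball_2 ennreal_mult a_def vol2_pos less_imp_le)
  qed
  also have "\<dots> = ennreal (C * \<rho> powr (2 * \<nu>))"
  proof (rule suminf_ennreal_eq)
    have "(\<lambda>k. vol2 * 2 powr (2 - 2 * \<nu>) * \<rho> powr (2 * \<nu>) * q ^ k) sums (vol2 * 2 powr (2 - 2 * \<nu>) * \<rho> powr (2 * \<nu>) * (1 / (1 - q)))"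
      by (intro sums_mult geometric_sums) (use q in auto)
    then show "(\<lambda>k. vol2 * 2 powr (2 - 2 * \<nu>) * \<rho> powr (2 * \<nu>) * q ^ k) sums (C * \<rho> powr (2 * \<nu>))"
      by (simp add: C_def mult.commute mult.left_commute)
    show "0 \<le> vol2 * 2 powr (2 - 2 * \<nu>) * \<rho> powr (2 * \<nu>) * q ^ k" for k
      using q vol2_pos by simp
  qed
  finally show "(\<integral>\<^sup>+ x. indicator (ball 0 \<rho>) x * ennreal (norm (x::real^2) powr (2 * \<nu> - 2)) \<partial>lborel) \<le> ennreal (C * \<rho> powr (2 * \<nu>))" .
qed

lemma Hop_cong_open:
  assumes "open S" "x \<in> S" "\<And>y. y \<in> S \<Longrightarrow> f y = g y"
  shows "Hop \<alpha> f x = Hop \<alpha> g x"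
proof -
  have "cov_partial \<alpha> j (cov_partial \<alpha> j f) x = cov_partial \<alpha> j (cov_partial \<alpha> j g) x" for j
    by (rule cov_partial_cong_open[OF assms(1,2) cov_partial_cong_open[OF assms(1) _ assms(3)]])
  then show ?thesis by (simp add: Hop_def)
qed

lemma Ck_on_Hop:
  assumes "Ck_on (Suc (Suc k)) (- {0}) f"
  shows "Ck_on k (- {0}) (Hop \<alpha> f)"
proof -
  have "Ck_on k (- {0}) (\<lambda>x. (-1) * (cov_partial \<alpha> 1 (cov_partial \<alpha> 1 f) x + cov_partial \<alpha> 2 (cov_partial \<alpha> 2 f) x))"
    by (intro Ck_on_mult Ck_on_add Ck_on_const Ck_on_cov_partial assms) auto
  then show ?thesis by (rule Ck_on_cong[rotated 2]) (auto simp: Hop_def sum_UNIV_2)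
qed

text \<open>The radial operator produces \<nu>(\<nu> - 1) + \<nu> - \<nu>^2 = 0: the power is the
  regular zero mode.\<close>

lemma Hop_power_zero:
  assumes m: "m = 0 \<or> m = -1" and x: "x \<noteq> 0" and nu: "\<bar>of_int m + \<alpha>\<bar> = \<nu>"
  shows "Hop \<alpha> (\<lambda>y. c * of_real (norm y powr \<nu>) * ang m y) x = 0"
proof -
  have n: "norm x > 0" using x by simp
  have d: "((\<lambda>r. c * of_real (a * r powr b)) has_vector_derivative c * of_real (a * b * r powr (b - 1))) (at r)"
    if "r > 0" for a b r :: real
    using that by (intro has_vector_derivative_mult_right has_vector_derivative_of_real)
       (auto intro!: derivative_eq_intros simp: has_real_derivative_iff_has_vector_derivative[symmetric])
  have sq: "(of_int m + \<alpha>)\<^sup>2 = \<nu>\<^sup>2" using nu by (metis power2_abs)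
  have p: "norm x powr (\<nu> - 1) = norm x powr \<nu> / norm x" "norm x powr (\<nu> - 1 - 1) = norm x powr \<nu> / (norm x)\<^sup>2"
    using n by (auto simp: powr_diff power2_eq_square)
  show ?thesis
    using Hop_radial[OF m x, of "\<lambda>r. c * of_real (1 * r powr \<nu>)" "\<lambda>r. c * of_real (1 * \<nu> * r powr (\<nu> - 1))" _ \<alpha>, OF d, OF _
        d[OF n, of "1 * \<nu>" "\<nu> - 1"]] n
    unfolding sq p by (simp add: field_simps power2_eq_square)
qed

subsection \<open>The profile belongs to the operator domain\<close>

text \<open>The derivative is bounded in the form r \<eta>'(r), which is invariant under dilations:
  the same \<open>C\<close> serves all the cutoffs \<eta>(nr).\<close>

definition cutoff_data :: "(real \<Rightarrow> real) \<Rightarrow> real \<Rightarrow> real \<Rightarrow> real \<Rightarrow> bool" where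
  "cutoff_data \<eta> d R C \<longleftrightarrow> d > 0 \<and> R > 0 \<and> (\<forall>r. 0 \<le> r \<and> r < d \<longrightarrow> \<eta> r = 1) \<and> (\<forall>r\<ge>R. \<eta> r = 0)
    \<and> (\<forall>r>0. \<bar>r * frechet_derivative \<eta> (at r) 1\<bar> \<le> C) \<and> d < R"

lemma cutoff_dataD:
  assumes "cutoff_data \<eta> d R C"
  shows "d > 0" "R > 0" "\<And>r. 0 \<le> r \<Longrightarrow> r < d \<Longrightarrow> \<eta> r = 1" "\<And>r. r \<ge> R \<Longrightarrow> \<eta> r = 0"
    "\<And>r. r > 0 \<Longrightarrow> \<bar>r * frechet_derivative \<eta> (at r) 1\<bar> \<le> C" "d < R"
  using assms by (auto simp: cutoff_data_def)

lemma radial_cutoffE: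
  assumes "radial_cutoff \<eta>"
  obtains d R C where "cutoff_data \<eta> d R C"
proof -
  from assms obtain d R0 where d: "d > 0" "\<And>r. 0 \<le> r \<Longrightarrow> r < d \<Longrightarrow> \<eta> r = 1" and R0: "\<And>r. r \<ge> R0 \<Longrightarrow> \<eta> r = 0"
    unfolding radial_cutoff_def by auto
  define R where "R = max (R0) (d + 1)"
  have R: "R > 0" "\<And>r. r \<ge> R \<Longrightarrow> \<eta> r = 0" "d < R" using d R0 by (auto simp: R_def)
  define e where "e r = frechet_derivative \<eta> (at r) 1" for r
  have "Ck_on (Suc 0) {0<..} \<eta>" using assms by (auto simp: radial_cutoff_def smooth_on_def simp del: Ck_on.simps)
  from Ck_on_real_deriv(2)[OF this] have "continuous_on {0<..} e" by (simp add: e_def)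
  then have "continuous_on {d/2..R} (\<lambda>r. r * e r)"
    using d by (intro continuous_intros) (auto elim!: continuous_on_subset)
  then have "bounded ((\<lambda>r. r * e r) ` {d/2..R})"
    by (intro compact_imp_bounded compact_continuous_image) auto
  then have "\<exists>C. \<forall>r\<in>{d/2..R}. \<bar>r * e r\<bar> \<le> C" unfolding bounded_iff by auto
  then obtain C where C: "\<And>r. r \<in> {d/2..R} \<Longrightarrow> \<bar>r * e r\<bar> \<le> C" by blast
  have "\<bar>r * e r\<bar> \<le> max C 0" if r: "r > 0" for r
  proof -
    \<comment> \<open>The derivative is bounded by compactness on \<open>{d/2..R}\<close> and
      vanishes on both sides, where the cutoff is constant.\<close>
    consider "r \<in> {d/2..R}" | "r \<in> {0<..<d}" | "r \<in> {R<..}" using r d by fastforce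
    then show ?thesis
    proof cases
      case 1
      then show ?thesis using C[of r] by auto
    next
      case 2
      have "frechet_derivative \<eta> (at r) = frechet_derivative (\<lambda>r. 1) (at r)"
        by (rule frechet_derivative_cong_open[of "{0<..<d}"]) (use 2 d in auto)
      then show ?thesis by (simp add: e_def frechet_derivative_const)
    next
      case 3
      have "frechet_derivative \<eta> (at r) = frechet_derivative (\<lambda>r. 0) (at r)"
        by (rule frechet_derivative_cong_open[of "{R<..}"]) (use 3 R in auto)
      then show ?thesis by (simp add: e_def frechet_derivative_const)
    qed
  qed
  then show ?thesis using that[of d R "max C 0"] d R unfolding e_def cutoff_data_def by auto
qed

lemma radial_cutoff_Ck: "radial_cutoff \<eta> \<Longrightarrow> Ck_on k {0<..} \<eta>"
  by (auto simp: radial_cutoff_def smooth_on_def)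

lemma Ck_on_scale_arg:
  assumes "a > 0" "Ck_on k {0<..} (h :: real \<Rightarrow> 'b::real_normed_vector)"
  shows "Ck_on k {0<..} (\<lambda>r. h (a * r))"
proof (rule Ck_on_compose_real[OF _ _ _ _ assms(2)])
  show "Ck_on k {0<..} (\<lambda>r. a * r)"
    by (rule Ck_on_linear) (auto intro: bounded_linear_mult_right)
qed (use assms in auto)

lemma has_vector_derivative_scale_arg:
  fixes h :: "real \<Rightarrow> 'b::real_normed_vector"
  assumes "(h has_vector_derivative d) (at (a * r))"
  shows "((\<lambda>r. h (a * r)) has_vector_derivative a *\<^sub>R d) (at r)"
proof -
  have "((\<lambda>r. a * r) has_derivative (\<lambda>e. a * e)) (at r)"
    by (intro bounded_linear_imp_has_derivative bounded_linear_mult_right)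
  from diff_chain_at[OF this] assms show ?thesis
    by (simp add: has_vector_derivative_def o_def mult.commute)
qed

locale profile =
  fixes \<alpha> \<nu> :: real and m :: int and \<eta> :: "real \<Rightarrow> real" and c :: complex
  assumes m: "m = 0 \<or> m = -1" and nu: "\<bar>of_int m + \<alpha>\<bar> = \<nu>" and nu01: "0 < \<nu>" "\<nu> < 1"
    and cut: "radial_cutoff \<eta>" and eta01: "\<And>r. r \<ge> 0 \<Longrightarrow> 0 \<le> \<eta> r \<and> \<eta> r \<le> 1"
begin

definition h :: "real \<Rightarrow> complex" where "h r = c * of_real (\<eta> r * r powr \<nu>)"

definition f :: fld where "f x = h (norm x) * ang m x"

lemma h_Ck: "Ck_on k {0<..} h"
  unfolding h_def[abs_def]
  by (intro Ck_on_mult Ck_on_const Ck_on_of_real radial_cutoff_Ck cut Ck_on_powr) auto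

lemma f_Ck: "Ck_on k (- {0}) f"
  unfolding f_def[abs_def] by (rule Ck_on_radial[OF m h_Ck])

lemma h_bound: "r \<ge> 0 \<Longrightarrow> norm (h r) \<le> norm c * r powr \<nu>"
  using eta01[of r] by (simp add: h_def norm_mult abs_mult mult_left_mono mult_left_le_one_le)

lemma f_measurable: "f \<in> borel_measurable borel"
  by (rule continuous_off_0_measurable[OF Ck_on_imp_continuous[OF f_Ck[of 0]]])

lemma f_bound: 
  assumes R: "R > 0" "\<And>r. r \<ge> R \<Longrightarrow> \<eta> r = 0"
  shows "norm (f x) \<le> norm c * R powr \<nu>" "norm x \<ge> R \<Longrightarrow> f x = 0"
proof -
  show z: "f x = 0" if "norm x \<ge> R" using R(2)[OF that] by (simp add: f_def h_def)
  show "norm (f x) \<le> norm c * R powr \<nu>"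
  proof (cases "norm x \<ge> R")
    case False
    have "norm (f x) \<le> norm (h (norm x)) * 1" unfolding f_def norm_mult by (intro mult_left_mono norm_ang) auto
    also have "\<dots> \<le> norm c * norm x powr \<nu>" using h_bound[of "norm x"] by simp
    also have "\<dots> \<le> norm c * R powr \<nu>" using False nu01 by (intro mult_left_mono powr_mono2) auto
    finally show ?thesis .
  qed (use z R in auto)
qed

lemma f_L2: "f \<in> L2"
proof -
  obtain d R C where "cutoff_data \<eta> d R C" by (rule radial_cutoffE[OF cut])
  note R = cutoff_dataD[OF this]
  show ?thesis
    by (rule L2_bounded_support[OF f_measurable f_bound(1)[OF R(2) R(4)] _ f_bound(2)[OF R(2) R(4)]]) (use R in auto)
qed

text \<open>The profile with a hole of radius of order 1/(n+1) around the origin, the sequence that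
  puts \<open>f\<close> into the form domain.\<close>

definition w :: "nat \<Rightarrow> fld" where
  "w n x = (of_real (1 - \<eta> (real (Suc n) * norm x)) * h (norm x)) * ang m x"

lemma w_test: "w n \<in> test_funs"
proof -
  obtain d R C where "cutoff_data \<eta> d R C" by (rule radial_cutoffE[OF cut])
  note R = cutoff_dataD[OF this]
  define g where "g r = of_real (1 - \<eta> (real (Suc n) * r)) * h r" for r
  have "Ck_on k {0<..} (\<lambda>r. complex_of_real (1 + (-1) * \<eta> (real (Suc n) * r)))" for k
  proof (rule Ck_on_of_real[OF _ Ck_on_add[OF _ Ck_on_const Ck_on_mult[OF _ Ck_on_const]]])
    show "Ck_on k {0<..} (\<lambda>r. \<eta> (real (Suc n) * r))"
      by (rule Ck_on_scale_arg[OF _ radial_cutoff_Ck[OF cut]]) simp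
  qed auto
  from Ck_on_mult[OF _ this h_Ck] have "smooth_on {0<..} g"
    by (simp add: smooth_on_def g_def[abs_def])
  moreover have "d / Suc n > 0" using R(1) by simp
  moreover have "g r = 0" if "0 \<le> r" "r < d / Suc n" for r
  proof -
    have "real (Suc n) * r < d" using that(2) by (simp add: field_simps)
    moreover have "0 \<le> real (Suc n) * r" using that(1) by simp
    ultimately have "\<eta> (real (Suc n) * r) = 1" by (intro R(3))
    then show ?thesis by (simp only: g_def) simp
  qed
  moreover have "g r = 0" if "R \<le> r" for r
    using R(4)[OF that] by (simp add: g_def h_def)
  ultimately have "(\<lambda>x. g (norm x) * ang m x) \<in> test_funs"
    by (rule test_funs_radial[OF m])
  moreover have "(\<lambda>x. g (norm x) * ang m x) = w n"
    by (rule ext) (simp only: g_def w_def)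
  ultimately show ?thesis by simp
qed

text \<open>The difference of two truncations is supported in a disc of radius of order 1/n, and its
  gradient is at most a constant times r^(\<nu>-1) independently of the truncations, because r
  \<eta>'(r) is dilation invariant. Since \<nu> > 0, the square of this bound is integrable at the
  origin, so the form norm of the difference tends to zero.\<close>

lemma f_form_dom: "f \<in> form_dom \<alpha>"
proof -
  obtain d R C where "cutoff_data \<eta> d R C" by (rule radial_cutoffE[OF cut])
  note R = cutoff_dataD[OF this]
  define \<eta>' where "\<eta>' r = frechet_derivative \<eta> (at r) 1" for r
  have C: "\<bar>r * \<eta>' r\<bar> \<le> C" if "r > 0" for r using R(5)[OF that] by (simp add: \<eta>'_def)
  have d\<eta>: "(\<eta> has_vector_derivative \<eta>' r) (at r)" if "r > 0" for r
    unfolding \<eta>'_def using Ck_on_real_deriv(1)[OF radial_cutoff_Ck[OF cut, of "Suc 0"] that] .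
  define h' where "h' r = c * of_real (\<eta> r * (\<nu> * r powr (\<nu> - 1)) + \<eta>' r * r powr \<nu>)" for r
  have dh: "(h has_vector_derivative h' r) (at r)" if "r > 0" for r
  proof -
    have "((\<lambda>r. r powr \<nu>) has_vector_derivative \<nu> * r powr (\<nu> - 1)) (at r)"
      using that by (auto intro!: derivative_eq_intros simp: has_real_derivative_iff_has_vector_derivative[symmetric])
    from has_vector_derivative_mult[OF d\<eta>[OF that] this] show ?thesis
      unfolding h_def[abs_def] h'_def
      unfolding has_real_derivative_iff_has_vector_derivative[symmetric]
      by (intro has_vector_derivative_mult_right has_vector_derivative_of_real)
  qed
  have C0: "C \<ge> 0" using C[of 1] by simp
  have h'b: "norm (h' r) \<le> norm c * (C + \<nu>) * r powr (\<nu> - 1)" if r: "r > 0" for r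
  proof -
    have "\<bar>\<eta> r * (\<nu> * r powr (\<nu> - 1)) + \<eta>' r * r powr \<nu>\<bar> \<le> \<nu> * r powr (\<nu> - 1) + C * r powr (\<nu> - 1)"
    proof (rule abs_triangle_ineq[THEN order_trans], rule add_mono)
      have "\<bar>\<eta>' r * r powr \<nu>\<bar> = \<bar>r * \<eta>' r\<bar> * r powr (\<nu> - 1)" using r by (simp add: abs_mult powr_diff)
      also have "\<dots> \<le> C * r powr (\<nu> - 1)" using C[OF r] by (intro mult_right_mono) auto
      finally show "\<bar>\<eta>' r * r powr \<nu>\<bar> \<le> C * r powr (\<nu> - 1)" .
      show "\<bar>\<eta> r * (\<nu> * r powr (\<nu> - 1))\<bar> \<le> \<nu> * r powr (\<nu> - 1)"
        using eta01[of r] r nu01 by (simp add: abs_mult mult_left_le_one_le)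
    qed
    then show ?thesis
      unfolding h'_def norm_mult norm_of_real mult.assoc by (intro mult_left_mono) (auto simp: algebra_simps)
  qed
  \<comment> \<open>The radial factor of a difference of two truncations; a and b are their dilation
    factors.\<close>
  define k where "k a b r = of_real (\<eta> (a * r) - \<eta> (b * r)) * h r" for a b r
  define k' where "k' a b r = of_real (\<eta> (a * r) - \<eta> (b * r)) * h' r
      + of_real (a * \<eta>' (a * r) - b * \<eta>' (b * r)) * h r" for a b r
  have dk: "(k a b has_vector_derivative k' a b r) (at r)" if "r > 0" "a > 0" "b > 0" for a b r
  proof -
    have "((\<lambda>r. of_real (\<eta> (a * r) - \<eta> (b * r)) :: complex) has_vector_derivative of_real (a * \<eta>' (a * r) - b * \<eta>' (b * r))) (at r)"
      using has_vector_derivative_diff[OF has_vector_derivative_scale_arg[OF d\<eta>, of a r]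
          has_vector_derivative_scale_arg[OF d\<eta>, of b r]] that
      by (intro has_vector_derivative_of_real) (simp add: has_real_derivative_iff_has_vector_derivative)
    from has_vector_derivative_mult[OF this dh[OF that(1)]] show ?thesis
      by (simp add: k_def[abs_def] k'_def)
  qed
  \<comment> \<open>C + \<nu> bounds h', the two differentiated cutoffs add 2C, and the 1 lets the
    same constant bound the function itself.\<close>
  define D where "D = norm c * (3 * C + \<nu> + 1)"
  have D0: "D \<ge> 0" using C0 nu01 by (simp add: D_def)
  have kb: "norm (k a b r) \<le> D * r powr (\<nu> - 1) * r" and k'b: "norm (k' a b r) \<le> D * r powr (\<nu> - 1)"
    if r: "r > 0" "a > 0" "b > 0" for a b r
  proof -
    have e: "\<bar>\<eta> (a * r) - \<eta> (b * r)\<bar> \<le> 1" using eta01[of "a * r"] eta01[of "b * r"] r by auto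
    have p: "r powr \<nu> = r powr (\<nu> - 1) * r" using r by (simp add: powr_diff)
    have hb: "norm (h r) \<le> norm c * (r powr (\<nu> - 1) * r)" using h_bound[of r] r unfolding p by simp
    have "norm (k a b r) \<le> 1 * (norm c * (r powr (\<nu> - 1) * r))"
      unfolding k_def norm_mult[of "of_real _"] norm_of_real using e hb by (intro mult_mono) auto
    also have "\<dots> \<le> D * (r powr (\<nu> - 1) * r)"
    proof -
      have "norm c * 1 \<le> D" unfolding D_def using C0 nu01 by (intro mult_left_mono) auto
      then show ?thesis using r by (simp add: mult_right_mono)
    qed
    finally show "norm (k a b r) \<le> D * r powr (\<nu> - 1) * r" by (simp add: mult.assoc)
    have "\<bar>r * (a * \<eta>' (a * r) - b * \<eta>' (b * r))\<bar> \<le> 2 * C"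
      using C[of "a * r"] C[of "b * r"] r by (simp add: algebra_simps abs_le_iff)
    then have e': "\<bar>a * \<eta>' (a * r) - b * \<eta>' (b * r)\<bar> \<le> 2 * C / r"
      using r by (simp add: abs_mult pos_le_divide_eq mult.commute)
    have "norm (k' a b r) \<le> 1 * (norm c * (C + \<nu>) * r powr (\<nu> - 1)) + (2 * C / r) * (norm c * (r powr (\<nu> - 1) * r))"
      unfolding k'_def
    proof (rule norm_triangle_mono)
      show "norm (of_real (\<eta> (a * r) - \<eta> (b * r)) * h' r) \<le> 1 * (norm c * (C + \<nu>) * r powr (\<nu> - 1))"
        unfolding norm_mult[of "of_real _"] norm_of_real using e h'b[OF r(1)] by (intro mult_mono) auto
      show "norm (of_real (a * \<eta>' (a * r) - b * \<eta>' (b * r)) * h r) \<le> (2 * C / r) * (norm c * (r powr (\<nu> - 1) * r))"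
        unfolding norm_mult[of "of_real _"] norm_of_real using e' hb C0 r by (intro mult_mono) auto
    qed
    also have "\<dots> = norm c * (3 * C + \<nu>) * r powr (\<nu> - 1)" using r by (simp add: field_simps)
    also have "\<dots> \<le> D * r powr (\<nu> - 1)" unfolding D_def by (intro mult_right_mono mult_left_mono) auto
    finally show "norm (k' a b r) \<le> D * r powr (\<nu> - 1)" .
  qed
  have w_diff: "(\<lambda>x. w i x - w j x) = (\<lambda>x. k (Suc j) (Suc i) (norm x) * ang m x)" for i j
    by (simp add: fun_eq_iff w_def k_def algebra_simps)
  obtain J where J: "J \<ge> 0" "\<And>\<rho>. \<rho> > 0 \<Longrightarrow>
    (\<integral>\<^sup>+ x. indicator (ball 0 \<rho>) x * ennreal (norm (x::real^2) powr (2 * \<nu> - 2)) \<partial>lborel) \<le> ennreal (J * \<rho> powr (2 * \<nu>))"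
    using nn_integral_norm_powr[OF nu01] by blast
  define E where "E = 2 * (1 + \<nu>)\<^sup>2 * D\<^sup>2"
  have E0: "E \<ge> 0" by (simp add: E_def)
  have S: "(form_seminorm \<alpha> (\<lambda>x. w i x - w j x))\<^sup>2 \<le> ennreal (E * (J * ((R + 1) / Suc n) powr (2 * \<nu>)))"
    if ij: "i \<ge> n" "j \<ge> n" for i j n
  proof -
    define g where "g = (\<lambda>x. w i x - w j x)"
    \<comment> \<open>R + 1 instead of R, so that the closed disc of radius R/(n+1) lies in the open
      ball over which the power is integrated.\<close>
    define \<rho> where "\<rho> = (R + 1) / Suc n"
    have \<rho>: "\<rho> > 0" using R by (simp add: \<rho>_def)
    have pt: "ennreal (\<Sum>l\<in>UNIV. (norm (cov_partial \<alpha> l g x))\<^sup>2)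
        \<le> ennreal E * (indicator (ball 0 \<rho>) x * ennreal (norm x powr (2 * \<nu> - 2)))" if x: "x \<noteq> 0" for x
    proof (cases "norm x \<le> R / Suc n")
      case True
      have n: "norm x > 0" using x by simp
      have "R / Suc n < \<rho>" unfolding \<rho>_def by (intro divide_strict_right_mono) auto
      then have "x \<in> ball 0 \<rho>" using True by simp
      have "(\<Sum>l\<in>UNIV. (norm (cov_partial \<alpha> l (\<lambda>y. k (Suc j) (Suc i) (norm y) * ang m y) x))\<^sup>2)
          \<le> 2 * (1 + \<bar>of_int m + \<alpha>\<bar>)\<^sup>2 * (D * norm x powr (\<nu> - 1))\<^sup>2"
        by (rule gradient_radial_bound[OF m x dk[OF n]]) (use kb[OF n] k'b[OF n] in auto)
      then have "(\<Sum>l\<in>UNIV. (norm (cov_partial \<alpha> l g x))\<^sup>2) \<le> 2 * (1 + \<bar>of_int m + \<alpha>\<bar>)\<^sup>2 * (D * norm x powr (\<nu> - 1))\<^sup>2"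
        unfolding g_def w_diff .
      also have "\<dots> = E * norm x powr (2 * \<nu> - 2)"
        using n unfolding nu E_def power_mult_distrib
        by (simp add: powr_power algebra_simps)
      finally show ?thesis using \<open>x \<in> ball 0 \<rho>\<close> E0 by (simp add: ennreal_mult''[symmetric] ennreal_leI)
    next
      case False
      have "g y = 0" if "y \<notin> cball 0 (R / Suc n)" for y
      proof -
        have y: "R < norm y * Suc n" using that by (simp add: field_simps)
        have "norm y * real (Suc n) \<le> real (Suc i) * norm y" "norm y * real (Suc n) \<le> real (Suc j) * norm y"
          using ij by (auto simp: mult.commute[of "norm y"] intro!: mult_right_mono)
        then have "R \<le> real (Suc i) * norm y" "R \<le> real (Suc j) * norm y" using y by linarith+
        then show ?thesis unfolding g_def w_diff k_def using R(4) by simp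
      qed
      then have "cov_partial \<alpha> l g x = 0" for l
        using False partial_zero[of "cball 0 (R / Suc n)" g x l] by (simp add: cov_partial_def)
      then show ?thesis by simp
    qed
    have "(form_seminorm \<alpha> g)\<^sup>2 = (\<integral>\<^sup>+ x. ennreal (\<Sum>l\<in>UNIV. (norm (cov_partial \<alpha> l g x))\<^sup>2) \<partial>lborel)"
      by (rule form_seminorm_power2)
    also have "\<dots> \<le> (\<integral>\<^sup>+ x. ennreal E * (indicator (ball 0 \<rho>) x * ennreal (norm (x::real^2) powr (2 * \<nu> - 2))) \<partial>lborel)"
      by (rule nn_integral_mono_AE) (use AE_lborel_singleton[of "0::real^2"] pt in auto)
    also have "\<dots> = ennreal E * (\<integral>\<^sup>+ x. indicator (ball 0 \<rho>) x * ennreal (norm (x::real^2) powr (2 * \<nu> - 2)) \<partial>lborel)"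
    proof (rule nn_integral_cmult)
      have [measurable]: "ball (0::real^2) \<rho> \<in> sets borel" by simp
      show "(\<lambda>x. indicator (ball 0 \<rho>) x * ennreal (norm (x::real^2) powr (2 * \<nu> - 2))) \<in> borel_measurable lborel"
        by measurable
    qed
    also have "\<dots> \<le> ennreal E * ennreal (J * \<rho> powr (2 * \<nu>))"
      by (intro mult_left_mono J(2) \<rho>) auto
    also have "\<dots> = ennreal (E * (J * \<rho> powr (2 * \<nu>)))" using E0 J by (simp add: ennreal_mult)
    finally show ?thesis unfolding g_def \<rho>_def .
  qed
  have lim0: "(\<lambda>n. (R + 1) / Suc n) \<longlonglongrightarrow> 0"
    using tendsto_mult_left[OF LIMSEQ_inverse_real_of_nat, of "R + 1"] by (simp add: divide_inverse)
  have "\<exists>K. \<forall>i\<ge>K. \<forall>j\<ge>K. form_seminorm \<alpha> (\<lambda>x. w i x - w j x) < ennreal e" if e: "e > 0" for e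
  proof -
    have "(\<lambda>n. ((R + 1) / Suc n) powr (2 * \<nu>)) \<longlonglongrightarrow> 0"
      by (rule tendsto_zero_powrI[OF lim0 tendsto_const]) (use R nu01 in auto)
    from tendsto_mult_left[OF this, of "E * J"]
    have "(\<lambda>n. E * (J * ((R + 1) / Suc n) powr (2 * \<nu>))) \<longlonglongrightarrow> 0" by (simp add: mult.assoc)
    then have "\<forall>\<^sub>F n in sequentially. E * (J * ((R + 1) / Suc n) powr (2 * \<nu>)) < e\<^sup>2"
      by (rule order_tendstoD) (use e in auto)
    then obtain n where n: "E * (J * ((R + 1) / Suc n) powr (2 * \<nu>)) < e\<^sup>2"
      unfolding eventually_sequentially by blast
    have "form_seminorm \<alpha> (\<lambda>x. w i x - w j x) < ennreal e" if "i \<ge> n" "j \<ge> n" for i j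
    proof -
      have "(form_seminorm \<alpha> (\<lambda>x. w i x - w j x))\<^sup>2 < ennreal (e\<^sup>2)"
        using S[OF that] n E0 J(1) by (auto intro: le_less_trans simp: ennreal_less_iff)
      then show ?thesis using ennreal_power_less_iff[of 2 e] e by simp
    qed
    then show ?thesis by blast
  qed
  moreover have "(\<lambda>n. Lp_norm 2 (\<lambda>x. w n x - f x)) \<longlonglongrightarrow> 0"
  proof -
    define B where "B = norm c * R powr \<nu>"
    have L: "(\<lambda>x. w n x - f x) \<in> L2" for n by (intro L2_diff test_funs_L2 w_test f_L2)
    have "l2 (\<lambda>x. w n x - f x) \<le> B * (sqrt vol2 * ((R + 1) / Suc n))" for n
    proof (rule L2_bounded_support(2)[OF L2_measurable[OF L]])
      have eq: "w n x - f x = - (of_real (\<eta> (Suc n * norm x)) * f x)" for x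
        by (simp add: w_def f_def algebra_simps)
      have "norm (w n x - f x) \<le> 1 * B" for x
        unfolding eq norm_minus_cancel norm_mult norm_of_real B_def
        using eta01[of "Suc n * norm x"] by (intro mult_mono f_bound(1)[OF R(2) R(4)]) auto
      then show "norm (w n x - f x) \<le> B" for x by simp
      show "w n x - f x = 0" if "norm x \<ge> (R + 1) / Suc n" for x
      proof -
        have "R + 1 \<le> Suc n * norm x" using that by (simp add: field_simps)
        then show ?thesis unfolding eq using R(4)[of "Suc n * norm x"] by simp
      qed
    qed (use R in auto)
    then have le: "\<forall>\<^sub>F n in sequentially. l2 (\<lambda>x. w n x - f x) \<le> B * (sqrt vol2 * ((R + 1) / Suc n))" by simp
    have lim: "(\<lambda>n. B * (sqrt vol2 * ((R + 1) / Suc n))) \<longlonglongrightarrow> 0"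
      using tendsto_mult_left[OF lim0, of "B * sqrt vol2"] by (simp only: mult.assoc mult_zero_right)
    have "(\<lambda>n. l2 (\<lambda>x. w n x - f x)) \<longlonglongrightarrow> 0"
      by (rule tendsto_sandwich[OF _ le tendsto_const lim]) simp
    then have "(\<lambda>n. ennreal (l2 (\<lambda>x. w n x - f x))) \<longlonglongrightarrow> ennreal 0" by (rule tendsto_ennrealI)
    then show ?thesis by (simp only: Lp_norm_l2[OF L] ennreal_0)
  qed
  ultimately have "approximates (form_seminorm \<alpha>) w f"
    using w_test f_L2 by (auto simp: approximates_def)
  then show ?thesis by (auto simp: form_dom_def test_closure_def)
qed

text \<open>Near the origin the profile is a zero mode and far out it vanishes, so off the origin
  \<open>Hop \<alpha> f\<close> lives on a compact annulus, where it is continuous.\<close>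

lemma Hop_f_L2: "Hop \<alpha> f \<in> L2"
proof -
  obtain d R C where "cutoff_data \<eta> d R C" by (rule radial_cutoffE[OF cut])
  note R = cutoff_dataD[OF this]
  have cont: "continuous_on (- {0}) (Hop \<alpha> f)"
    using Ck_on_Hop[OF f_Ck, of 0] by simp
  have z1: "Hop \<alpha> f x = 0" if "x \<noteq> 0" "norm x < d" for x
  proof -
    have "Hop \<alpha> f x = Hop \<alpha> (\<lambda>y. c * of_real (norm y powr \<nu>) * ang m y) x"
      by (rule Hop_cong_open[of "ball 0 d"]) (use that R(3) in \<open>auto simp: f_def h_def\<close>)
    then show ?thesis using Hop_power_zero[OF m that(1) nu] by simp
  qed
  have z2: "Hop \<alpha> f x = 0" if "norm x > R" for x
  proof -
    have "Hop \<alpha> f x = Hop \<alpha> (\<lambda>y. 0) x"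
      by (rule Hop_cong_open[of "- cball 0 R"]) (use that f_bound(2)[OF R(2) R(4)] in auto)
    moreover have "cov_partial \<alpha> j (\<lambda>y. 0) = (\<lambda>y. 0)" for j
      by (simp add: fun_eq_iff cov_partial_def partial_def frechet_derivative_const)
    ultimately show ?thesis by (simp add: Hop_def)
  qed
  define A where "A = cball (0::real^2) (R + 1) - ball 0 (d / 2)"
  have "compact A" unfolding A_def by (intro compact_diff) auto
  moreover have "continuous_on A (Hop \<alpha> f)"
    by (rule continuous_on_subset[OF cont]) (use R in \<open>auto simp: A_def\<close>)
  ultimately have "bounded (Hop \<alpha> f ` A)" by (intro compact_imp_bounded compact_continuous_image)
  then obtain B where B: "\<And>x. x \<in> A \<Longrightarrow> norm (Hop \<alpha> f x) \<le> B" unfolding bounded_iff by auto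
  \<comment> \<open>The origin is treated apart, since the pointwise expression has an uncontrolled
    value there.\<close>
  have b: "norm (Hop \<alpha> f x) \<le> max B (norm (Hop \<alpha> f 0))" for x
  proof (cases "x = 0 \<or> x \<in> A")
    case True
    then show ?thesis using B[of x] by auto
  next
    case False
    then have "Hop \<alpha> f x = 0" using z1[of x] z2[of x] R by (auto simp: A_def)
    then show ?thesis by (simp add: le_max_iff_disj)
  qed
  have z3: "Hop \<alpha> f x = 0" if "norm x \<ge> R + 1" for x by (rule z2) (use that in simp)
  have R1: "0 \<le> R + 1" using R(2) by simp
  show ?thesis
    by (rule L2_bounded_support(1)[OF continuous_off_0_measurable[OF cont] b R1 z3])
qed

lemma f_H_graph: "H_graph \<alpha> f (Hop \<alpha> f)"
proof (rule H_graphI[OF f_form_dom Hop_f_L2])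
  fix \<psi> assume "\<psi> \<in> test_funs"
  then obtain K where "\<And>k. tst k K \<psi>" by (metis test_funs_imp_tst)
  then show "pairing f (Hop \<alpha> \<psi>) = pairing (Hop \<alpha> f) \<psi>" using pairing_Hop_sym[OF f_Ck] by blast
qed

lemma f_H_dom: "f \<in> H_dom \<alpha>"
  using f_H_graph by (auto simp: H_dom_def)

end

subsection \<open>Uniqueness of the singular coefficients\<close>

text \<open>The square of the last summand of \<open>Y_norm\<close>. A nonzero combination of
  r^\<alpha> and r^(1-\<alpha>) e^(-i\<theta>) has infinite weight near the origin, which is what
  separates these functions from \<open>Y_space\<close>.\<close>

definition wt :: "fld \<Rightarrow> ennreal" where
  "wt v = (\<integral>\<^sup>+ x. ennreal ((norm (v x))\<^sup>2 / (norm (x::real^2)) ^ 4) \<partial>lborel)"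

lemma wt_le_Y_norm: "wt v \<le> (Y_norm v)\<^sup>2"
proof -
  have "wt v = (eLp lborel 2 (\<lambda>x. ennreal (norm (v x) / (norm x)\<^sup>2)))\<^sup>2"
    unfolding wt_def by (subst eLp_power) (simp_all add: ennreal_power power_divide flip: power_mult)
  also have "\<dots> \<le> (Y_norm v)\<^sup>2"
    unfolding Y_norm_def by (intro power_mono) (auto intro: add_increasing)
  finally show ?thesis .
qed

lemma wt_test_fun:
  assumes "v \<in> test_funs"
  shows "wt v < top"
proof -
  obtain K where K: "\<And>k. tst k K v" using test_funs_imp_tst[OF assms] by metis
  have "Ck_on 0 (- {0}) (\<lambda>x. v x * complex_of_real (norm x powr (-4)))"
    by (intro Ck_on_mult Ck_on_of_real Ck_on_norm_powr tst_subset0[OF K]) auto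
  from tst_integrable[OF tst_mult_cnj[OF this K]]
  have "(\<integral>\<^sup>+ x. ennreal (norm (v x * complex_of_real (norm x powr (-4)) * cnj (v x))) \<partial>lborel) < top"
    by (simp add: integrable_iff_bounded)
  moreover have "norm (v x * complex_of_real (norm x powr (-4)) * cnj (v x)) = (norm (v x))\<^sup>2 / (norm x) ^ 4" for x
    by (simp add: norm_mult power2_eq_square powr_minus divide_inverse norm_inverse norm_power)
  ultimately show ?thesis by (simp add: wt_def)
qed

lemma norm_diff_sq_le: "(norm (a::complex))\<^sup>2 \<le> 2 * (norm (a - b))\<^sup>2 + 2 * (norm b)\<^sup>2"
proof -
  have "norm a \<le> norm (a - b) + norm b" using norm_triangle_ineq[of "a - b" b] by simp
  then have "(norm a)\<^sup>2 \<le> (norm (a - b) + norm b)\<^sup>2" by (intro power_mono) auto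
  then show ?thesis using sum_squares_bound[of "norm (a - b)" "norm b"] by (simp add: power2_sum)
qed

lemma ennreal_le_lin2:
  assumes "a \<le> p * u + q * v" "0 \<le> p" "0 \<le> u" "0 \<le> q" "0 \<le> v"
  shows "ennreal a \<le> ennreal p * ennreal u + ennreal q * ennreal v"
  using ennreal_leI[OF assms(1)] assms(2-) by (simp only: ennreal_plus ennreal_mult mult_nonneg_nonneg)

lemma ennreal_le_lin3:
  assumes "a \<le> p * u + (q * v + r * w)" "0 \<le> p" "0 \<le> u" "0 \<le> q" "0 \<le> v" "0 \<le> r" "0 \<le> w"
  shows "ennreal a \<le> ennreal p * ennreal u + (ennreal q * ennreal v + ennreal r * ennreal w)"
  using ennreal_leI[OF assms(1)] assms(2-)
  by (simp only: ennreal_plus ennreal_mult mult_nonneg_nonneg add_nonneg_nonneg)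

lemma ennreal_lin2:
  assumes "0 \<le> p" "0 \<le> u" "0 \<le> q" "0 \<le> v"
  shows "ennreal p * ennreal u + ennreal q * ennreal v = ennreal (p * u + q * v)"
  using assms by (simp only: ennreal_plus ennreal_mult mult_nonneg_nonneg)

text \<open>Formulated with the cut |x| > \<rho> because members of \<open>Y_space\<close> are given
  as L^2 limits; away from the origin the weight is bounded and survives the limit.\<close>

definition weight_bound :: "fld \<Rightarrow> real \<Rightarrow> bool" where
  "weight_bound \<psi> M \<longleftrightarrow> M \<ge> 0 \<and> (\<forall>\<rho>>0.
    (\<integral>\<^sup>+ x. indicator {x::real^2. \<rho> < norm x} x * ennreal ((norm (\<psi> x))\<^sup>2 / (norm x) ^ 4) \<partial>lborel) \<le> ennreal M)"

lemma weight_boundD: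
  assumes "weight_bound \<psi> M"
  shows "M \<ge> 0" "\<And>\<rho>. \<rho> > 0 \<Longrightarrow>
    (\<integral>\<^sup>+ x. indicator {x::real^2. \<rho> < norm x} x * ennreal ((norm (\<psi> x))\<^sup>2 / (norm x) ^ 4) \<partial>lborel) \<le> ennreal M"
  using assms unfolding weight_bound_def by simp_all

text \<open>For given \<rho> choose n with L^2 distance of \<open>w n\<close> to \<psi> below
  \<rho>^2, which compensates the weight 1/\<rho>^4. Then \<open>w n\<close> is compared with one
  fixed \<open>w K\<close> in \<open>Y_norm\<close>. The three parts add up to 2 + 4 + 4
  \<open>MK\<close>, whatever \<rho> is.\<close>

lemma Y_space_weight_bound:
  assumes "\<psi> \<in> Y_space"
  obtains M where "weight_bound \<psi> M"
proof -
  obtain w where w: "approximates Y_norm w \<psi>" using assms by (auto simp: Y_space_def test_closure_def)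
  have t: "w n \<in> test_funs" for n using w by (auto simp: approximates_def)
  have \<psi>: "\<psi> \<in> L2" using w by (auto simp: approximates_def)
  note [measurable] = L2_measurable[OF \<psi>] L2_measurable[OF test_funs_L2[OF t]]
  have "\<exists>K. \<forall>m\<ge>K. \<forall>n\<ge>K. Y_norm (\<lambda>x. w m x - w n x) < ennreal 1"
    using w unfolding approximates_def by (metis zero_less_one)
  then obtain K where K: "\<And>m n. m \<ge> K \<Longrightarrow> n \<ge> K \<Longrightarrow> Y_norm (\<lambda>x. w m x - w n x) < ennreal 1" by blast
  obtain MK where MK: "MK \<ge> 0" "wt (w K) = ennreal MK"
    using wt_test_fun[OF t[of K]] by (cases "wt (w K)" rule: ennreal_cases) auto
  have "(\<integral>\<^sup>+ x. indicator {x::real^2. \<rho> < norm x} x * ennreal ((norm (\<psi> x))\<^sup>2 / (norm x) ^ 4) \<partial>lborel) \<le> ennreal (6 + 4 * MK)"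
    if \<rho>: "\<rho> > 0" for \<rho>
  proof -
    have "\<forall>\<^sub>F n in sequentially. l2 (\<lambda>x. w n x - \<psi> x) < \<rho>\<^sup>2"
      using approximates_tendsto[OF w] by (rule order_tendstoD) (use \<rho> in auto)
    then obtain N where N: "\<And>n. n \<ge> N \<Longrightarrow> l2 (\<lambda>x. w n x - \<psi> x) < \<rho>\<^sup>2" unfolding eventually_sequentially by blast
    define n where "n = max N K"
    have n: "l2 (\<lambda>x. w n x - \<psi> x) < \<rho>\<^sup>2" "Y_norm (\<lambda>x. w n x - w K x) < ennreal 1"
      using N[of n] K[of n K] by (auto simp: n_def)
    have d: "(\<lambda>x. w n x - \<psi> x) \<in> L2" by (intro L2_diff test_funs_L2 t \<psi>)
    have pt: "indicator {x::real^2. \<rho> < norm x} x * ennreal ((norm (\<psi> x))\<^sup>2 / (norm x) ^ 4)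
      \<le> ennreal (2 / \<rho> ^ 4) * ennreal ((norm (w n x - \<psi> x))\<^sup>2)
        + (ennreal 4 * ennreal ((norm (w n x - w K x))\<^sup>2 / (norm x) ^ 4)
        + ennreal 4 * ennreal ((norm (w K x))\<^sup>2 / (norm x) ^ 4))" for x
    proof (cases "\<rho> < norm x")
      case True
      have p: "\<rho> ^ 4 \<le> norm x ^ 4" using True \<rho> by (intro power_mono) auto
      have x4: "norm x ^ 4 > 0" using True \<rho> by (intro zero_less_power) linarith
      have "(norm (\<psi> x))\<^sup>2 \<le> 2 * (norm (w n x - \<psi> x))\<^sup>2 + 2 * (norm (w n x))\<^sup>2"
        using norm_diff_sq_le[of "\<psi> x" "w n x"] by (simp add: norm_minus_commute)
      also have "\<dots> \<le> 2 * (norm (w n x - \<psi> x))\<^sup>2 + (4 * (norm (w n x - w K x))\<^sup>2 + 4 * (norm (w K x))\<^sup>2)"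
        using norm_diff_sq_le[of "w n x" "w K x"] by simp
      finally have "(norm (\<psi> x))\<^sup>2 / norm x ^ 4 \<le> (2 * (norm (w n x - \<psi> x))\<^sup>2 + (4 * (norm (w n x - w K x))\<^sup>2 + 4 * (norm (w K x))\<^sup>2)) / norm x ^ 4"
        by (intro divide_right_mono) auto
      also have "\<dots> = 2 * (norm (w n x - \<psi> x))\<^sup>2 / norm x ^ 4 + (4 * ((norm (w n x - w K x))\<^sup>2 / norm x ^ 4) + 4 * ((norm (w K x))\<^sup>2 / norm x ^ 4))"
        by (simp add: add_divide_distrib)
      also have "2 * (norm (w n x - \<psi> x))\<^sup>2 / norm x ^ 4 \<le> 2 * (norm (w n x - \<psi> x))\<^sup>2 / \<rho> ^ 4"
        using p \<rho> x4 by (intro divide_left_mono) auto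
      finally have "(norm (\<psi> x))\<^sup>2 / norm x ^ 4 \<le> (2 / \<rho> ^ 4) * (norm (w n x - \<psi> x))\<^sup>2
          + (4 * ((norm (w n x - w K x))\<^sup>2 / norm x ^ 4) + 4 * ((norm (w K x))\<^sup>2 / norm x ^ 4))"
        by simp
      then have "ennreal ((norm (\<psi> x))\<^sup>2 / norm x ^ 4) \<le> ennreal (2 / \<rho> ^ 4) * ennreal ((norm (w n x - \<psi> x))\<^sup>2)
        + (ennreal 4 * ennreal ((norm (w n x - w K x))\<^sup>2 / (norm x) ^ 4)
        + ennreal 4 * ennreal ((norm (w K x))\<^sup>2 / (norm x) ^ 4))"
        by (rule ennreal_le_lin3) (use \<rho> in auto)
      then show ?thesis using True by (simp only: indicator_simps mem_Collect_eq mult_1)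
    qed simp
    have m: "(\<lambda>x. ennreal ((norm (w n x - \<psi> x))\<^sup>2)) \<in> borel_measurable lborel"
      "(\<lambda>x::real^2. ennreal ((norm (w n x - w K x))\<^sup>2 / (norm x) ^ 4)) \<in> borel_measurable lborel"
      "(\<lambda>x::real^2. ennreal ((norm (w K x))\<^sup>2 / (norm x) ^ 4)) \<in> borel_measurable lborel"
      by measurable
    have 1: "(\<integral>\<^sup>+ x. indicator {x::real^2. \<rho> < norm x} x * ennreal ((norm (\<psi> x))\<^sup>2 / (norm x) ^ 4) \<partial>lborel)
      \<le> (\<integral>\<^sup>+ x. ennreal (2 / \<rho> ^ 4) * ennreal ((norm (w n x - \<psi> x))\<^sup>2)
        + (ennreal 4 * ennreal ((norm (w n x - w K x))\<^sup>2 / (norm (x::real^2)) ^ 4)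
        + ennreal 4 * ennreal ((norm (w K x))\<^sup>2 / (norm x) ^ 4)) \<partial>lborel)"
      by (rule nn_integral_mono) (rule pt)
    have 2: "(\<integral>\<^sup>+ x. ennreal (2 / \<rho> ^ 4) * ennreal ((norm (w n x - \<psi> x))\<^sup>2)
        + (ennreal 4 * ennreal ((norm (w n x - w K x))\<^sup>2 / (norm (x::real^2)) ^ 4)
        + ennreal 4 * ennreal ((norm (w K x))\<^sup>2 / (norm x) ^ 4)) \<partial>lborel)
      = ennreal (2 / \<rho> ^ 4) * (\<integral>\<^sup>+ x. ennreal ((norm (w n x - \<psi> x))\<^sup>2) \<partial>lborel)
        + (ennreal 4 * wt (\<lambda>x. w n x - w K x) + ennreal 4 * wt (w K))"
      unfolding wt_def
      by (simp only: nn_integral_add nn_integral_cmult m borel_measurable_times_ennreal borel_measurable_const borel_measurable_add)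
    have 3: "(\<integral>\<^sup>+ x. ennreal ((norm (w n x - \<psi> x))\<^sup>2) \<partial>lborel) = ennreal ((l2 (\<lambda>x. w n x - \<psi> x))\<^sup>2)"
      using d by (simp add: l2_sq L2_iff nn_integral_eq_integral)
    have 4: "ennreal (2 / \<rho> ^ 4) * ennreal ((l2 (\<lambda>x. w n x - \<psi> x))\<^sup>2) \<le> ennreal 2 * ennreal 1"
    proof -
      have "(l2 (\<lambda>x. w n x - \<psi> x))\<^sup>2 \<le> (\<rho>\<^sup>2)\<^sup>2" using n(1) by (intro power_mono) auto
      then have "(2 / \<rho> ^ 4) * (l2 (\<lambda>x. w n x - \<psi> x))\<^sup>2 \<le> (2 / \<rho> ^ 4) * \<rho> ^ 4"
        using \<rho> by (intro mult_left_mono) (auto simp flip: power_mult)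
      then have le2: "(2 / \<rho> ^ 4) * (l2 (\<lambda>x. w n x - \<psi> x))\<^sup>2 \<le> 2" using \<rho> by simp
      have "ennreal (2 / \<rho> ^ 4) * ennreal ((l2 (\<lambda>x. w n x - \<psi> x))\<^sup>2) = ennreal ((2 / \<rho> ^ 4) * (l2 (\<lambda>x. w n x - \<psi> x))\<^sup>2)"
        by (rule ennreal_mult[symmetric]) (use \<rho> in auto)
      also have "\<dots> \<le> ennreal 2" by (rule ennreal_leI[OF le2])
      finally show ?thesis by (simp only: ennreal_1 mult_1_right)
    qed
    have 5: "wt (\<lambda>x. w n x - w K x) \<le> ennreal 1"
    proof -
      have "(Y_norm (\<lambda>x. w n x - w K x))\<^sup>2 \<le> (ennreal 1)\<^sup>2" by (rule power_mono[OF less_imp_le[OF n(2)]]) simp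
      then show ?thesis using wt_le_Y_norm[of "\<lambda>x. w n x - w K x"] by (simp add: order_trans)
    qed
    have "ennreal (2 / \<rho> ^ 4) * ennreal ((l2 (\<lambda>x. w n x - \<psi> x))\<^sup>2)
        + (ennreal 4 * wt (\<lambda>x. w n x - w K x) + ennreal 4 * wt (w K))
      \<le> ennreal 2 * ennreal 1 + (ennreal 4 * ennreal 1 + ennreal 4 * ennreal MK)"
      unfolding MK(2) by (rule add_mono[OF 4 add_mono[OF mult_left_mono[OF 5] order_refl]]) simp
    also have "\<dots> = ennreal 2 * ennreal 1 + ennreal 1 * ennreal (4 + 4 * MK)"
      using ennreal_lin2[of 4 1 4 MK] MK(1) by simp
    also have "\<dots> = ennreal (6 + 4 * MK)"
      using ennreal_lin2[of 2 1 1 "4 + 4 * MK"] MK(1) by simp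
    finally show ?thesis using 1 unfolding 2 3 by (rule order_trans[rotated])
  qed
  then show ?thesis using that[of "6 + 4 * MK"] MK(1) unfolding weight_bound_def by simp
qed

lemma powr_blowup:
  assumes "X \<ge> 0" "s < 0" "\<delta> > 0" and b: "\<And>\<rho>. 0 < \<rho> \<Longrightarrow> \<rho> < \<delta> \<Longrightarrow> X * \<rho> powr s \<le> Q"
  shows "X = (0::real)"
proof (rule ccontr)
  assume "X \<noteq> 0"
  then have X: "X > 0" using assms by simp
  have "filterlim (\<lambda>\<rho>::real. \<rho> powr s) at_top (at_right 0)"
    using assms(2) by real_asymp
  then have "\<forall>\<^sub>F \<rho> in at_right 0. \<rho> powr s > Q / X" by (simp add: filterlim_at_top_dense)
  moreover have "\<forall>\<^sub>F \<rho> in at_right 0. 0 < \<rho> \<and> \<rho> < \<delta>"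
    using assms(3) by (auto simp: eventually_at_right_field intro!: exI[of _ \<delta>])
  ultimately have "\<forall>\<^sub>F \<rho> in at_right (0::real). False"
  proof eventually_elim
    case (elim \<rho>)
    then show ?case using b[of \<rho>] X by (auto simp: field_simps)
  qed
  then show False by simp
qed

text \<open>A disc of radius \<rho>/2 centred at distance 3\<rho>/2 fits into the ring, and the
  integrand is at least X (2\<rho>)^(2\<beta>-4) on it. The integral is therefore at least a
  constant times X \<rho>^(2\<beta>-2), which is unbounded as \<rho> tends to 0 unless X =
  0.\<close>

lemma annulus_weight:
  assumes "X \<ge> 0" "\<beta> < 1" "\<delta> > 0" "Q \<ge> 0"
    and b: "\<And>\<rho>. 0 < \<rho> \<Longrightarrow> \<rho> < \<delta> \<Longrightarrow>
      (\<integral>\<^sup>+ x. indicator {x::real^2. \<rho> < norm x \<and> norm x < 2 * \<rho>} x * ennreal (X * norm x powr (2 * \<beta>) / norm x ^ 4) \<partial>lborel) \<le> ennreal Q"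
  shows "X = 0"
proof -
  have "X * (2 powr (2 * \<beta> - 4) * vol2 / 4) * \<rho> powr (2 * \<beta> - 2) \<le> Q" if \<rho>: "0 < \<rho>" "\<rho> < \<delta>" for \<rho>
  proof -
    define p :: "real^2" where "p = (3 / 2 * \<rho>) *\<^sub>R axis 1 1"
    have np: "norm p = 3 / 2 * \<rho>" using \<rho> by (simp add: p_def)
    have pt: "ennreal (X * (2 * \<rho>) powr (2 * \<beta> - 4)) * indicator (ball p (\<rho> / 2)) x
      \<le> indicator {x::real^2. \<rho> < norm x \<and> norm x < 2 * \<rho>} x * ennreal (X * norm x powr (2 * \<beta>) / norm x ^ 4)" for x
    proof (cases "x \<in> ball p (\<rho> / 2)")
      case True
      then have d: "norm (p - x) < \<rho> / 2" by (simp add: dist_norm)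
      have x: "\<rho> < norm x" "norm x < 2 * \<rho>"
        using d norm_triangle_ineq2[of p x] norm_triangle_ineq3[of p x] np by linarith+
      have "(2 * \<rho>) powr (2 * \<beta> - 4) \<le> norm x powr (2 * \<beta> - 4)"
        using x \<rho> assms by (intro powr_mono2') auto
      also have "\<dots> = norm x powr (2 * \<beta>) / norm x ^ 4"
        using x \<rho> powr_realpow[of "norm x" 4] by (simp add: powr_diff)
      finally have "X * (2 * \<rho>) powr (2 * \<beta> - 4) \<le> X * (norm x powr (2 * \<beta>) / norm x ^ 4)"
        using assms by (intro mult_left_mono) auto
      then show ?thesis using True x by (simp add: ennreal_leI)
    qed simp
    have "ennreal (X * (2 * \<rho>) powr (2 * \<beta> - 4) * (vol2 * (\<rho> / 2)\<^sup>2))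
      = (\<integral>\<^sup>+ x. ennreal (X * (2 * \<rho>) powr (2 * \<beta> - 4)) * indicator (ball p (\<rho> / 2)) x \<partial>lborel)"
      using \<rho> assms vol2_pos
      by (subst nn_integral_cmult_indicator) (auto simp: emeasure_ball_2 ennreal_mult less_imp_le)
    also have "\<dots> \<le> (\<integral>\<^sup>+ x. indicator {x::real^2. \<rho> < norm x \<and> norm x < 2 * \<rho>} x * ennreal (X * norm x powr (2 * \<beta>) / norm x ^ 4) \<partial>lborel)"
      by (rule nn_integral_mono) (rule pt)
    also have "\<dots> \<le> ennreal Q" by (rule b[OF \<rho>])
    finally have "X * (2 * \<rho>) powr (2 * \<beta> - 4) * (vol2 * (\<rho> / 2)\<^sup>2) \<le> Q" using assms by simp
    then have "X * vol2 * ((2 * \<rho>) powr (2 * \<beta> - 4) * (\<rho> / 2)\<^sup>2) \<le> Q" by (simp only: mult_ac)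
    moreover have "(2 * \<rho>) powr (2 * \<beta> - 4) * (\<rho> / 2)\<^sup>2 = 2 powr (2 * \<beta> - 4) / 4 * \<rho> powr (2 * \<beta> - 2)"
    proof -
      have "\<rho> powr (2 * \<beta> - 2) = \<rho> powr (2 * \<beta> - 4) * \<rho> powr 2" by (simp add: powr_add[symmetric])
      then show ?thesis using \<rho> by (simp add: powr_mult power_divide)
    qed
    ultimately have "X * vol2 * (2 powr (2 * \<beta> - 4) / 4 * \<rho> powr (2 * \<beta> - 2)) \<le> Q" by metis
    then show ?thesis by (simp add: mult_ac)
  qed
  from powr_blowup[OF _ _ assms(3) this] have "X * (2 powr (2 * \<beta> - 4) * vol2 / 4) = 0"
    using assms vol2_pos by auto
  then show ?thesis using vol2_pos by simp
qed

lemma nn_integral_reflect: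
  fixes F :: "'a::euclidean_space \<Rightarrow> ennreal"
  assumes [measurable]: "F \<in> borel_measurable borel"
  shows "(\<integral>\<^sup>+ x. F (- x) \<partial>lborel) = (\<integral>\<^sup>+ x. F x \<partial>lborel)"
proof -
  have "lborel = distr lborel borel (\<lambda>x::'a. - x)"
    using lborel_affine[of "-1" "0::'a"] by (simp add: density_1)
  then have "(\<integral>\<^sup>+ x. F x \<partial>lborel) = (\<integral>\<^sup>+ x. F x \<partial>distr lborel borel (\<lambda>x::'a. - x))" by simp
  also have "\<dots> = (\<integral>\<^sup>+ x. F (- x) \<partial>lborel)" by (subst nn_integral_distr) auto
  finally show ?thesis by simp
qed

lemma ang_m1_reflect: "ang (-1) (- x) = - ang (-1) x"
  by (simp add: ang_m1 algebra_simps)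

lemma powr_sq: "(t powr a)\<^sup>2 = t powr (2 * a)" for t a :: real
  by (simp add: power2_eq_square powr_add[symmetric])

text \<open>Parity separates the two functions: r^\<alpha> is even and r^(1-\<alpha>) e^(-i\<theta>)
  is odd. Adding or subtracting the reflected function isolates one of them with the weighted norm
  still bounded on every small ring, and \<open>annulus_weight\<close> makes its coefficient
  vanish.\<close>

lemma singular_part_unique:
  fixes A B :: complex
  assumes \<alpha>: "0 < \<alpha>" "\<alpha> < 1" and Y: "\<psi> \<in> Y_space" "\<psi>' \<in> Y_space" and \<delta>: "\<delta> > 0"
    and eq: "AE x in lborel. norm x < \<delta> \<longrightarrow>
      \<psi>' x - \<psi> x = A * of_real (norm x powr \<alpha>) + B * of_real (norm x powr (1 - \<alpha>)) * ang (-1) x"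
  shows "A = 0" "B = 0"
proof -
  define F where "F x = A * of_real (norm x powr \<alpha>) + B * of_real (norm x powr (1 - \<alpha>)) * ang (-1) x" for x :: "real^2"
  have [measurable]: "ang (-1) \<in> borel_measurable borel" by (rule ang_measurable) simp
  have Fm [measurable]: "F \<in> borel_measurable borel" unfolding F_def[abs_def] by measurable
  have "\<psi> \<in> L2" "\<psi>' \<in> L2" using Y by (auto simp: Y_space_def test_closure_def approximates_def)
  note [measurable] = this[THEN L2_measurable]
  obtain M where "weight_bound \<psi> M" by (rule Y_space_weight_bound[OF Y(1)])
  note M = weight_boundD[OF this]
  obtain M' where "weight_bound \<psi>' M'" by (rule Y_space_weight_bound[OF Y(2)])
  note M' = weight_boundD[OF this]
  define N where "N \<rho> = {x::real^2. \<rho> < norm x \<and> norm x < 2 * \<rho>}" for \<rho>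
  have Nm [measurable]: "N \<rho> \<in> sets borel" for \<rho> unfolding N_def by measurable
  define I where "I \<rho> = (\<integral>\<^sup>+ x. indicator (N \<rho>) x * ennreal ((norm (F x))\<^sup>2 / (norm x) ^ 4) \<partial>lborel)" for \<rho>
  have I: "I \<rho> \<le> ennreal (2 * M + 2 * M')" if \<rho>: "0 < \<rho>" "\<rho> < \<delta> / 2" for \<rho>
  proof -
    have "I \<rho> \<le> (\<integral>\<^sup>+ x. ennreal 2 * (indicator {x::real^2. \<rho> < norm x} x * ennreal ((norm (\<psi> x))\<^sup>2 / (norm x) ^ 4))
       + ennreal 2 * (indicator {x::real^2. \<rho> < norm x} x * ennreal ((norm (\<psi>' x))\<^sup>2 / (norm x) ^ 4)) \<partial>lborel)"
      unfolding I_def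
    proof (rule nn_integral_mono_AE)
      show "AE x in lborel. indicator (N \<rho>) x * ennreal ((norm (F x))\<^sup>2 / (norm x) ^ 4)
         \<le> ennreal 2 * (indicator {x::real^2. \<rho> < norm x} x * ennreal ((norm (\<psi> x))\<^sup>2 / (norm x) ^ 4))
       + ennreal 2 * (indicator {x::real^2. \<rho> < norm x} x * ennreal ((norm (\<psi>' x))\<^sup>2 / (norm x) ^ 4))"
        using eq
      proof (rule AE_mp, intro AE_I2 impI)
        fix x :: "real^2"
        assume e: "norm x < \<delta> \<longrightarrow> \<psi>' x - \<psi> x = A * of_real (norm x powr \<alpha>) + B * of_real (norm x powr (1 - \<alpha>)) * ang (-1) x"
        show "indicator (N \<rho>) x * ennreal ((norm (F x))\<^sup>2 / (norm x) ^ 4)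
         \<le> ennreal 2 * (indicator {x::real^2. \<rho> < norm x} x * ennreal ((norm (\<psi> x))\<^sup>2 / (norm x) ^ 4))
       + ennreal 2 * (indicator {x::real^2. \<rho> < norm x} x * ennreal ((norm (\<psi>' x))\<^sup>2 / (norm x) ^ 4))"
        proof (cases "x \<in> N \<rho>")
          case True
          then have x: "\<rho> < norm x" "norm x < \<delta>" using \<rho> by (auto simp: N_def)
          then have "F x = \<psi>' x - \<psi> x" using e by (simp add: F_def)
          then have "(norm (F x))\<^sup>2 \<le> 2 * (norm (\<psi> x))\<^sup>2 + 2 * (norm (\<psi>' x))\<^sup>2"
            using norm_diff_sq_le[of "F x" "\<psi>' x"] by simp
          then have "(norm (F x))\<^sup>2 / norm x ^ 4 \<le> (2 * (norm (\<psi> x))\<^sup>2 + 2 * (norm (\<psi>' x))\<^sup>2) / norm x ^ 4"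
            by (intro divide_right_mono) auto
          then have "(norm (F x))\<^sup>2 / norm x ^ 4 \<le> 2 * ((norm (\<psi> x))\<^sup>2 / norm x ^ 4) + 2 * ((norm (\<psi>' x))\<^sup>2 / norm x ^ 4)"
            by (simp add: add_divide_distrib)
          then have "ennreal ((norm (F x))\<^sup>2 / norm x ^ 4)
              \<le> ennreal 2 * ennreal ((norm (\<psi> x))\<^sup>2 / norm x ^ 4) + ennreal 2 * ennreal ((norm (\<psi>' x))\<^sup>2 / norm x ^ 4)"
            by (rule ennreal_le_lin2) auto
          then show ?thesis using True x by (simp only: indicator_simps mem_Collect_eq mult_1)
        qed simp
      qed
    qed
    also have "\<dots> = ennreal 2 * (\<integral>\<^sup>+ x. indicator {x::real^2. \<rho> < norm x} x * ennreal ((norm (\<psi> x))\<^sup>2 / (norm x) ^ 4) \<partial>lborel)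
       + ennreal 2 * (\<integral>\<^sup>+ x. indicator {x::real^2. \<rho> < norm x} x * ennreal ((norm (\<psi>' x))\<^sup>2 / (norm x) ^ 4) \<partial>lborel)"
    proof -
      have [measurable]: "{x::real^2. \<rho> < norm x} \<in> sets borel" by measurable
      have m: "(\<lambda>x. indicator {x::real^2. \<rho> < norm x} x * ennreal ((norm (\<psi> x))\<^sup>2 / (norm x) ^ 4)) \<in> borel_measurable lborel"
        "(\<lambda>x. indicator {x::real^2. \<rho> < norm x} x * ennreal ((norm (\<psi>' x))\<^sup>2 / (norm x) ^ 4)) \<in> borel_measurable lborel"
        by measurable
      show ?thesis by (simp only: nn_integral_add nn_integral_cmult m borel_measurable_times_ennreal borel_measurable_const)
    qed
    also have "\<dots> \<le> ennreal 2 * ennreal M + ennreal 2 * ennreal M'"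
      by (intro add_mono mult_left_mono M(2) M'(2) \<rho>(1)) auto
    also have "\<dots> = ennreal (2 * M + 2 * M')"
      using M M' by (simp add: ennreal_mult''[symmetric] ennreal_plus[symmetric] del: ennreal_plus ennreal_numeral)
    finally show ?thesis .
  qed
  have refl: "(\<integral>\<^sup>+ x. indicator (N \<rho>) x * ennreal ((norm (F (- x)))\<^sup>2 / (norm x) ^ 4) \<partial>lborel) = I \<rho>" for \<rho>
  proof -
    have "(\<lambda>x. indicator (N \<rho>) x * ennreal ((norm (F x))\<^sup>2 / (norm x) ^ 4)) \<in> borel_measurable borel" by measurable
    from nn_integral_reflect[OF this] show ?thesis by (simp add: I_def N_def indicator_def)
  qed
  \<comment> \<open>The function and its reflection each contribute twice the bound for
    \<open>I \<rho>\<close>.\<close>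
  define Q where "Q = 4 * (2 * M + 2 * M')"
  have Q0: "Q \<ge> 0" using M M' by (simp add: Q_def)
  have key: "(\<integral>\<^sup>+ x. indicator (N \<rho>) x * ennreal ((norm (F x + s * F (- x)))\<^sup>2 / (norm x) ^ 4) \<partial>lborel) \<le> ennreal Q"
    if \<rho>: "0 < \<rho>" "\<rho> < \<delta> / 2" and s: "norm s = 1" for \<rho> s
  proof -
    have pt: "indicator (N \<rho>) x * ennreal ((norm (F x + s * F (- x)))\<^sup>2 / (norm x) ^ 4)
      \<le> ennreal 2 * (indicator (N \<rho>) x * ennreal ((norm (F x))\<^sup>2 / (norm x) ^ 4))
        + ennreal 2 * (indicator (N \<rho>) x * ennreal ((norm (F (- x)))\<^sup>2 / (norm x) ^ 4))" for x
    proof (cases "x \<in> N \<rho>")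
      case True
      have "(norm (F x + s * F (- x)))\<^sup>2 \<le> 2 * (norm (F x))\<^sup>2 + 2 * (norm (F (- x)))\<^sup>2"
        using norm_diff_sq_le[of "F x + s * F (- x)" "s * F (- x)"] s by (simp add: norm_mult)
      then have "(norm (F x + s * F (- x)))\<^sup>2 / norm x ^ 4 \<le> (2 * (norm (F x))\<^sup>2 + 2 * (norm (F (- x)))\<^sup>2) / norm x ^ 4"
        by (intro divide_right_mono) auto
      then have "(norm (F x + s * F (- x)))\<^sup>2 / norm x ^ 4 \<le> 2 * ((norm (F x))\<^sup>2 / norm x ^ 4) + 2 * ((norm (F (- x)))\<^sup>2 / norm x ^ 4)"
        by (simp add: add_divide_distrib)
      then have "ennreal ((norm (F x + s * F (- x)))\<^sup>2 / norm x ^ 4)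
          \<le> ennreal 2 * ennreal ((norm (F x))\<^sup>2 / norm x ^ 4) + ennreal 2 * ennreal ((norm (F (- x)))\<^sup>2 / norm x ^ 4)"
        by (rule ennreal_le_lin2) auto
      then show ?thesis using True by (simp only: indicator_simps mult_1)
    qed simp
    have "(\<integral>\<^sup>+ x. indicator (N \<rho>) x * ennreal ((norm (F x + s * F (- x)))\<^sup>2 / (norm x) ^ 4) \<partial>lborel)
      \<le> (\<integral>\<^sup>+ x. ennreal 2 * (indicator (N \<rho>) x * ennreal ((norm (F x))\<^sup>2 / (norm x) ^ 4))
        + ennreal 2 * (indicator (N \<rho>) x * ennreal ((norm (F (- x)))\<^sup>2 / (norm x) ^ 4)) \<partial>lborel)"
      by (rule nn_integral_mono) (rule pt)
    also have "\<dots> = ennreal 2 * (\<integral>\<^sup>+ x. indicator (N \<rho>) x * ennreal ((norm (F x))\<^sup>2 / (norm x) ^ 4) \<partial>lborel)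
        + ennreal 2 * (\<integral>\<^sup>+ x. indicator (N \<rho>) x * ennreal ((norm (F (- x)))\<^sup>2 / (norm x) ^ 4) \<partial>lborel)"
    proof -
      have m: "(\<lambda>x. indicator (N \<rho>) x * ennreal ((norm (F x))\<^sup>2 / (norm x) ^ 4)) \<in> borel_measurable lborel"
        "(\<lambda>x. indicator (N \<rho>) x * ennreal ((norm (F (- x)))\<^sup>2 / (norm x) ^ 4)) \<in> borel_measurable lborel"
        by measurable
      show ?thesis by (simp only: nn_integral_add nn_integral_cmult m borel_measurable_times_ennreal borel_measurable_const)
    qed
    also have "\<dots> = ennreal 2 * I \<rho> + ennreal 2 * I \<rho>" unfolding refl I_def ..
    also have "\<dots> = ennreal 4 * I \<rho>" by (simp add: mult_2[symmetric] flip: distrib_right)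
    also have "\<dots> \<le> ennreal 4 * ennreal (2 * M + 2 * M')" by (intro mult_left_mono I \<rho>) auto
    also have "\<dots> = ennreal Q" unfolding Q_def by (rule ennreal_mult[symmetric]) (use M(1) M'(1) in auto)
    finally show ?thesis .
  qed
  have "(norm (2 * A))\<^sup>2 = 0"
  proof (rule annulus_weight[where \<beta>=\<alpha> and \<delta>="\<delta> / 2" and Q=Q])
    fix \<rho> assume \<rho>: "0 < \<rho>" "\<rho> < \<delta> / 2"
    have "F x + 1 * F (- x) = 2 * A * of_real (norm x powr \<alpha>)" for x
      by (simp add: F_def ang_m1_reflect)
    then have "(norm (F x + 1 * F (- x)))\<^sup>2 = (norm (2 * A))\<^sup>2 * norm x powr (2 * \<alpha>)" for x
      by (simp add: norm_mult power_mult_distrib powr_sq)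
    with key[OF \<rho>, of 1] show "(\<integral>\<^sup>+ x. indicator {x::real^2. \<rho> < norm x \<and> norm x < 2 * \<rho>} x
        * ennreal ((norm (2 * A))\<^sup>2 * norm x powr (2 * \<alpha>) / norm x ^ 4) \<partial>lborel) \<le> ennreal Q"
      by (simp only: N_def norm_one simp_thms)
  qed (use \<alpha> \<delta> Q0 in auto)
  then show "A = 0" by simp
  have "(norm (2 * B))\<^sup>2 = 0"
  proof (rule annulus_weight[where \<beta>="1 - \<alpha>" and \<delta>="\<delta> / 2" and Q=Q])
    fix \<rho> assume \<rho>: "0 < \<rho>" "\<rho> < \<delta> / 2"
    have "F x + (-1) * F (- x) = 2 * B * of_real (norm x powr (1 - \<alpha>)) * ang (-1) x" for x
      by (simp add: F_def ang_m1_reflect)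
    then have e: "(norm (F x + (-1) * F (- x)))\<^sup>2 = (norm (2 * B))\<^sup>2 * norm x powr (2 * (1 - \<alpha>))" for x
      by (cases "x = 0") (simp_all add: norm_mult power_mult_distrib powr_sq norm_ang_eq)
    have "norm (-1 :: complex) = 1" by simp
    from key[OF \<rho> this] show "(\<integral>\<^sup>+ x. indicator {x::real^2. \<rho> < norm x \<and> norm x < 2 * \<rho>} x
        * ennreal ((norm (2 * B))\<^sup>2 * norm x powr (2 * (1 - \<alpha>)) / norm x ^ 4) \<partial>lborel) \<le> ennreal Q"
      by (simp only: N_def e)
  qed (use \<alpha> \<delta> Q0 in auto)
  then show "B = 0" by simp
qed

text \<open>Where both cutoffs equal one the two decompositions differ by pure powers, so the choice
  of cutoffs drops out.\<close>

lemma decomposes_unique: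
  assumes \<alpha>: "0 < \<alpha>" "\<alpha> < 1" and cut: "radial_cutoff \<eta>" "radial_cutoff \<eta>'"
    and d: "decomposes \<alpha> \<eta> \<phi> \<psi> a b" "decomposes \<alpha> \<eta>' \<phi> \<psi>' a' b'"
  shows "a = a'" "b = b'"
proof -
  obtain e where e: "e > 0" "\<And>r. 0 \<le> r \<Longrightarrow> r < e \<Longrightarrow> \<eta> r = 1" using cut(1) unfolding radial_cutoff_def by blast
  obtain e' where e': "e' > 0" "\<And>r. 0 \<le> r \<Longrightarrow> r < e' \<Longrightarrow> \<eta>' r = 1" using cut(2) unfolding radial_cutoff_def by blast
  have Y: "\<psi> \<in> Y_space" "\<psi>' \<in> Y_space" using d by (auto simp: decomposes_def)
  have 1: "AE x in lborel. \<phi> x = \<psi> x + a * of_real (\<eta> (norm x) * norm x powr \<alpha>)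
        + b * of_real (\<eta> (norm x) * norm x powr (1 - \<alpha>)) * ang (-1) x" using d(1) by (simp add: decomposes_def)
  have 2: "AE x in lborel. \<phi> x = \<psi>' x + a' * of_real (\<eta>' (norm x) * norm x powr \<alpha>)
        + b' * of_real (\<eta>' (norm x) * norm x powr (1 - \<alpha>)) * ang (-1) x" using d(2) by (simp add: decomposes_def)
  have eq: "AE x in lborel. norm x < min e e' \<longrightarrow>
      \<psi>' x - \<psi> x = (a - a') * of_real (norm x powr \<alpha>) + (b - b') * of_real (norm x powr (1 - \<alpha>)) * ang (-1) x"
    using 1 2
  proof eventually_elim
    case (elim x)
    show ?case
    proof
      assume x: "norm x < min e e'"
      then have "\<eta> (norm x) = 1" "\<eta>' (norm x) = 1" using e(2)[of "norm x"] e'(2)[of "norm x"] by auto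
      then have "\<psi> x + a * of_real (norm x powr \<alpha>) + b * of_real (norm x powr (1 - \<alpha>)) * ang (-1) x
        = \<psi>' x + a' * of_real (norm x powr \<alpha>) + b' * of_real (norm x powr (1 - \<alpha>)) * ang (-1) x"
        using elim by simp
      then show "\<psi>' x - \<psi> x = (a - a') * of_real (norm x powr \<alpha>) + (b - b') * of_real (norm x powr (1 - \<alpha>)) * ang (-1) x"
        by (simp add: algebra_simps)
    qed
  qed
  have "min e e' > 0" using e e' by simp
  from singular_part_unique[OF \<alpha> Y this eq] show "a = a'" "b = b'" by auto
qed

lemma zero_Y_space: "(\<lambda>x. 0) \<in> Y_space"
proof -
  have "smooth_on UNIV (\<lambda>x::real^2. 0::complex)" by (simp add: smooth_on_def Ck_on_const)
  then have t: "(\<lambda>x. 0) \<in> test_funs" by (simp add: test_funs_def)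
  have p: "partial j (\<lambda>x. 0) = (\<lambda>x. 0)" for j
    by (simp add: fun_eq_iff partial_def frechet_derivative_const)
  have "Y_norm (\<lambda>x. 0) = 0" by (simp add: Y_norm_def p eLp_def eroot_def)
  then have "approximates Y_norm (\<lambda>n x. 0) (\<lambda>x. 0)"
    using t test_funs_L2[OF t] by (auto simp: approximates_def Lp_norm_2 eroot_def)
  then show ?thesis by (auto simp: Y_space_def test_closure_def)
qed

lemma sing_coeff_eq:
  assumes \<alpha>: "0 < \<alpha>" "\<alpha> < 1" and cut: "radial_cutoff \<eta>" and d: "decomposes \<alpha> \<eta> \<phi> \<psi> a b"
  shows "sing_coeff \<alpha> m \<phi> = (if m = 0 then a else b)"
  unfolding sing_coeff_def
proof (rule the_equality)
  show "\<exists>\<eta> \<psi> c0 cm1. radial_cutoff \<eta> \<and> decomposes \<alpha> \<eta> \<phi> \<psi> c0 cm1 \<and> (if m = 0 then a else b) = (if m = 0 then c0 else cm1)"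
    using cut d by blast
  fix c assume "\<exists>\<eta> \<psi> c0 cm1. radial_cutoff \<eta> \<and> decomposes \<alpha> \<eta> \<phi> \<psi> c0 cm1 \<and> c = (if m = 0 then c0 else cm1)"
  then obtain \<eta>' \<psi>' c0 cm1 where *: "radial_cutoff \<eta>'" "decomposes \<alpha> \<eta>' \<phi> \<psi>' c0 cm1" "c = (if m = 0 then c0 else cm1)" by blast
  show "c = (if m = 0 then a else b)"
    using decomposes_unique[OF \<alpha> *(1) cut *(2) d] *(3) by simp
qed

subsection \<open>The unitary group\<close>

text \<open>The coefficient 1 keeps the shape of the linearity clause in \<open>propagator\<close>,
  so that polarization can be applied to it directly.\<close>

lemma l2_sq_combination:
  assumes "f \<in> L2" "g \<in> L2"
  shows "(l2 (\<lambda>x. 1 * f x + b * g x))\<^sup>2 = (l2 f)\<^sup>2 + (norm b)\<^sup>2 * (l2 g)\<^sup>2 + 2 * Re (cnj b * pairing f g)"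
proof -
  have bg: "(\<lambda>x. b * g x) \<in> L2" by (rule L2_scale[OF assms(2)])
  have s: "(\<lambda>x. f x + b * g x) \<in> L2" by (rule L2_add[OF assms(1) bg])
  have "complex_of_real ((l2 (\<lambda>x. f x + b * g x))\<^sup>2)
      = pairing f f + pairing f (\<lambda>x. b * g x) + (pairing (\<lambda>x. b * g x) f + pairing (\<lambda>x. b * g x) (\<lambda>x. b * g x))"
    unfolding pairing_self[OF s, symmetric] pairing_add_left[OF assms(1) bg s]
      pairing_add_right[OF assms(1) bg assms(1)] pairing_add_right[OF assms(1) bg bg] ..
  also have "\<dots> = of_real ((l2 f)\<^sup>2) + cnj b * pairing f g + (cnj (cnj b * pairing f g) + of_real ((norm b)\<^sup>2 * (l2 g)\<^sup>2))"
    unfolding pairing_self[OF assms(1)] pairing_self[OF bg] pairing_scale_right pairing_scale_left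
      l2_scale pairing_cnj[of g f] power_mult_distrib by simp
  finally have "Re (complex_of_real ((l2 (\<lambda>x. f x + b * g x))\<^sup>2)) 
      = Re (of_real ((l2 f)\<^sup>2) + cnj b * pairing f g + (cnj (cnj b * pairing f g) + of_real ((norm b)\<^sup>2 * (l2 g)\<^sup>2)))"
    by (rule arg_cong)
  then show ?thesis by (simp only: mult_1 plus_complex.sel Re_complex_of_real complex_cnj cnj.sel)
qed

locale unitary_group =
  fixes \<alpha> :: real and U :: "real \<Rightarrow> fld \<Rightarrow> fld"
  assumes propag: "propagator \<alpha> U"
begin

lemma U_L2: "f \<in> L2 \<Longrightarrow> U t f \<in> L2"
  using propag unfolding propagator_def by blast

lemma U_measurable: "f \<in> L2 \<Longrightarrow> U t f \<in> borel_measurable borel"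
  by (rule L2_measurable[OF U_L2])

lemma l2_U: 
  assumes "f \<in> L2" shows "l2 (U t f) = l2 f"
proof -
  have "Lp_norm 2 (U t f) = Lp_norm 2 f" using propag assms unfolding propagator_def by blast
  then show ?thesis using Lp_norm_l2[OF assms] Lp_norm_l2[OF U_L2[OF assms, of t]] by simp
qed

lemma U_zero: "f \<in> L2 \<Longrightarrow> AE x in lborel. U 0 f x = f x"
  using propag unfolding propagator_def by blast

lemma U_add: "f \<in> L2 \<Longrightarrow> AE x in lborel. U (s + t) f x = U s (U t f) x"
  using propag unfolding propagator_def by blast

lemma U_linear:
  assumes "f \<in> L2" "g \<in> L2"
  shows "AE x in lborel. U t (\<lambda>y. a * f y + b * g y) x = a * U t f x + b * U t g x"
  using propag assms unfolding propagator_def by blast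

lemma U_generator:
  assumes "H_graph \<alpha> f g" "f \<in> L2" "g \<in> L2"
  shows "((\<lambda>h. Lp_norm 2 (\<lambda>x. (U h f x - f x) / of_real h + \<i> * g x)) \<longlongrightarrow> 0) (at 0)"
  using propag assms unfolding propagator_def by blast

text \<open>Polarization: an isometric linear map preserves the real part of every multiple of the
  pairing, and the multiples with b = 1 and b = i determine it.\<close>

lemma U_pairing:
  assumes f: "f \<in> L2" and g: "g \<in> L2"
  shows "pairing (U t f) (U t g) = pairing f g"
proof -
  have *: "Re (cnj b * pairing (U t f) (U t g)) = Re (cnj b * pairing f g)" for b
  proof -
    have fg: "(\<lambda>y. 1 * f y + b * g y) \<in> L2" using L2_add[OF f L2_scale[OF g]] by simp
    have Ufg: "(\<lambda>y. 1 * U t f y + b * U t g y) \<in> L2" using L2_add[OF U_L2[OF f] L2_scale[OF U_L2[OF g]]] by simp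
    have "l2 (\<lambda>x. 1 * U t f x + b * U t g x) = l2 (U t (\<lambda>y. 1 * f y + b * g y))"
      by (rule l2_cong_AE[symmetric, OF U_L2[OF fg] Ufg U_linear[OF f g]])
    also have "\<dots> = l2 (\<lambda>y. 1 * f y + b * g y)" by (rule l2_U[OF fg])
    finally have "(l2 (\<lambda>x. 1 * U t f x + b * U t g x))\<^sup>2 = (l2 (\<lambda>y. 1 * f y + b * g y))\<^sup>2" by simp
    then show ?thesis
      unfolding l2_sq_combination[OF f g] l2_sq_combination[OF U_L2[OF f] U_L2[OF g]] l2_U[OF f] l2_U[OF g] by simp
  qed
  show ?thesis using *[of 1] *[of \<i>] by (simp add: complex_eq_iff)
qed

text \<open>The second claim is a Lipschitz bound at time zero: the difference quotient converges to
  -i \<open>HG\<close>, so near 0 its norm stays below that of \<open>HG\<close> plus 1.\<close>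

lemma U_difference_bound:
  assumes H: "H_graph \<alpha> G HG" and G: "G \<in> L2" and HG: "HG \<in> L2"
  shows "((\<lambda>h. l2 (\<lambda>x. (U h G x - G x) / of_real h + \<i> * HG x)) \<longlongrightarrow> 0) (at 0)"
    and "\<exists>\<delta>>0. \<forall>h. \<bar>h\<bar> < \<delta> \<longrightarrow> l2 (\<lambda>x. U h G x - G x) \<le> (l2 HG + 1) * \<bar>h\<bar>"
proof -
  have L: "(\<lambda>x. (U h G x - G x) / of_real h + \<i> * HG x) \<in> L2" for h
    using L2_add[OF L2_scale[OF L2_diff[OF U_L2[OF G, of h] G], of "1 / of_real h"] L2_scale[OF HG, of \<i>]] by simp
  show lim: "((\<lambda>h. l2 (\<lambda>x. (U h G x - G x) / of_real h + \<i> * HG x)) \<longlongrightarrow> 0) (at 0)"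
  proof -
    have "((\<lambda>h. ennreal (l2 (\<lambda>x. (U h G x - G x) / of_real h + \<i> * HG x))) \<longlongrightarrow> ennreal 0) (at 0)"
      using U_generator[OF H G HG] by (simp only: Lp_norm_l2[OF L] ennreal_0)
    then show ?thesis by (subst (asm) tendsto_ennreal_iff) auto
  qed
  have "\<forall>\<^sub>F h in at 0. l2 (\<lambda>x. (U h G x - G x) / of_real h + \<i> * HG x) < 1"
    by (rule order_tendstoD(2)[OF lim]) simp
  then obtain \<delta> where \<delta>: "\<delta> > 0"
    "\<And>h. h \<noteq> 0 \<Longrightarrow> \<bar>h\<bar> < \<delta> \<Longrightarrow> l2 (\<lambda>x. (U h G x - G x) / of_real h + \<i> * HG x) < 1"
    unfolding eventually_at by (auto simp: dist_real_def)
  have "l2 (\<lambda>x. U h G x - G x) \<le> (l2 HG + 1) * \<bar>h\<bar>" if h: "\<bar>h\<bar> < \<delta>" for h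
  proof (cases "h = 0")
    case True
    have "l2 (\<lambda>x. U 0 G x - G x) = l2 (\<lambda>x. 0)"
      by (rule l2_cong_AE) (use U_zero[OF G] L2_diff[OF U_L2[OF G] G] L2_diff[OF G G] in auto)
    then show ?thesis using True by (simp add: l2_def)
  next
    case False
    have "l2 (\<lambda>x. U h G x - G x) = l2 (\<lambda>x. of_real h * (((U h G x - G x) / of_real h + \<i> * HG x) + (- \<i>) * HG x))"
    proof -
      have "U h G x - G x = of_real h * (((U h G x - G x) / of_real h + \<i> * HG x) + (- \<i>) * HG x)" for x
        using False by simp
      then show ?thesis by presburger
    qed
    also have "\<dots> = \<bar>h\<bar> * l2 (\<lambda>x. ((U h G x - G x) / of_real h + \<i> * HG x) + (- \<i>) * HG x)"
      unfolding l2_scale by simp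
    also have "\<dots> \<le> \<bar>h\<bar> * (l2 (\<lambda>x. (U h G x - G x) / of_real h + \<i> * HG x) + l2 (\<lambda>x. (- \<i>) * HG x))"
      by (intro mult_left_mono l2_triangle[OF L L2_scale[OF HG]]) simp
    also have "\<dots> \<le> \<bar>h\<bar> * (1 + l2 HG)"
      unfolding l2_scale using \<delta>(2)[OF False h] by (intro mult_left_mono add_mono) auto
    finally show ?thesis by (simp add: mult.commute add.commute)
  qed
  then show "\<exists>\<delta>>0. \<forall>h. \<bar>h\<bar> < \<delta> \<longrightarrow> l2 (\<lambda>x. U h G x - G x) \<le> (l2 HG + 1) * \<bar>h\<bar>" using \<delta>(1) by blast
qed

end

subsection \<open>The nonlinearity\<close>

lemma nonlin_measurable: "f \<in> borel_measurable M \<Longrightarrow> nonlin f \<in> borel_measurable M"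
  unfolding nonlin_def[abs_def] by measurable

lemma norm_nonlin: "norm (nonlin f x) = (norm (f x))\<^sup>2"
  by (simp add: nonlin_def norm_mult power2_eq_square)

lemma norm_nonlin_diff: "norm (nonlin f x - nonlin g x) \<le> (norm (f x) + norm (g x)) * norm (f x - g x)"
proof -
  have "nonlin f x - nonlin g x = of_real (norm (f x)) * (f x - g x) + of_real (norm (f x) - norm (g x)) * g x"
    by (simp add: nonlin_def algebra_simps)
  also have "norm \<dots> \<le> norm (f x) * norm (f x - g x) + norm (f x - g x) * norm (g x)"
  proof (rule norm_triangle_mono)
    show "norm (of_real (norm (f x)) * (f x - g x)) \<le> norm (f x) * norm (f x - g x)" by (simp add: norm_mult)
    show "norm (of_real (norm (f x) - norm (g x)) * g x) \<le> norm (f x - g x) * norm (g x)"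
      unfolding norm_mult norm_of_real by (intro mult_right_mono norm_triangle_ineq3) auto
  qed
  finally show ?thesis by (simp add: algebra_simps)
qed

lemma nonlin_pairing_bounded:
  assumes f: "f \<in> L2" and G: "G \<in> borel_measurable borel" "\<And>x. norm (G x) \<le> B"
  shows "integrable lborel (\<lambda>x. nonlin f x * cnj (G x))" "norm (pairing (nonlin f) G) \<le> B * (l2 f)\<^sup>2"
proof -
  have B: "B \<ge> 0" using G(2)[of 0] norm_ge_zero order_trans by blast
  note [measurable] = nonlin_measurable[OF L2_measurable[OF f]] G(1)
  have i: "integrable lborel (\<lambda>x. B * (norm (f x))\<^sup>2)" using f by (simp add: L2_iff)
  have b: "norm (nonlin f x * cnj (G x)) \<le> B * (norm (f x))\<^sup>2" for x
    unfolding norm_mult norm_nonlin using mult_left_mono[OF G(2)[of x], of "(norm (f x))\<^sup>2"] by (simp add: mult.commute)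
  show "integrable lborel (\<lambda>x. nonlin f x * cnj (G x))"
    by (rule Bochner_Integration.integrable_bound[OF i]) (use b in \<open>auto intro!: order_trans[OF b] simp: B\<close>)
  have "norm (pairing (nonlin f) G) \<le> (\<integral> x. B * (norm (f x))\<^sup>2 \<partial>lborel)"
    unfolding pairing_def by (rule Bochner_Integration.integral_norm_bound_integral) (use b i \<open>integrable lborel (\<lambda>x. nonlin f x * cnj (G x))\<close> in auto)
  then show "norm (pairing (nonlin f) G) \<le> B * (l2 f)\<^sup>2" by (simp add: l2_sq)
qed

lemma nonlin_pairing_diff:
  assumes f: "f \<in> L2" and g: "g \<in> L2" and G: "G \<in> borel_measurable borel" "\<And>x. norm (G x) \<le> B"
  shows "norm (pairing (nonlin f) G - pairing (nonlin g) G) \<le> B * ((l2 f + l2 g) * l2 (\<lambda>x. f x - g x))"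
proof -
  have B: "B \<ge> 0" using G(2)[of 0] norm_ge_zero order_trans by blast
  \<comment> \<open>The moduli are cast to complex fields so that the Cauchy-Schwarz and triangle
    inequalities for \<open>pairing\<close> and \<open>l2\<close> apply to them.\<close>
  define a where "a x = complex_of_real (norm (f x))" for x
  define b where "b x = complex_of_real (norm (g x))" for x
  define d where "d x = complex_of_real (norm (f x - g x))" for x
  have m [measurable]: "f \<in> borel_measurable borel" "g \<in> borel_measurable borel" using f g by (auto simp: L2_def)
  have L: "a \<in> L2" "b \<in> L2" "d \<in> L2"
    using f g L2_diff[OF f g] by (auto simp: L2_iff a_def[abs_def] b_def[abs_def] d_def[abs_def])
  have l: "l2 a = l2 f" "l2 b = l2 g" "l2 d = l2 (\<lambda>x. f x - g x)" by (simp_all add: l2_def a_def b_def d_def)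
  have ab: "(\<lambda>x. a x + b x) \<in> L2" by (rule L2_add[OF L(1,2)])
  note i1 = nonlin_pairing_bounded(1)[OF f G] and i2 = nonlin_pairing_bounded(1)[OF g G]
  have i3: "integrable lborel (\<lambda>x. B * norm ((a x + b x) * cnj (d x)))"
    using pairing_integrable(1)[OF ab L(3)] by (intro integrable_mult_right integrable_norm)
  have "norm (pairing (nonlin f) G - pairing (nonlin g) G) = norm (\<integral> x. nonlin f x * cnj (G x) - nonlin g x * cnj (G x) \<partial>lborel)"
    unfolding pairing_def using i1 i2 by simp
  also have "\<dots> \<le> (\<integral> x. B * norm ((a x + b x) * cnj (d x)) \<partial>lborel)"
  proof (rule Bochner_Integration.integral_norm_bound_integral)
    show "integrable lborel (\<lambda>x. nonlin f x * cnj (G x) - nonlin g x * cnj (G x))" using i1 i2 by simp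
    show "norm (nonlin f x * cnj (G x) - nonlin g x * cnj (G x)) \<le> B * norm ((a x + b x) * cnj (d x))" for x
    proof -
      have "norm (a x + b x) = norm (f x) + norm (g x)"
        unfolding a_def b_def of_real_add[symmetric] norm_of_real by simp
      then have e: "norm ((a x + b x) * cnj (d x)) = (norm (f x) + norm (g x)) * norm (f x - g x)"
        by (simp add: norm_mult d_def)
      have "norm (nonlin f x * cnj (G x) - nonlin g x * cnj (G x)) = norm (nonlin f x - nonlin g x) * norm (G x)"
        by (simp add: left_diff_distrib[symmetric] norm_mult)
      also have "\<dots> \<le> ((norm (f x) + norm (g x)) * norm (f x - g x)) * B"
        by (intro mult_mono norm_nonlin_diff G) auto
      finally show ?thesis unfolding e by (simp only: mult.commute)
    qed
  qed (rule i3)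
  also have "\<dots> = B * (\<integral> x. norm ((a x + b x) * cnj (d x)) \<partial>lborel)" by simp
  also have "(\<integral> x. norm ((a x + b x) * cnj (d x)) \<partial>lborel) = Re (pairing (\<lambda>x. a x + b x) d)"
  proof -
    have "(a x + b x) * cnj (d x) = of_real (norm ((a x + b x) * cnj (d x)))" for x
      unfolding a_def b_def d_def complex_cnj_complex_of_real of_real_add[symmetric] of_real_mult[symmetric] norm_of_real
      by simp
    then have "pairing (\<lambda>x. a x + b x) d = (\<integral> x. complex_of_real (norm ((a x + b x) * cnj (d x))) \<partial>lborel)"
      unfolding pairing_def by presburger
    then show ?thesis by simp
  qed
  also have "\<dots> \<le> norm (pairing (\<lambda>x. a x + b x) d)" by (rule complex_Re_le_cmod)
  also have "\<dots> \<le> l2 (\<lambda>x. a x + b x) * l2 d" by (rule pairing_integrable(2)[OF ab L(3)])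
  also have "\<dots> \<le> (l2 a + l2 b) * l2 d" by (intro mult_right_mono l2_triangle L) simp
  finally show ?thesis unfolding l using B by (simp add: mult_left_mono)
qed

text \<open>Holds for all measurable fields: if the product is not integrable, the pairing has its
  default value 0. This suits |u|u, which need not be in L^2 at a given time.\<close>

lemma pairing_CS_ennreal:
  assumes [measurable]: "f \<in> borel_measurable borel" "g \<in> borel_measurable borel"
  shows "(ennreal (norm (pairing f g)))\<^sup>2
    \<le> (\<integral>\<^sup>+ x. ennreal ((norm (f x))\<^sup>2) \<partial>lborel) * (\<integral>\<^sup>+ x. ennreal ((norm (g x))\<^sup>2) \<partial>lborel)"
proof -
  have "ennreal (norm (pairing f g)) \<le> (\<integral>\<^sup>+ x. ennreal (norm (f x)) * ennreal (norm (g x)) \<partial>lborel)"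
  proof (cases "integrable lborel (\<lambda>x. f x * cnj (g x))")
    case True
    have "ennreal (norm (pairing f g)) \<le> ennreal (\<integral> x. norm (f x * cnj (g x)) \<partial>lborel)"
      unfolding pairing_def by (intro ennreal_leI integral_norm_bound)
    also have "\<dots> = (\<integral>\<^sup>+ x. ennreal (norm (f x * cnj (g x))) \<partial>lborel)"
      using True by (intro nn_integral_eq_integral[symmetric]) auto
    finally show ?thesis by (simp add: norm_mult ennreal_mult)
  next
    case False
    then show ?thesis by (simp add: pairing_def not_integrable_integral_eq)
  qed
  then have "(ennreal (norm (pairing f g)))\<^sup>2 \<le> (\<integral>\<^sup>+ x. ennreal (norm (f x)) * ennreal (norm (g x)) \<partial>lborel)\<^sup>2"
    by (intro power_mono) auto
  also have "\<dots> \<le> (\<integral>\<^sup>+ x. ennreal (norm (f x)) ^ 2 \<partial>lborel) * (\<integral>\<^sup>+ x. ennreal (norm (g x)) ^ 2 \<partial>lborel)"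
    by (rule Cauchy_Schwarz_nn_integral) auto
  finally show ?thesis by (simp add: ennreal_power)
qed

subsection \<open>The weak form of the equation\<close>

text \<open>
  \<open>Q4 s\<close> stands for \<open>\<parallel>u s - u\<^sub>a\<^sub>p s\<parallel>\<^sub>4\<^sup>4\<close>. Its measurability in \<open>s\<close> is not known, so its integral has to be read
  as a lower integral.
\<close>

locale nls = unitary_group +
  fixes lam T C0 M4 :: real and u :: "real \<Rightarrow> fld" and Q4 :: "real \<Rightarrow> ennreal"
  assumes duh: "duhamel lam U u" and uL: "\<And>t. u t \<in> L2"
    and cont: "\<And>t. ((\<lambda>s. Lp_norm 2 (\<lambda>x. u s x - u t x)) \<longlongrightarrow> 0) (at t)"
    and T: "T > 0" and C0: "C0 \<ge> 0" and M4: "M4 \<ge> 0"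
    and u4: "\<And>s. s \<ge> T \<Longrightarrow> (\<integral>\<^sup>+ x. ennreal ((norm (u s x)) ^ 4) \<partial>lborel) \<le> 8 * (ennreal C0 + Q4 s)"
    and Q4: "(\<integral>\<^sup>+ s. Q4 s * indicator {T..} s \<partial>lborel) \<le> ennreal M4"
begin

lemma u_cont: "((\<lambda>s. l2 (\<lambda>x. u s x - u t x)) \<longlongrightarrow> 0) (at t)"
proof -
  have "((\<lambda>s. ennreal (l2 (\<lambda>x. u s x - u t x))) \<longlongrightarrow> ennreal 0) (at t)"
    using cont[of t] by (simp only: Lp_norm_l2[OF L2_diff[OF uL uL]] ennreal_0)
  then show ?thesis by (subst (asm) tendsto_ennreal_iff) auto
qed

lemma u_cont': "e > 0 \<Longrightarrow> \<exists>\<delta>>0. \<forall>s. \<bar>s - t\<bar> < \<delta> \<longrightarrow> l2 (\<lambda>x. u s x - u t x) < e"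
proof -
  assume e: "e > 0"
  have "\<forall>\<^sub>F s in at t. l2 (\<lambda>x. u s x - u t x) < e" by (rule order_tendstoD(2)[OF u_cont e])
  then obtain \<delta> where \<delta>: "\<delta> > 0" "\<And>s. s \<noteq> t \<Longrightarrow> \<bar>s - t\<bar> < \<delta> \<Longrightarrow> l2 (\<lambda>x. u s x - u t x) < e"
    unfolding eventually_at by (auto simp: dist_real_def)
  have "l2 (\<lambda>x. u t x - u t x) < e" using e by (simp add: l2_def)
  then have "\<forall>s. \<bar>s - t\<bar> < \<delta> \<longrightarrow> l2 (\<lambda>x. u s x - u t x) < e" using \<delta>(2) by metis
  then show ?thesis using \<delta>(1) by blast
qed

lemma pairing_u_continuous:
  assumes g: "g \<in> L2"
  shows "continuous_on S (\<lambda>t. pairing (u t) g)"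
proof -
  have "isCont (\<lambda>t. pairing (u t) g) t" for t
    unfolding isCont_def
  proof (rule LIM_zero_cancel, rule tendsto_norm_zero_cancel, rule tendsto_sandwich[OF _ _ tendsto_const])
    show "\<forall>\<^sub>F s in at t. norm (pairing (u s) g - pairing (u t) g) \<le> l2 (\<lambda>x. u s x - u t x) * l2 g"
      using pairing_integrable(2)[OF L2_diff[OF uL uL] g] by (simp add: pairing_diff_left uL g)
    show "((\<lambda>s. l2 (\<lambda>x. u s x - u t x) * l2 g) \<longlongrightarrow> 0) (at t)"
      using tendsto_mult_right[OF u_cont, where c="l2 g"] by simp
  qed simp
  then show ?thesis by (simp add: continuous_at_imp_continuous_on)
qed

lemma l2_u_le: "l2 (u s) \<le> l2 (u t) + l2 (\<lambda>x. u s x - u t x)"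
  by (rule l2_triangle_diff[OF uL uL])

lemma nonlin_u_continuous:
  assumes G: "G \<in> borel_measurable borel" "\<And>x. norm (G x) \<le> B"
  shows "continuous_on S (\<lambda>t. pairing (nonlin (u t)) G)"
proof -
  have "isCont (\<lambda>t. pairing (nonlin (u t)) G) t" for t
    unfolding isCont_def
  proof (rule LIM_zero_cancel, rule tendsto_norm_zero_cancel, rule tendsto_sandwich[OF _ _ tendsto_const])
    have B: "B \<ge> 0" using G(2)[of 0] norm_ge_zero order_trans by blast
    show "\<forall>\<^sub>F s in at t. norm (pairing (nonlin (u s)) G - pairing (nonlin (u t)) G)
        \<le> B * ((2 * l2 (u t) + l2 (\<lambda>x. u s x - u t x)) * l2 (\<lambda>x. u s x - u t x))"
    proof (rule always_eventually, rule allI)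
      fix s
      have "norm (pairing (nonlin (u s)) G - pairing (nonlin (u t)) G) \<le> B * ((l2 (u s) + l2 (u t)) * l2 (\<lambda>x. u s x - u t x))"
        by (rule nonlin_pairing_diff[OF uL uL G])
      also have "\<dots> \<le> B * ((2 * l2 (u t) + l2 (\<lambda>x. u s x - u t x)) * l2 (\<lambda>x. u s x - u t x))"
        using l2_u_le[of s t] B by (intro mult_left_mono mult_right_mono) auto
      finally show "norm (pairing (nonlin (u s)) G - pairing (nonlin (u t)) G)
        \<le> B * ((2 * l2 (u t) + l2 (\<lambda>x. u s x - u t x)) * l2 (\<lambda>x. u s x - u t x))" .
    qed
    have "((\<lambda>s. B * ((2 * l2 (u t) + l2 (\<lambda>x. u s x - u t x)) * l2 (\<lambda>x. u s x - u t x))) \<longlongrightarrow> B * ((2 * l2 (u t) + 0) * 0)) (at t)"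
      by (intro tendsto_mult tendsto_add tendsto_const u_cont)
    then show "((\<lambda>s. B * ((2 * l2 (u t) + l2 (\<lambda>x. u s x - u t x)) * l2 (\<lambda>x. u s x - u t x))) \<longlongrightarrow> 0) (at t)" by simp
  qed simp
  then show ?thesis by (simp add: continuous_at_imp_continuous_on)
qed

text \<open>Duhamel's formula at t2 tested with G is compared with the one at t1 tested with
  \<open>U (t1 - t2) G\<close>. By the group law both have the same integrand, and by unitarity the
  same free term, so only the integral over (t1, t2) is left.\<close>

lemma duhamel_restart:
  assumes G: "G \<in> L2" and t: "0 < t1" "t1 < t2"
  shows "set_integrable lborel {t1<..<t2} (\<lambda>s. pairing (nonlin (u s)) (U (s - t2) G))"
    and "pairing (u t2) G = pairing (u t1) (U (t1 - t2) G)
      - \<i> * of_real lam * (CLINT s:{t1<..<t2}|lborel. pairing (nonlin (u s)) (U (s - t2) G))"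
    and "AE s in lborel. s \<in> {t1<..<t2} \<longrightarrow> integrable lborel (\<lambda>x. nonlin (u s) x * cnj (U (s - t2) G x))"
proof -
  define F where "F s = pairing (nonlin (u s)) (U (s - t2) G)" for s
  note D = duh[unfolded duhamel_def, rule_format]
  have G': "U (t1 - t2) G \<in> L2" by (rule U_L2[OF G])
  have F1: "pairing (nonlin (u s)) (U (s - t1) (U (t1 - t2) G)) = F s" for s
    unfolding F_def
  proof (rule pairing_cong_AE)
    have "(s - t1) + (t1 - t2) = s - t2" by simp
    then show "AE x in lborel. U (s - t1) (U (t1 - t2) G) x = U (s - t2) G x"
      using U_add[OF G, of "s - t1" "t1 - t2"] by (simp add: eq_commute)
  qed (use nonlin_measurable[OF L2_measurable[OF uL]] U_measurable[OF G] U_measurable[OF G'] in auto)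
  have d2: "interval_lebesgue_integrable lborel (ereal 0) (ereal t2) F"
    "pairing (u t2) G = pairing (U t2 (u 0)) G - \<i> * of_real lam * (CLBINT s=ereal 0..ereal t2. F s)"
    "AE s in lborel. s \<in> closed_segment 0 t2 \<longrightarrow> integrable lborel (\<lambda>x. nonlin (u s) x * cnj (U (s - t2) G x))"
    using D[of G t2] G unfolding F_def by auto
  have d1: "pairing (u t1) (U (t1 - t2) G) = pairing (U t1 (u 0)) (U (t1 - t2) G) - \<i> * of_real lam * (CLBINT s=ereal 0..ereal t1. F s)"
    using D[of "U (t1 - t2) G" t1] G' unfolding F1 by auto
  have p: "pairing (U t2 (u 0)) G = pairing (U t1 (u 0)) (U (t1 - t2) G)"
  proof -
    have "pairing (U t1 (u 0)) (U (t1 - t2) G) = pairing (U (t2 - t1) (U t1 (u 0))) (U (t2 - t1) (U (t1 - t2) G))"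
      by (rule U_pairing[symmetric, OF U_L2[OF uL] G'])
    also have "\<dots> = pairing (U t2 (u 0)) G"
    proof (rule pairing_cong_AE)
      show "AE x in lborel. U (t2 - t1) (U t1 (u 0)) x = U t2 (u 0) x"
        using U_add[OF uL, of "t2 - t1" t1 0] by (simp add: eq_commute)
      have "AE x in lborel. U ((t2 - t1) + (t1 - t2)) G x = U (t2 - t1) (U (t1 - t2) G) x" by (rule U_add[OF G])
      then have "AE x in lborel. U 0 G x = U (t2 - t1) (U (t1 - t2) G) x" by simp
      with U_zero[OF G] show "AE x in lborel. U (t2 - t1) (U (t1 - t2) G) x = G x"
        by eventually_elim simp
    qed (use U_measurable[OF U_L2[OF uL]] U_measurable[OF uL] U_measurable[OF G'] L2_measurable[OF G] in auto)
    finally show ?thesis by simp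
  qed
  have int: "set_integrable lborel {0<..<t2} F"
    using d2(1) t by (simp add: interval_lebesgue_integrable_def)
  show si: "set_integrable lborel {t1<..<t2} (\<lambda>s. pairing (nonlin (u s)) (U (s - t2) G))"
    unfolding F_def[symmetric] by (rule set_integrable_subset[OF int]) (use t in auto)
  have "(CLBINT s=ereal 0..ereal t1. F s) + (CLBINT s=ereal t1..ereal t2. F s) = (CLBINT s=ereal 0..ereal t2. F s)"
    by (rule interval_integral_sum) (use d2(1) t in \<open>simp add: min_def max_def\<close>)
  moreover have "(CLBINT s=ereal t1..ereal t2. F s) = (CLINT s:{t1<..<t2}|lborel. F s)"
    using t by (simp add: interval_lebesgue_integral_def)
  ultimately have e: "(CLBINT s=ereal 0..ereal t2. F s) = (CLBINT s=ereal 0..ereal t1. F s) + (CLINT s:{t1<..<t2}|lborel. F s)" by simp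
  show "pairing (u t2) G = pairing (u t1) (U (t1 - t2) G)
      - \<i> * of_real lam * (CLINT s:{t1<..<t2}|lborel. pairing (nonlin (u s)) (U (s - t2) G))"
    unfolding d2(2) p e d1 F_def[symmetric] by (simp add: algebra_simps)
  show "AE s in lborel. s \<in> {t1<..<t2} \<longrightarrow> integrable lborel (\<lambda>x. nonlin (u s) x * cnj (U (s - t2) G x))"
    using d2(3) by eventually_elim (use t in \<open>auto simp: closed_segment_eq_real_ivl\<close>)
qed

text \<open>Replacing \<open>U (s - t2) G\<close> by G costs o(t2 - t1), which is what
  differentiation demands. The difference of the two is controlled in L^2, by \<open>K0\<close>
  times the elapsed time, so |u|u has to be measured in L^2, that is u in L^4. Cauchy-Schwarz in
  time then yields the extra factor sqrt (t2 - t1).\<close>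

lemma duhamel_remainder:
  assumes G: "G \<in> L2" "\<And>x. norm (G x) \<le> B" and K0: "K0 > 0"
    and dq: "\<And>h. \<bar>h\<bar> < \<delta> \<Longrightarrow> l2 (\<lambda>x. U h G x - G x) \<le> K0 * \<bar>h\<bar>"
    and t: "T \<le> t1" "t1 < t2" "t2 - t1 < \<delta>"
  defines "D \<equiv> \<lambda>s. pairing (nonlin (u s)) (U (s - t2) G) - pairing (nonlin (u s)) G"
  shows "set_integrable lborel {t1<..<t2} D"
    and "norm (CLINT s:{t1<..<t2}|lborel. D s) \<le> sqrt (8 * K0\<^sup>2 * (C0 * (t2 - t1) + M4)) * (t2 - t1) * sqrt (t2 - t1)"
proof -
  define k where "k = t2 - t1"
  define S where "S = {t1<..<t2}"
  have k: "k > 0" using t by (simp add: k_def)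
  have t10: "0 < t1" using T t by simp
  note Gm = L2_measurable[OF G(1)]
  have "continuous_on {t1..t2} (\<lambda>s. pairing (nonlin (u s)) G)"
    by (rule nonlin_u_continuous[OF Gm G(2)])
  then have "set_integrable lborel {t1..t2} (\<lambda>s. pairing (nonlin (u s)) G)"
    by (rule borel_integrable_atLeastAtMost')
  then have "set_integrable lborel S (\<lambda>s. pairing (nonlin (u s)) G)"
    by (rule set_integrable_subset) (auto simp: S_def)
  with duhamel_restart(1)[OF G(1) t10 t(2)] show Dint: "set_integrable lborel {t1<..<t2} D"
    unfolding D_def S_def by (rule set_integral_diff(1))
  define E where "E s = norm (indicator S s *\<^sub>R D s)" for s
  have Eint: "integrable lborel E"
    using Dint unfolding E_def S_def set_integrable_def by (rule integrable_norm)
  have Em [measurable]: "E \<in> borel_measurable borel" using Eint by auto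
  have Sm [measurable]: "S \<in> sets borel" by (simp add: S_def)
  have E0: "E s \<ge> 0" for s by (simp add: E_def)
  define L where "L = 8 * (K0 * k)\<^sup>2"
  have L: "L > 0" using K0 k by (simp add: L_def)
  have "AE s in lborel. s \<in> S \<longrightarrow> ennreal ((E s)\<^sup>2) \<le> ennreal L * (ennreal C0 + Q4 s)"
    using duhamel_restart(3)[OF G(1) t10 t(2)]
  proof eventually_elim
    case (elim s)
    show ?case
    proof
      assume s: "s \<in> S"
      then have i: "integrable lborel (\<lambda>x. nonlin (u s) x * cnj (U (s - t2) G x))" using elim by (simp add: S_def)
      have "D s = pairing (nonlin (u s)) (\<lambda>x. U (s - t2) G x - G x)"
        unfolding D_def pairing_def using i nonlin_pairing_bounded(1)[OF uL Gm G(2), of s]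
        by (simp add: right_diff_distrib)
      then have "ennreal ((E s)\<^sup>2) = (ennreal (norm (pairing (nonlin (u s)) (\<lambda>x. U (s - t2) G x - G x))))\<^sup>2"
        using s by (simp add: E_def ennreal_power)
      also have "\<dots> \<le> (\<integral>\<^sup>+ x. ennreal ((norm (nonlin (u s) x))\<^sup>2) \<partial>lborel)
          * (\<integral>\<^sup>+ x. ennreal ((norm (U (s - t2) G x - G x))\<^sup>2) \<partial>lborel)"
        by (rule pairing_CS_ennreal[OF nonlin_measurable[OF L2_measurable[OF uL]] L2_measurable[OF L2_diff[OF U_L2[OF G(1)] G(1)]]])
      also have "\<dots> \<le> (8 * (ennreal C0 + Q4 s)) * ennreal ((K0 * k)\<^sup>2)"
      proof (rule mult_mono)
        have "(\<integral>\<^sup>+ x. ennreal ((norm (nonlin (u s) x))\<^sup>2) \<partial>lborel) = (\<integral>\<^sup>+ x. ennreal ((norm (u s x)) ^ 4) \<partial>lborel)"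
          by (simp add: norm_nonlin flip: power_mult)
        also have "\<dots> \<le> 8 * (ennreal C0 + Q4 s)" by (rule u4) (use s t in \<open>simp add: S_def\<close>)
        finally show "(\<integral>\<^sup>+ x. ennreal ((norm (nonlin (u s) x))\<^sup>2) \<partial>lborel) \<le> 8 * (ennreal C0 + Q4 s)" .
        have d: "(\<lambda>x. U (s - t2) G x - G x) \<in> L2" by (rule L2_diff[OF U_L2[OF G(1)] G(1)])
        have "l2 (\<lambda>x. U (s - t2) G x - G x) \<le> K0 * \<bar>s - t2\<bar>" by (rule dq) (use s t in \<open>simp add: S_def\<close>)
        also have "\<dots> \<le> K0 * k" using s K0 by (intro mult_left_mono) (auto simp: S_def k_def)
        finally have "(l2 (\<lambda>x. U (s - t2) G x - G x))\<^sup>2 \<le> (K0 * k)\<^sup>2" by (intro power_mono) auto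
        then show "(\<integral>\<^sup>+ x. ennreal ((norm (U (s - t2) G x - G x))\<^sup>2) \<partial>lborel) \<le> ennreal ((K0 * k)\<^sup>2)"
          using d by (simp add: l2_sq L2_iff nn_integral_eq_integral ennreal_leI)
      qed auto
      also have "\<dots> = ennreal L * (ennreal C0 + Q4 s)"
      proof -
        have "ennreal L = ennreal 8 * ennreal ((K0 * k)\<^sup>2)" unfolding L_def by (rule ennreal_mult) auto
        then show ?thesis by (simp only: ennreal_numeral mult_ac)
      qed
      finally show "ennreal ((E s)\<^sup>2) \<le> ennreal L * (ennreal C0 + Q4 s)" .
    qed
  qed
  note bd = this
  \<comment> \<open>A measurable minorant of \<open>Q4\<close> on \<open>S\<close>, obtained by
    solving the pointwise bound for \<open>Q4\<close>. The lower integral of \<open>Q4\<close>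
    dominates its integral, and only this minorant is manipulated under the integral sign.\<close>
  define p where "p s = max 0 ((E s)\<^sup>2 / L - C0) * indicator S s" for s
  have pm [measurable]: "p \<in> borel_measurable borel" unfolding p_def[abs_def] by measurable
  have p0: "p s \<ge> 0" for s by (simp add: p_def)
  have "(\<integral>\<^sup>+ s. ennreal (p s) \<partial>lborel) \<le> (\<integral>\<^sup>+ s. Q4 s * indicator {T..} s \<partial>lborel)"
  proof (rule nn_integral_mono_AE)
    show "AE s in lborel. ennreal (p s) \<le> Q4 s * indicator {T..} s"
      using bd
    proof eventually_elim
      case (elim s)
      show ?case
      proof (cases "s \<in> S")
        case True
        then have sT: "indicator {T..} s = (1::ennreal)" using t by (simp add: S_def)
        show ?thesis
        proof (cases "Q4 s" rule: ennreal_cases)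
          case (real q)
          have "ennreal ((E s)\<^sup>2) \<le> ennreal (L * (C0 + q))"
            using elim True real C0 L by (simp add: ennreal_mult ennreal_plus[symmetric] del: ennreal_plus)
          then have "(E s)\<^sup>2 \<le> L * (C0 + q)" using L C0 real by simp
          then have "(E s)\<^sup>2 / L - C0 \<le> q" using L by (simp add: field_simps)
          then have "p s \<le> q" using True real by (simp add: p_def)
          then show ?thesis unfolding sT real(2) by (simp add: ennreal_leI)
        next
          case top
          then show ?thesis unfolding sT by simp
        qed
      qed (simp add: p_def)
    qed
  qed
  then have pM: "(\<integral>\<^sup>+ s. ennreal (p s) \<partial>lborel) \<le> ennreal M4" using Q4 by (rule order_trans)
  have eS: "emeasure lborel S = ennreal k" using t by (simp add: S_def k_def)
  have "(\<integral>\<^sup>+ s. (ennreal (E s))\<^sup>2 \<partial>lborel) \<le> (\<integral>\<^sup>+ s. ennreal (L * C0) * indicator S s + ennreal L * ennreal (p s) \<partial>lborel)"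
  proof (rule nn_integral_mono)
    fix s
    show "(ennreal (E s))\<^sup>2 \<le> ennreal (L * C0) * indicator S s + ennreal L * ennreal (p s)"
    proof (cases "s \<in> S")
      case True
      have "(E s)\<^sup>2 / L - C0 \<le> p s" using True by (simp add: p_def)
      then have "(E s)\<^sup>2 \<le> L * C0 + L * p s" using L by (simp add: field_simps)
      then have "ennreal ((E s)\<^sup>2) \<le> ennreal (L * C0 + L * p s)" by (rule ennreal_leI)
      also have "\<dots> = ennreal (L * C0) + ennreal (L * p s)" using L C0 p0[of s] by (intro ennreal_plus) auto
      also have "ennreal (L * p s) = ennreal L * ennreal (p s)" using L p0[of s] by (intro ennreal_mult) auto
      finally show ?thesis using True E0[of s] by (simp add: ennreal_power)
    next
      case False
      then show ?thesis by (simp add: E_def)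
    qed
  qed
  also have "\<dots> = ennreal (L * C0) * ennreal k + ennreal L * (\<integral>\<^sup>+ s. ennreal (p s) \<partial>lborel)"
    by (subst nn_integral_add) (auto simp: nn_integral_cmult eS)
  also have "\<dots> \<le> ennreal (L * C0) * ennreal k + ennreal L * ennreal M4"
    by (intro add_left_mono mult_left_mono pM) simp
  also have "\<dots> = ennreal (L * C0 * k + L * M4)" using ennreal_lin2[of "L * C0" k L M4] L C0 k M4 by simp
  finally have E2: "(\<integral>\<^sup>+ s. (ennreal (E s))\<^sup>2 \<partial>lborel) \<le> ennreal (L * C0 * k + L * M4)" .
  have S2: "(\<integral>\<^sup>+ s. (indicator S s :: ennreal)\<^sup>2 \<partial>lborel) = ennreal k"
  proof -
    have "(indicator S s :: ennreal)\<^sup>2 = indicator S s" for s by (simp add: indicator_def)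
    then show ?thesis using eS by simp
  qed
  have "(\<integral>\<^sup>+ s. ennreal (E s) * indicator S s \<partial>lborel)\<^sup>2
      \<le> (\<integral>\<^sup>+ s. (ennreal (E s))\<^sup>2 \<partial>lborel) * (\<integral>\<^sup>+ s. (indicator S s)\<^sup>2 \<partial>lborel)"
    by (rule Cauchy_Schwarz_nn_integral) auto
  also have "\<dots> \<le> ennreal (L * C0 * k + L * M4) * ennreal k" unfolding S2 by (intro mult_right_mono E2) simp
  also have "\<dots> = ennreal ((L * C0 * k + L * M4) * k)" using L C0 k M4 by (intro ennreal_mult[symmetric]) auto
  also have "(L * C0 * k + L * M4) * k = (sqrt (8 * K0\<^sup>2 * (C0 * k + M4)) * k * sqrt k)\<^sup>2"
  proof -
    have A: "8 * K0\<^sup>2 * (C0 * k + M4) \<ge> 0" using C0 M4 k by simp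
    have "(sqrt A * k * sqrt k)\<^sup>2 = A * k\<^sup>2 * k" if "A \<ge> 0" for A
      using that k by (simp add: power_mult_distrib)
    from this[OF A] show ?thesis by (simp only: L_def power_mult_distrib) (simp add: algebra_simps)
  qed
  finally have sq: "(\<integral>\<^sup>+ s. ennreal (E s) * indicator S s \<partial>lborel)\<^sup>2 \<le> ennreal ((sqrt (8 * K0\<^sup>2 * (C0 * k + M4)) * k * sqrt k)\<^sup>2)" .
  have "(\<integral>\<^sup>+ s. ennreal (E s) * indicator S s \<partial>lborel) \<le> ennreal (sqrt (8 * K0\<^sup>2 * (C0 * k + M4)) * k * sqrt k)"
    by (subst ennreal_power_le_iff[of 2]) (use sq k C0 M4 in auto)
  moreover have "(\<lambda>s. ennreal (E s) * indicator S s) = (\<lambda>s. ennreal (E s))"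
    by (auto simp: fun_eq_iff E_def indicator_def)
  moreover have "(\<integral>\<^sup>+ s. ennreal (E s) \<partial>lborel) = ennreal (\<integral> s. E s \<partial>lborel)"
    by (rule nn_integral_eq_integral[OF Eint]) (use E0 in auto)
  ultimately have "ennreal (\<integral> s. E s \<partial>lborel) \<le> ennreal (sqrt (8 * K0\<^sup>2 * (C0 * k + M4)) * k * sqrt k)" by simp
  then have Eb: "(\<integral> s. E s \<partial>lborel) \<le> sqrt (8 * K0\<^sup>2 * (C0 * k + M4)) * k * sqrt k"
    by (subst (asm) ennreal_le_iff) (use k C0 M4 in auto)
  have "norm (CLINT s:S|lborel. D s) \<le> (\<integral> s. E s \<partial>lborel)"
    unfolding set_lebesgue_integral_def E_def by (rule integral_norm_bound)
  with Eb show "norm (CLINT s:{t1<..<t2}|lborel. D s) \<le> sqrt (8 * K0\<^sup>2 * (C0 * (t2 - t1) + M4)) * (t2 - t1) * sqrt (t2 - t1)"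
    unfolding S_def k_def by (rule order_trans[rotated])
qed

text \<open>The generator acts on G in place of u. The error in the increment of the pairing splits
  into that of the group acting on G, the motion of u, and the nonlinear integral, each within a
  multiple of e times the increment of time.\<close>

lemma pairing_u_derivative:
  assumes H: "H_graph \<alpha> G HG" and G: "G \<in> L2" "\<And>x. norm (G x) \<le> B" and HG: "HG \<in> L2" and t: "T < t"
  shows "((\<lambda>t. pairing (u t) G) has_vector_derivative
    (- \<i> * pairing (u t) HG - \<i> * of_real lam * pairing (nonlin (u t)) G)) (at t)"
proof -
  define X where "X t = pairing (u t) G" for t
  define N where "N s = pairing (nonlin (u s)) G" for s
  define K0 where "K0 = l2 HG + 1"
  have K0: "K0 > 0" unfolding K0_def using l2_nonneg[of HG] by linarith
  define Q where "Q h = (\<lambda>x. (U h G x - G x) / of_real h + \<i> * HG x)" for h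
  have QL: "Q h \<in> L2" for h
    using L2_add[OF L2_scale[OF L2_diff[OF U_L2[OF G(1), of h] G(1)], of "1 / of_real h"] L2_scale[OF HG, of \<i>]]
    by (simp add: Q_def)
  obtain \<delta>3 where \<delta>3: "\<delta>3 > 0" "\<And>h. \<bar>h\<bar> < \<delta>3 \<Longrightarrow> l2 (\<lambda>x. U h G x - G x) \<le> K0 * \<bar>h\<bar>"
    using U_difference_bound(2)[OF H G(1) HG] unfolding K0_def by blast
  note Gm = L2_measurable[OF G(1)]
  define D where "D = - \<i> * pairing (u t) HG - \<i> * of_real lam * N t"
  define Z where "Z = sqrt (8 * K0\<^sup>2 * (C0 + M4)) + 1"
  have Z: "Z > 0" unfolding Z_def using C0 M4 by (intro add_nonneg_pos) auto
  define A where "A = l2 (u t) + 1"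
  have A: "A > 0" unfolding A_def using l2_nonneg[of "u t"] by linarith
  \<comment> \<open>Collects the coefficients of e in the final estimate: \<open>A\<close> from the
    generator, the norm of \<open>HG\<close> from the continuity of u, and twice |lam| from the two
    nonlinear errors.\<close>
  define W where "W = A + l2 HG + 2 * \<bar>lam\<bar>"
  have W: "W > 0" unfolding W_def using A l2_nonneg[of HG] by linarith
  have "((\<lambda>y. (X y - X t) /\<^sub>R (y - t)) \<longlongrightarrow> D) (at t)"
  proof (rule LIM_I)
    fix \<epsilon> :: real assume \<epsilon>: "\<epsilon> > 0"
    define e where "e = \<epsilon> / (2 * W)"
    have e: "e > 0" "W * e < \<epsilon>" using \<epsilon> W by (auto simp: e_def)
    have "min 1 e > 0" using e by simp
    then obtain \<delta>1 where \<delta>1: "\<delta>1 > 0" "\<And>s. \<bar>s - t\<bar> < \<delta>1 \<Longrightarrow> l2 (\<lambda>x. u s x - u t x) < min 1 e"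
      using u_cont'[of "min 1 e" t] by blast
    have "\<forall>\<^sub>F h in at 0. l2 (Q h) < e"
      unfolding Q_def by (rule order_tendstoD(2)[OF U_difference_bound(1)[OF H G(1) HG] e(1)])
    then obtain \<delta>2 where \<delta>2: "\<delta>2 > 0" "\<And>h. h \<noteq> 0 \<Longrightarrow> \<bar>h\<bar> < \<delta>2 \<Longrightarrow> l2 (Q h) < e"
      unfolding eventually_at by (auto simp: dist_real_def)
    have "continuous_on UNIV N" unfolding N_def by (rule nonlin_u_continuous[OF Gm G(2)])
    then have "\<forall>e>0. \<exists>d>0. \<forall>s. \<bar>s - t\<bar> < d \<longrightarrow> norm (N s - N t) < e"
      unfolding continuous_on_iff by (simp add: dist_norm)
    then obtain \<delta>4 where \<delta>4: "\<delta>4 > 0" "\<And>s. \<bar>s - t\<bar> < \<delta>4 \<Longrightarrow> norm (N s - N t) < e"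
      using e(1) by blast
    \<comment> \<open>Chosen so that \<open>Z * sqrt k \<le> e\<close> whenever k is below
      it.\<close>
    define \<delta>5 where "\<delta>5 = (e / Z)\<^sup>2"
    have \<delta>5: "\<delta>5 > 0" unfolding \<delta>5_def using e Z by simp
    define \<delta> where "\<delta> = min (min (min \<delta>1 \<delta>2) (min \<delta>3 \<delta>4)) (min (min \<delta>5 1) (t - T))"
    have \<delta>: "\<delta> > 0" using \<delta>1 \<delta>2 \<delta>3 \<delta>4 \<delta>5 t by (simp add: \<delta>_def)
    have "norm ((X y - X t) /\<^sub>R (y - t) - D) < \<epsilon>" if y: "y \<noteq> t" "norm (y - t) < \<delta>" for y
    proof -
      \<comment> \<open>The difference quotient is symmetric in its endpoints. Ordering them treats
        both one-sided limits at once and keeps Duhamel's formula running forward in time.\<close>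
      define t1 where "t1 = min y t"
      define t2 where "t2 = max y t"
      define k where "k = t2 - t1"
      have k: "k > 0" "k = \<bar>y - t\<bar>" using y by (auto simp: k_def t1_def t2_def)
      have kd: "k < \<delta>1" "k < \<delta>2" "k < \<delta>3" "k < \<delta>4" "k < \<delta>5" "k < 1" "k < t - T"
        using y(2) k by (auto simp: \<delta>_def)
      have t12: "T \<le> t1" "t1 < t2" "0 < t1" using kd(7) k T t y by (auto simp: t1_def t2_def min_def max_def abs_if split: if_splits)
      have tin: "t1 \<le> t" "t \<le> t2" by (auto simp: t1_def t2_def)
      have k2: "t2 - t1 < \<delta>3" using kd by (simp add: k_def)
      have flip: "(X y - X t) /\<^sub>R (y - t) = (X t2 - X t1) /\<^sub>R k"
      proof (cases "y < t")
        case True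
        then have "X t2 - X t1 = - (X y - X t)" "k = - (y - t)" by (auto simp: t1_def t2_def k_def)
        then show ?thesis by (simp only: inverse_minus_eq scaleR_minus_left scaleR_minus_right minus_minus)
      next
        case False
        then show ?thesis by (simp add: t1_def t2_def k_def)
      qed
      define S where "S = {t1<..<t2}"
      define F where "F s = pairing (nonlin (u s)) (U (s - t2) G)" for s
      note rem = duhamel_remainder[OF G K0 \<delta>3(2) t12(1,2) k2]
      have N1: "set_integrable lborel S (\<lambda>s. N s - N t)"
      proof -
        have "continuous_on {t1..t2} (\<lambda>s. N s - N t)"
          unfolding N_def by (intro continuous_on_diff continuous_on_const nonlin_u_continuous[OF Gm G(2)])
        then have "set_integrable lborel {t1..t2} (\<lambda>s. N s - N t)" by (rule borel_integrable_atLeastAtMost')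
        then show ?thesis by (rule set_integrable_subset) (auto simp: S_def)
      qed
      have Sk: "emeasure lborel S = ennreal k" "measure lborel S = k" using t12 by (auto simp: S_def k_def)
      have Nc: "set_integrable lborel S (\<lambda>s. N t)" unfolding set_integrable_def using Sk
        by (intro integrable_scaleR_left integrable_real_indicator) (auto simp: S_def)
      have Feq: "(CLINT s:S|lborel. F s) - k * N t = (CLINT s:S|lborel. F s - N s) + (CLINT s:S|lborel. N s - N t)"
      proof -
        have "(CLINT s:S|lborel. N t) = k * N t"
          unfolding set_lebesgue_integral_def using Sk by (simp add: S_def scaleR_conv_of_real)
        moreover have "(CLINT s:S|lborel. (F s - N s) + (N s - N t) + N t)
           = (CLINT s:S|lborel. F s - N s) + (CLINT s:S|lborel. N s - N t) + (CLINT s:S|lborel. N t)"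
        proof -
          have r1: "set_integrable lborel S (\<lambda>s. F s - N s)" using rem(1) unfolding F_def N_def S_def .
          show ?thesis
            by (simp only: set_integral_add(2)[OF set_integral_add(1)[OF r1 N1] Nc] set_integral_add(2)[OF r1 N1])
        qed
        ultimately show ?thesis by simp
      qed
      have b1: "norm (CLINT s:S|lborel. F s - N s) \<le> k * e"
      proof -
        have "norm (CLINT s:S|lborel. F s - N s) \<le> sqrt (8 * K0\<^sup>2 * (C0 * k + M4)) * k * sqrt k"
          using rem(2) unfolding F_def N_def S_def k_def .
        also have "\<dots> \<le> Z * k * (e / Z)"
        proof (intro mult_mono)
          have "C0 * k \<le> C0" using kd(6) k C0 by (intro mult_left_le) auto
          then have "sqrt (8 * K0\<^sup>2 * (C0 * k + M4)) \<le> sqrt (8 * K0\<^sup>2 * (C0 + M4))"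
            by (intro real_sqrt_le_mono mult_left_mono) auto
          then show "sqrt (8 * K0\<^sup>2 * (C0 * k + M4)) \<le> Z" unfolding Z_def by linarith
          have "sqrt k \<le> sqrt \<delta>5" using kd by simp
          then show "sqrt k \<le> e / Z" unfolding \<delta>5_def using e Z by (simp add: real_sqrt_abs)
        qed (use k C0 M4 Z in auto)
        also have "\<dots> = k * e" using Z by simp
        finally show ?thesis .
      qed
      have b2: "norm (CLINT s:S|lborel. N s - N t) \<le> k * e"
      proof -
        have "norm (CLINT s:S|lborel. N s - N t) \<le> (\<integral> s. indicator S s *\<^sub>R e \<partial>lborel)"
          unfolding set_lebesgue_integral_def
        proof (rule Bochner_Integration.integral_norm_bound_integral)
          show "integrable lborel (\<lambda>s. indicator S s *\<^sub>R (N s - N t))" using N1 unfolding set_integrable_def .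
          show "integrable lborel (\<lambda>s. indicator S s *\<^sub>R e)"
            using Sk by (intro integrable_scaleR_left integrable_real_indicator) (auto simp: S_def)
          show "norm (indicator S s *\<^sub>R (N s - N t)) \<le> indicator S s *\<^sub>R e" for s
          proof (cases "s \<in> S")
            case True
            then have "\<bar>s - t\<bar> < \<delta>4" using kd(4) tin unfolding S_def k_def by auto
            then show ?thesis using \<delta>4(2)[of s] True by simp
          qed simp
        qed
        also have "\<dots> = k * e" using Sk by (simp add: S_def)
        finally show ?thesis .
      qed
      have p1: "pairing (u t1) (U (t1 - t2) G) - pairing (u t1) G = - of_real k * pairing (u t1) (Q (- k)) + (- \<i> * of_real k) * pairing (u t1) HG"
      proof -
        have eq: "U (t1 - t2) G x - G x = (- of_real k) * Q (- k) x + (\<i> * of_real k) * HG x" for x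
        proof -
          have "A = (- z) * (A / (- z) + \<i> * C) + (\<i> * z) * C" if "z \<noteq> 0" for A C z :: complex
            using that by (simp add: field_simps)
          from this[of "of_real k" "U (- k) G x - G x" "HG x"] have
            "U (- k) G x - G x = (- of_real k) * Q (- k) x + (\<i> * of_real k) * HG x"
            using k(1) unfolding Q_def of_real_minus by simp
          moreover have "t1 - t2 = - k" by (simp add: k_def)
          ultimately show ?thesis by simp
        qed
        have "pairing (u t1) (U (t1 - t2) G) - pairing (u t1) G = pairing (u t1) (\<lambda>x. U (t1 - t2) G x - G x)"
          by (rule pairing_diff_right[symmetric, OF U_L2[OF G(1)] G(1) uL])
        also have "\<dots> = pairing (u t1) (\<lambda>x. (- of_real k) * Q (- k) x) + pairing (u t1) (\<lambda>x. (\<i> * of_real k) * HG x)"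
          unfolding eq by (rule pairing_add_right[OF L2_scale[OF QL] L2_scale[OF HG] uL])
        finally show ?thesis unfolding pairing_scale_right by simp
      qed
      have X2: "X t2 - X t1 = - of_real k * pairing (u t1) (Q (- k)) + (- \<i> * of_real k) * pairing (u t1) HG
          - \<i> * of_real lam * (CLINT s:S|lborel. F s)"
        unfolding X_def F_def S_def duhamel_restart(2)[OF G(1) t12(3,2)] using p1 by simp
      have u1: "l2 (\<lambda>x. u t1 x - u t x) < min 1 e" using \<delta>1(2)[of t1] kd(1) tin by (simp add: k_def)
      have pd: "pairing (u t1) HG - pairing (u t) HG = pairing (\<lambda>x. u t1 x - u t x) HG"
        by (rule pairing_diff_left[symmetric, OF uL uL HG])
      have tot: "(X t2 - X t1) - of_real k * D = - of_real k * pairing (u t1) (Q (- k))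
          + (- \<i> * of_real k) * pairing (\<lambda>x. u t1 x - u t x) HG
          + (- \<i> * of_real lam) * ((CLINT s:S|lborel. F s - N s) + (CLINT s:S|lborel. N s - N t))"
        unfolding X2 D_def pd[symmetric] Feq[symmetric] by (simp add: algebra_simps)
      have "norm ((X t2 - X t1) - of_real k * D) \<le> k * (A * e) + k * (e * l2 HG) + \<bar>lam\<bar> * (k * e + k * e)"
        unfolding tot
      proof (intro norm_triangle_mono)
        have "norm (pairing (u t1) (Q (- k))) \<le> l2 (u t1) * l2 (Q (- k))" by (rule pairing_integrable(2)[OF uL QL])
        also have "\<dots> \<le> A * e"
          using l2_u_le[of t1 t] u1 \<delta>2(2)[of "- k"] kd(2) k A unfolding A_def by (intro mult_mono) auto
        finally show "norm (- of_real k * pairing (u t1) (Q (- k))) \<le> k * (A * e)"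
          using k by (simp add: norm_mult)
        have "norm (pairing (\<lambda>x. u t1 x - u t x) HG) \<le> l2 (\<lambda>x. u t1 x - u t x) * l2 HG"
          by (rule pairing_integrable(2)[OF L2_diff[OF uL uL] HG])
        also have "\<dots> \<le> e * l2 HG" using u1 by (intro mult_right_mono) auto
        finally show "norm ((- \<i> * of_real k) * pairing (\<lambda>x. u t1 x - u t x) HG) \<le> k * (e * l2 HG)"
          using k by (simp add: norm_mult)
        have "norm ((CLINT s:S|lborel. F s - N s) + (CLINT s:S|lborel. N s - N t)) \<le> k * e + k * e"
          by (rule norm_triangle_mono[OF b1 b2])
        then show "norm ((- \<i> * of_real lam) * ((CLINT s:S|lborel. F s - N s) + (CLINT s:S|lborel. N s - N t))) \<le> \<bar>lam\<bar> * (k * e + k * e)"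
          unfolding norm_mult by (simp add: mult_left_mono)
      qed
      also have "\<dots> = k * (W * e)" by (simp add: W_def algebra_simps)
      finally have fin: "norm ((X t2 - X t1) - of_real k * D) \<le> k * (W * e)" .
      have "(X t2 - X t1) /\<^sub>R k - D = ((X t2 - X t1) - of_real k * D) /\<^sub>R k"
        using k by (simp add: scaleR_conv_of_real field_simps)
      then have "norm ((X t2 - X t1) /\<^sub>R k - D) = norm ((X t2 - X t1) - of_real k * D) / k"
        using k by (simp add: divide_inverse mult.commute)
      also have "\<dots> \<le> W * e" using fin k by (simp add: divide_le_eq mult.commute)
      finally show ?thesis using e(2) unfolding flip by simp
    qed
    then show "\<exists>s>0. \<forall>x. x \<noteq> t \<and> norm (x - t) < s \<longrightarrow> norm ((X x - X t) /\<^sub>R (x - t) - D) < \<epsilon>"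
      using \<delta> by blast
  qed
  then show ?thesis
    unfolding has_vector_derivative_iff_tendsto X_def D_def N_def .
qed

end

subsection \<open>Explicit approximate solutions\<close>

lemma has_vector_derivative_cis: "(cis has_vector_derivative \<i> * cis t) (at t)"
proof -
  have "((\<lambda>t. \<i> * of_real t) has_vector_derivative \<i> * of_real 1) (at t)"
    by (intro has_vector_derivative_mult_right has_vector_derivative_of_real) simp
  from field_vector_diff_chain_at[OF this DERIV_exp] show ?thesis
    by (simp add: o_def cis_conv_exp[abs_def])
qed

lemma has_vector_derivative_cis_compose:
  assumes "(f has_real_derivative f') (at t)"
  shows "((\<lambda>t. cis (f t)) has_vector_derivative of_real f' * \<i> * cis (f t)) (at t)"
  using vector_diff_chain_at[OF assms[unfolded has_real_derivative_iff_has_vector_derivative] has_vector_derivative_cis]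
  by (simp add: o_def scaleR_conv_of_real mult.assoc)

lemma Ck_on_cis: "Ck_on k UNIV cis"
proof (induction k)
  case 0
  show ?case by (simp add: continuous_on_cis)
next
  case (Suc k)
  have d: "(cis has_derivative (\<lambda>e. of_real e * (\<i> * cis t))) (at t)" for t
    using has_vector_derivative_cis[of t] by (simp add: has_vector_derivative_def scaleR_conv_of_real)
  have "Ck_on k UNIV (\<lambda>t. of_real e * (\<i> * cis t))" for e
    by (intro Ck_on_mult Ck_on_const Suc.IH) auto
  then show ?case
    by (rule Ck_on_SucI[where D="\<lambda>t e. of_real e * (\<i> * cis t)", OF open_UNIV d])
qed

text \<open>The factor 1/(2it) is split into -i/2 and a power of t, which is merged with the one
  from (|x|/2t)^a so that time and space separate outside the phase.\<close>

definition qfun :: "int \<Rightarrow> real \<Rightarrow> real \<Rightarrow> fld" where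
  "qfun m a t x = (- \<i> / 2) * of_real (t powr (- 1 - a) * (norm x / 2) powr a) * cis ((norm x)\<^sup>2 / (4 * t)) * ang m x"

definition dqfun :: "int \<Rightarrow> real \<Rightarrow> real \<Rightarrow> fld" where
  "dqfun m a t x = (of_real (- (1 + a) / t) - \<i> * of_real ((norm x)\<^sup>2 / (4 * t\<^sup>2))) * qfun m a t x"

lemma qfun_time_derivative:
  assumes t: "t > 0"
  shows "((\<lambda>t. qfun m a t x) has_vector_derivative dqfun m a t x) (at t)"
proof -
  have 1: "((\<lambda>t. of_real (t powr (- 1 - a)) :: complex) has_vector_derivative of_real ((- 1 - a) * t powr (- 1 - a - 1))) (at t)"
    using t by (intro has_vector_derivative_of_real) (auto intro!: derivative_eq_intros)
  have 2: "((\<lambda>t. cis ((norm x)\<^sup>2 / (4 * t))) has_vector_derivative of_real (- ((norm x)\<^sup>2 / (4 * t\<^sup>2))) * \<i> * cis ((norm x)\<^sup>2 / (4 * t))) (at t)"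
    by (rule has_vector_derivative_cis_compose) (use t in \<open>auto intro!: derivative_eq_intros simp: power2_eq_square\<close>)
  have p: "t powr (- 1 - a - 1) = t powr (- 1 - a) / t" using t by (subst powr_diff) simp
  have "((\<lambda>t. ((- \<i> / 2) * of_real ((norm x / 2) powr a) * ang m x) * (of_real (t powr (- 1 - a)) * cis ((norm x)\<^sup>2 / (4 * t)))) has_vector_derivative
    ((- \<i> / 2) * of_real ((norm x / 2) powr a) * ang m x) * (of_real (t powr (- 1 - a)) * (of_real (- ((norm x)\<^sup>2 / (4 * t\<^sup>2))) * \<i> * cis ((norm x)\<^sup>2 / (4 * t)))
      + of_real ((- 1 - a) * t powr (- 1 - a - 1)) * cis ((norm x)\<^sup>2 / (4 * t)))) (at t)"
    by (rule has_vector_derivative_mult_right[OF has_vector_derivative_mult[OF 1 2]])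
  moreover have "(\<lambda>t. ((- \<i> / 2) * of_real ((norm x / 2) powr a) * ang m x) * (of_real (t powr (- 1 - a)) * cis ((norm x)\<^sup>2 / (4 * t))))
     = (\<lambda>t. qfun m a t x)"
    by (simp add: fun_eq_iff qfun_def mult_ac)
  moreover have "((- \<i> / 2) * of_real ((norm x / 2) powr a) * ang m x) * (of_real (t powr (- 1 - a)) * (of_real (- ((norm x)\<^sup>2 / (4 * t\<^sup>2))) * \<i> * cis ((norm x)\<^sup>2 / (4 * t)))
      + of_real ((- 1 - a) * t powr (- 1 - a - 1)) * cis ((norm x)\<^sup>2 / (4 * t))) = dqfun m a t x"
    unfolding p dqfun_def qfun_def using t by (simp add: field_simps)
  ultimately show ?thesis by simp
qed

definition qrad :: "real \<Rightarrow> real \<Rightarrow> real \<Rightarrow> complex" where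
  "qrad a t r = (- \<i> / 2) * of_real (t powr (- 1 - a) * (1 / 2) powr a) * (of_real (r powr a) * cis (r\<^sup>2 / (4 * t)))"

lemma qfun_qrad: "qfun m a t x = qrad a t (norm x) * ang m x"
proof -
  have "(norm x / 2) powr a = norm x powr a * (1 / 2) powr a" using powr_mult[of "norm x" "1 / 2" a] by simp
  then show ?thesis by (simp add: qfun_def qrad_def mult_ac)
qed

lemma Ck_on_qrad: "Ck_on k {0<..} (qrad a t)"
proof -
  have "Ck_on k {0<..} (\<lambda>r::real. (r * r) * (1 / (4 * t)))"
    by (intro Ck_on_mult Ck_on_const Ck_on_linear bounded_linear_ident) auto
  then have "Ck_on k {0<..} (\<lambda>r. cis ((r * r) * (1 / (4 * t))))"
    by (rule Ck_on_compose_real[where R=UNIV, rotated 3]) (auto simp: Ck_on_cis)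
  then have "Ck_on k {0<..} (\<lambda>r. cis (r\<^sup>2 / (4 * t)))" by (simp add: power2_eq_square)
  then show ?thesis unfolding qrad_def[abs_def]
    by (intro Ck_on_mult Ck_on_const Ck_on_of_real Ck_on_powr) auto
qed

lemma qfun_Ck: "m = 0 \<or> m = -1 \<Longrightarrow> Ck_on k (- {0}) (qfun m a t)"
  using Ck_on_radial[OF _ Ck_on_qrad, of m k a t] by (simp add: qfun_qrad[abs_def])

text \<open>Logarithmic differentiation: q' = L q with L = i r/(2t) + a/r, whence q'' = (L^2 + L') q
  in the next lemma.\<close>

lemma qrad_derivative:
  assumes r: "r > 0" and t: "t > 0"
  shows "(qrad a t has_vector_derivative (\<i> * of_real (r / (2 * t)) + of_real (a / r)) * qrad a t r) (at r)"
proof -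
  have 1: "((\<lambda>r. of_real (r powr a) :: complex) has_vector_derivative of_real (a * r powr (a - 1))) (at r)"
    using r by (intro has_vector_derivative_of_real) (auto intro!: derivative_eq_intros)
  have 2: "((\<lambda>r. cis (r\<^sup>2 / (4 * t))) has_vector_derivative of_real (r / (2 * t)) * \<i> * cis (r\<^sup>2 / (4 * t))) (at r)"
    by (rule has_vector_derivative_cis_compose) (use t in \<open>auto intro!: derivative_eq_intros simp: field_simps\<close>)
  have p: "r powr (a - 1) = r powr a / r" using r by (simp add: powr_diff)
  have "(qrad a t has_vector_derivative
    ((- \<i> / 2) * of_real (t powr (- 1 - a) * (1 / 2) powr a)) * (of_real (r powr a) * (of_real (r / (2 * t)) * \<i> * cis (r\<^sup>2 / (4 * t)))
      + of_real (a * r powr (a - 1)) * cis (r\<^sup>2 / (4 * t)))) (at r)"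
    unfolding qrad_def[abs_def] by (rule has_vector_derivative_mult_right[OF has_vector_derivative_mult[OF 1 2]])
  moreover have "((- \<i> / 2) * of_real (t powr (- 1 - a) * (1 / 2) powr a)) * (of_real (r powr a) * (of_real (r / (2 * t)) * \<i> * cis (r\<^sup>2 / (4 * t)))
      + of_real (a * r powr (a - 1)) * cis (r\<^sup>2 / (4 * t))) = (\<i> * of_real (r / (2 * t)) + of_real (a / r)) * qrad a t r"
  proof -
    have gen: "C * (q * (A * \<i> * E) + (b * q) * E) = (\<i> * A + b) * (C * (q * E))" for A b C E q :: complex
      by (simp add: algebra_simps)
    have "complex_of_real (a * (r powr a / r)) = of_real (a / r) * of_real (r powr a)" by simp
    then show ?thesis unfolding p qrad_def by (simp only: gen)
  qed
  ultimately show ?thesis by simp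
qed

lemma qrad_derivative2:
  assumes r: "r > 0" and t: "t > 0"
  shows "((\<lambda>r. (\<i> * of_real (r / (2 * t)) + of_real (a / r)) * qrad a t r) has_vector_derivative
    ((\<i> * of_real (r / (2 * t)) + of_real (a / r))\<^sup>2 + \<i> * of_real (1 / (2 * t)) - of_real (a / r\<^sup>2)) * qrad a t r) (at r)"
proof -
  have 1: "((\<lambda>r. \<i> * of_real (r / (2 * t))) has_vector_derivative \<i> * of_real (1 / (2 * t))) (at r)"
    using t by (intro has_vector_derivative_mult_right has_vector_derivative_of_real) (auto intro!: derivative_eq_intros)
  have 2: "((\<lambda>r. of_real (a / r) :: complex) has_vector_derivative of_real (- a / r\<^sup>2)) (at r)"
    using r by (intro has_vector_derivative_of_real) (auto intro!: derivative_eq_intros simp: power2_eq_square)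
  have gen: "A * (A * q) + (B + of_real (- a / r\<^sup>2)) * q = (A\<^sup>2 + B - of_real (a / r\<^sup>2)) * q" for A B q :: complex
    by (simp add: algebra_simps power2_eq_square)
  from has_vector_derivative_mult[OF has_vector_derivative_add[OF 1 2] qrad_derivative[OF r t, of a]]
  show ?thesis unfolding gen .
qed

text \<open>For \<open>a = \<nu>\<close> the function is the pseudoconformal transform of the zero mode, an exact solution
  of the linear equation.\<close>

lemma qfun_equation:
  assumes m: "m = 0 \<or> m = -1" and nu: "\<bar>of_int m + \<alpha>\<bar> = \<nu>" and x: "x \<noteq> 0" and t: "t > 0"
  shows "dqfun m a t x = - \<i> * Hop \<alpha> (qfun m a t) x - \<i> * of_real ((a\<^sup>2 - \<nu>\<^sup>2) / (norm x)\<^sup>2) * qfun m a t x"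
proof -
  have n: "norm x > 0" using x by simp
  have sq: "(of_int m + \<alpha>)\<^sup>2 = \<nu>\<^sup>2" using nu by (metis power2_abs)
  have "Hop \<alpha> (qfun m a t) x = - (((\<i> * of_real (norm x / (2 * t)) + of_real (a / norm x))\<^sup>2 + \<i> * of_real (1 / (2 * t)) - of_real (a / (norm x)\<^sup>2)) * qrad a t (norm x)
     + (\<i> * of_real (norm x / (2 * t)) + of_real (a / norm x)) * qrad a t (norm x) / of_real (norm x)
     - of_real (\<nu>\<^sup>2 / (norm x)\<^sup>2) * qrad a t (norm x)) * ang m x"
    unfolding qfun_qrad[abs_def] sq[symmetric]
    by (rule Hop_radial[OF m x qrad_derivative[OF _ t] qrad_derivative2[OF n t]])
  moreover have "(of_real (- (1 + a) / t) - \<i> * of_real ((norm x)\<^sup>2 / (4 * t\<^sup>2))) * (q * g)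
    = - \<i> * (- (((\<i> * of_real (norm x / (2 * t)) + of_real (a / norm x))\<^sup>2 + \<i> * of_real (1 / (2 * t)) - of_real (a / (norm x)\<^sup>2)) * q
     + (\<i> * of_real (norm x / (2 * t)) + of_real (a / norm x)) * q / of_real (norm x)
     - of_real (\<nu>\<^sup>2 / (norm x)\<^sup>2) * q) * g) - \<i> * of_real ((a\<^sup>2 - \<nu>\<^sup>2) / (norm x)\<^sup>2) * (q * g)" for q g :: complex
  proof -
    \<comment> \<open>With complex variables in place of the real quantities this is a rational
      identity; the terms b^2 and n^2 over r^2 are exactly what the last summand removes.\<close>
    have gen: "- (1 + b) / s - \<i> * (r\<^sup>2 / (4 * s\<^sup>2))
      = \<i> * ((\<i> * (r / (2 * s)) + b / r)\<^sup>2 + \<i> * (1 / (2 * s)) - b / r\<^sup>2 + (\<i> * (r / (2 * s)) + b / r) / r - n\<^sup>2 / r\<^sup>2)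
        - \<i> * ((b\<^sup>2 - n\<^sup>2) / r\<^sup>2)" if "r \<noteq> 0" "s \<noteq> 0" for b r s n :: complex
      using that by (simp add: field_simps power2_eq_square)
    have "of_real (- (1 + a) / t) - \<i> * of_real ((norm x)\<^sup>2 / (4 * t\<^sup>2))
      = \<i> * ((\<i> * of_real (norm x / (2 * t)) + of_real (a / norm x))\<^sup>2 + \<i> * of_real (1 / (2 * t)) - of_real (a / (norm x)\<^sup>2)
        + (\<i> * of_real (norm x / (2 * t)) + of_real (a / norm x)) / of_real (norm x) - of_real (\<nu>\<^sup>2 / (norm x)\<^sup>2))
        - \<i> * of_real ((a\<^sup>2 - \<nu>\<^sup>2) / (norm x)\<^sup>2)"
      using gen[of "of_real (norm x)" "of_real t" "of_real a" "of_real \<nu>"] n t by simp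
    moreover have "(\<i> * (A + B / r - D) - E) * (q * g) = - \<i> * (- (A * q + B * q / r - D * q) * g) - E * (q * g)" for A B D E r :: complex
      by (simp add: algebra_simps add_divide_distrib)
    ultimately show ?thesis by (simp only:)
  qed
  ultimately show ?thesis unfolding dqfun_def qfun_qrad by (simp only:)
qed

lemma qfun_bound:
  assumes "t > 0" "a > 0" "norm x \<le> R" 
  shows "norm (qfun m a t x) \<le> t powr (- 1 - a) * R powr a"
proof -
  have "norm (qfun m a t x) = (1 / 2) * (t powr (- 1 - a) * (norm x / 2) powr a) * norm (ang m x)"
    by (simp add: qfun_def norm_mult norm_divide)
  also have "\<dots> \<le> (1 / 2) * (t powr (- 1 - a) * (norm x / 2) powr a) * 1"
    by (intro mult_left_mono norm_ang) auto
  also have "\<dots> \<le> t powr (- 1 - a) * R powr a"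
  proof -
    have "(norm x / 2) powr a \<le> R powr a" using assms norm_ge_zero[of x] by (intro powr_mono2) linarith+
    then have "t powr (- 1 - a) * (norm x / 2) powr a \<le> t powr (- 1 - a) * R powr a" by (intro mult_left_mono) auto
    moreover have "0 \<le> t powr (- 1 - a) * (norm x / 2) powr a" by simp
    ultimately show ?thesis by linarith
  qed
  finally show ?thesis .
qed

text \<open>Differentiation under the integral by dominated convergence: on the compact set
  \<open>K\<close> and for times above t/2 the time derivative is bounded.\<close>

lemma qfun_pairing_derivative:
  assumes m: "m = 0 \<or> m = -1" and a: "a > 0" and \<psi>: "tst 0 K \<psi>" and t: "t > 0"
  shows "((\<lambda>t. pairing (qfun m a t) \<psi>) has_vector_derivative pairing (dqfun m a t) \<psi>) (at t)"
  unfolding has_vector_derivative_iff_tendsto tendsto_at_iff_sequentially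
proof (intro allI impI)
  fix X :: "nat \<Rightarrow> real"
  assume X: "\<forall>i. X i \<in> UNIV - {t}" "X \<longlonglongrightarrow> t"
  have qi: "integrable lborel (\<lambda>x. qfun m a s x * cnj (\<psi> x))" for s
    by (rule tst_integrable[OF tst_mult_cnj[OF qfun_Ck[OF m] \<psi>]])
  obtain R where R: "R > 0" "\<And>x. x \<in> K \<Longrightarrow> norm x \<le> R"
  proof -
    obtain R where "\<And>x. x \<in> K \<Longrightarrow> norm x \<le> R"
      using \<psi> compact_imp_bounded[of K] bounded_iff unfolding tst_def by metis
    then show ?thesis using that[of "max R 1"] by (auto simp: le_max_iff_disj)
  qed
  have K: "\<And>x. x \<notin> K \<Longrightarrow> \<psi> x = 0" using \<psi> by (auto simp: tst_def)
  define D where "D = ((1 + a) * 2 / t + R\<^sup>2 / t\<^sup>2) * ((t / 2) powr (- 1 - a) * R powr a)"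
  have D0: "D \<ge> 0" using t a by (simp add: D_def)
  have dq: "norm (dqfun m a s x) \<le> D" if s: "s \<ge> t / 2" and x: "norm x \<le> R" for s x
  proof -
    have s0: "s > 0" using s t by linarith
    have "norm (of_real (- (1 + a) / s) - \<i> * of_real ((norm x)\<^sup>2 / (4 * s\<^sup>2))) \<le> (1 + a) * 2 / t + R\<^sup>2 / t\<^sup>2"
    proof (rule order_trans[OF norm_triangle_ineq4 add_mono])
      have "(1 + a) / s \<le> (1 + a) / (t / 2)" using s t a by (intro divide_left_mono) auto
      then show "norm (complex_of_real (- (1 + a) / s)) \<le> (1 + a) * 2 / t"
        unfolding norm_of_real abs_divide abs_minus_cancel using a s0 by simp
      have "(norm x)\<^sup>2 / (4 * s\<^sup>2) \<le> R\<^sup>2 / (4 * (t / 2)\<^sup>2)"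
        using s t x R by (intro frac_le mult_left_mono power_mono) auto
      then show "norm (\<i> * of_real ((norm x)\<^sup>2 / (4 * s\<^sup>2))) \<le> R\<^sup>2 / t\<^sup>2"
        by (simp add: norm_mult norm_divide norm_power power_divide)
    qed
    moreover have "norm (qfun m a s x) \<le> (t / 2) powr (- 1 - a) * R powr a"
    proof -
      have "norm (qfun m a s x) \<le> s powr (- 1 - a) * R powr a" by (rule qfun_bound[OF s0 a x])
      also have "\<dots> \<le> (t / 2) powr (- 1 - a) * R powr a"
        using s t a by (intro mult_right_mono powr_mono2') auto
      finally show ?thesis .
    qed
    ultimately show ?thesis unfolding dqfun_def norm_mult D_def using t a by (intro mult_mono) auto
  qed
  have dc: "continuous_on (- {0}) (dqfun m a t)"
  proof -
    have "continuous_on (- {0}) (qfun m a t)" by (rule Ck_on_imp_continuous[OF qfun_Ck[OF m, of 0]])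
    then show ?thesis unfolding dqfun_def[abs_def] using t by (intro continuous_intros) auto
  qed
  obtain B where B: "\<And>x. norm (\<psi> x) \<le> B" "B \<ge> 0" using tst_bounded[OF \<psi>] by metis
  have "\<forall>\<^sub>F n in sequentially. X n > t / 2" using X(2) t by (intro order_tendstoD) auto
  then obtain n0 where n0: "\<And>n. n \<ge> n0 \<Longrightarrow> X n > t / 2" unfolding eventually_sequentially by blast
  \<comment> \<open>The shift by \<open>n0\<close> keeps all times above t/2, where the bound
    \<open>D\<close> is valid; \<open>LIMSEQ_offset\<close> removes it at the end.\<close>
  define Q where "Q n x = ((qfun m a (X (n + n0)) x - qfun m a t x) /\<^sub>R (X (n + n0) - t)) * cnj (\<psi> x)" for n x
  have "(\<lambda>n. integral\<^sup>L lborel (Q n)) \<longlonglongrightarrow> integral\<^sup>L lborel (\<lambda>x. dqfun m a t x * cnj (\<psi> x))"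
  proof (rule integral_dominated_convergence[where w="\<lambda>x. D * B * indicator (cball 0 R) x"])
    have [measurable]: "dqfun m a t \<in> borel_measurable borel" "qfun m a s \<in> borel_measurable borel" for s
      using continuous_off_0_measurable[OF dc] continuous_off_0_measurable[OF Ck_on_imp_continuous[OF qfun_Ck[OF m, of 0]]] by auto
    have [measurable]: "\<psi> \<in> borel_measurable borel" using tst_integrable[OF \<psi>] by auto
    show "(\<lambda>x. dqfun m a t x * cnj (\<psi> x)) \<in> borel_measurable lborel" by measurable
    show "Q n \<in> borel_measurable lborel" for n unfolding Q_def by measurable
    have "integrable lborel (\<lambda>x. indicator (cball (0::real^2) R) x *\<^sub>R (D * B))"
      by (intro borel_integrable_compact) auto
    then show "integrable lborel (\<lambda>x. D * B * indicator (cball (0::real^2) R) x)" by (simp add: mult.commute)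
    show "AE x in lborel. (\<lambda>n. Q n x) \<longlonglongrightarrow> dqfun m a t x * cnj (\<psi> x)"
    proof (rule AE_I2)
      fix x
      have "((\<lambda>y. (qfun m a y x - qfun m a t x) /\<^sub>R (y - t)) \<longlongrightarrow> dqfun m a t x) (at t)"
        using qfun_time_derivative[OF t, of m a x] unfolding has_vector_derivative_iff_tendsto .
      moreover have "filterlim (\<lambda>n. X (n + n0)) (at t) sequentially"
        unfolding filterlim_at using X LIMSEQ_ignore_initial_segment[OF X(2), of n0] by auto
      ultimately have "(\<lambda>n. (qfun m a (X (n + n0)) x - qfun m a t x) /\<^sub>R (X (n + n0) - t)) \<longlonglongrightarrow> dqfun m a t x"
        by (rule filterlim_compose)
      then show "(\<lambda>n. Q n x) \<longlonglongrightarrow> dqfun m a t x * cnj (\<psi> x)"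
        unfolding Q_def by (intro tendsto_mult tendsto_const)
    qed
    show "AE x in lborel. norm (Q n x) \<le> D * B * indicator (cball 0 R) x" for n
    proof (rule AE_I2)
      fix x
      show "norm (Q n x) \<le> D * B * indicator (cball 0 R) x"
      proof (cases "x \<in> K")
        case True
        then have x: "norm x \<le> R" using R by auto
        define y where "y = X (n + n0)"
        have y: "y > t / 2" "y \<noteq> t" using n0[of "n + n0"] X(1) by (auto simp: y_def)
        have "norm (qfun m a y x - qfun m a t x) \<le> D * norm (y - t)"
        proof (rule differentiable_bound[where S="{t / 2..}" and f="\<lambda>s. qfun m a s x"])
          show "((\<lambda>s. qfun m a s x) has_derivative (\<lambda>r. r *\<^sub>R dqfun m a s x)) (at s within {t / 2..})" if "s \<in> {t / 2..}" for s
            using qfun_time_derivative[of s m a x] that t by (auto simp: has_vector_derivative_def has_derivative_at_withinI)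
          show "onorm (\<lambda>r. r *\<^sub>R dqfun m a s x) \<le> D" if "s \<in> {t / 2..}" for s
            using dq[of s x] that x D0 by (intro onorm_bound) (auto simp: mult.commute[of D] mult_left_mono)
        qed (use y t in auto)
        moreover have "norm ((qfun m a y x - qfun m a t x) /\<^sub>R (y - t)) = norm (qfun m a y x - qfun m a t x) / norm (y - t)"
          by (simp add: divide_inverse mult.commute)
        ultimately have "norm ((qfun m a y x - qfun m a t x) /\<^sub>R (y - t)) \<le> D"
          using y by (simp only: pos_divide_le_eq) (simp add: pos_divide_le_eq)
        then have "norm (Q n x) \<le> D * B"
          unfolding Q_def norm_mult y_def[symmetric] complex_mod_cnj by (intro mult_mono B D0) auto
        then show ?thesis using x by simp
      qed (simp add: Q_def K D0 B)
    qed
  qed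
  moreover have "integral\<^sup>L lborel (Q n) = (pairing (qfun m a (X (n + n0))) \<psi> - pairing (qfun m a t) \<psi>) /\<^sub>R (X (n + n0) - t)" for n
  proof -
    have "Q n = (\<lambda>x. (qfun m a (X (n + n0)) x * cnj (\<psi> x) - qfun m a t x * cnj (\<psi> x)) /\<^sub>R (X (n + n0) - t))"
      by (simp add: Q_def fun_eq_iff left_diff_distrib)
    then show ?thesis unfolding pairing_def using qi by simp
  qed
  ultimately have "(\<lambda>n. (pairing (qfun m a (X (n + n0))) \<psi> - pairing (qfun m a t) \<psi>) /\<^sub>R (X (n + n0) - t)) \<longlonglongrightarrow> pairing (dqfun m a t) \<psi>"
    by (simp add: pairing_def)
  then have "(\<lambda>n. ((\<lambda>y. (pairing (qfun m a y) \<psi> - pairing (qfun m a t) \<psi>) /\<^sub>R (y - t)) \<circ> X) (n + n0)) \<longlonglongrightarrow> pairing (dqfun m a t) \<psi>"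
    by (simp add: o_def)
  then show "((\<lambda>y. (pairing (qfun m a y) \<psi> - pairing (qfun m a t) \<psi>) /\<^sub>R (y - t)) \<circ> X) \<longlonglongrightarrow> pairing (dqfun m a t) \<psi>"
    by (rule LIMSEQ_offset)
qed

lemma qfun_pairing_equation:
  assumes m: "m = 0 \<or> m = -1" and nu: "\<bar>of_int m + \<alpha>\<bar> = \<nu>" and G: "tst 2 K G" and t: "t > 0"
  shows "pairing (dqfun m a t) G = - \<i> * pairing (qfun m a t) (Hop \<alpha> G)
    - \<i> * of_real (a\<^sup>2 - \<nu>\<^sup>2) * pairing (\<lambda>x. of_real (1 / (norm x)\<^sup>2) * qfun m a t x) G"
proof -
  have G0: "tst 0 K G" using tst_continuous[OF G] G by (simp add: tst_def)
  have K: "0 \<notin> K" "\<And>x. x \<notin> K \<Longrightarrow> G x = 0" using G by (auto simp: tst_def)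
  have i1: "integrable lborel (\<lambda>x. Hop \<alpha> (qfun m a t) x * cnj (G x))"
    by (rule tst_integrable[OF tst_mult_cnj[OF Ck_on_Hop[OF qfun_Ck[OF m]] G0]])
  have i2: "integrable lborel (\<lambda>x. (of_real (1 / (norm x)\<^sup>2) * qfun m a t x) * cnj (G x))"
  proof (rule tst_integrable[OF tst_mult_cnj[OF _ G0]])
    have "Ck_on 0 (- {0}) (\<lambda>x. of_real (norm x powr (-2)) * qfun m a t x)"
      by (intro Ck_on_mult Ck_on_of_real Ck_on_norm_powr qfun_Ck[OF m]) auto
    then show "Ck_on 0 (- {0}) (\<lambda>x. of_real (1 / (norm x)\<^sup>2) * qfun m a t x)"
      by (rule Ck_on_cong[rotated 2]) (auto simp: powr_minus divide_inverse)
  qed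
  have pt: "dqfun m a t x * cnj (G x) = - \<i> * (Hop \<alpha> (qfun m a t) x * cnj (G x))
     - \<i> * of_real (a\<^sup>2 - \<nu>\<^sup>2) * ((of_real (1 / (norm x)\<^sup>2) * qfun m a t x) * cnj (G x))" for x
  proof (cases "x \<in> K")
    case True
    then have "x \<noteq> 0" using K by auto
    have "complex_of_real ((a\<^sup>2 - \<nu>\<^sup>2) / (norm x)\<^sup>2) = of_real (a\<^sup>2 - \<nu>\<^sup>2) * of_real (1 / (norm x)\<^sup>2)" by simp
    then show ?thesis unfolding qfun_equation[OF m nu \<open>x \<noteq> 0\<close> t] by (simp only: left_diff_distrib mult.assoc)
  qed (simp add: K)
  have "pairing (dqfun m a t) G = - \<i> * pairing (Hop \<alpha> (qfun m a t)) G
    - \<i> * of_real (a\<^sup>2 - \<nu>\<^sup>2) * pairing (\<lambda>x. of_real (1 / (norm x)\<^sup>2) * qfun m a t x) G"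
  proof -
    have gen: "(\<integral> x. A * f x - B * g x \<partial>lborel) = A * (\<integral> x. f x \<partial>lborel) - B * (\<integral> x. g x \<partial>lborel)"
      if "integrable lborel f" "integrable lborel g" for A B :: complex and f g :: fld
      using that by simp
    show ?thesis unfolding pairing_def pt by (rule gen[OF i1 i2])
  qed
  then show ?thesis unfolding pairing_Hop_sym[OF qfun_Ck[OF m] G] .
qed

text \<open>The assumed decay is an essential supremum in time and so holds almost everywhere. For a
  continuous quantity a violation would persist on an interval of positive length, so the bound
  holds at every time.\<close>

lemma AE_norm_le_imp_all:
  fixes f :: "real \<Rightarrow> complex"
  assumes "a < b" "continuous_on {a..b} f" "AE t in lborel. t \<in> {a..b} \<longrightarrow> norm (f t) \<le> C" "t \<in> {a..b}"
  shows "norm (f t) \<le> C"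
proof (rule ccontr)
  assume "\<not> norm (f t) \<le> C"
  then have e: "norm (f t) - C > 0" by simp
  from assms(2)[unfolded continuous_on_iff, rule_format, OF assms(4) e]
  obtain d where d: "d > 0" "\<And>s. s \<in> {a..b} \<Longrightarrow> dist s t < d \<Longrightarrow> dist (f s) (f t) < norm (f t) - C" by blast
  define p where "p = max a (t - d)"
  define r where "r = min b (t + d)"
  have pr: "p < r" using assms(1,4) d(1) by (auto simp: p_def r_def)
  have "AE s in lborel. s \<notin> {p<..<r}"
    using assms(3)
  proof eventually_elim
    case (elim s)
    show ?case
    proof
      assume s: "s \<in> {p<..<r}"
      then have "s \<in> {a..b}" "dist s t < d" by (auto simp: p_def r_def dist_real_def)
      then have "norm (f s - f t) < norm (f t) - C" "norm (f s) \<le> C" using d(2)[of s] elim by (auto simp: dist_norm)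
      then show False using norm_triangle_ineq2[of "f t" "f s"] by (simp add: norm_minus_commute)
    qed
  qed
  then have "emeasure lborel {p<..<r} = 0"
    by (subst (asm) AE_iff_null_sets[symmetric]) (auto simp: null_sets_def)
  then show False using pr by simp
qed

subsection \<open>Test functions at the parabolic scale\<close>

text \<open>Vanishing near 0 makes the rescaled function admissible as a test function; the plateau
  from r1 to r2 is where the lower bound of the main term comes from.\<close>

definition bump :: "(real \<Rightarrow> real) \<Rightarrow> real \<Rightarrow> real \<Rightarrow> real \<Rightarrow> bool" where
  "bump g a r1 r2 \<longleftrightarrow> (\<forall>k. Ck_on k {0<..} g) \<and> 0 < a \<and> 0 < r1 \<and> r1 < r2 \<and> r2 \<le> 1 \<and> (\<forall>r\<ge>0. 0 \<le> g r \<and> g r \<le> 1)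
     \<and> (\<forall>r. 0 \<le> r \<and> r < a \<longrightarrow> g r = 0) \<and> (\<forall>r\<ge>1. g r = 0) \<and> (\<forall>r. r1 \<le> r \<and> r \<le> r2 \<longrightarrow> g r = 1)"

lemma bumpD:
  assumes "bump g a r1 r2"
  shows "Ck_on k {0<..} g" "0 < a" "0 < r1" "r1 < r2" "r2 \<le> 1" "\<And>r. r \<ge> 0 \<Longrightarrow> 0 \<le> g r" "\<And>r. r \<ge> 0 \<Longrightarrow> g r \<le> 1"
    "\<And>r. 0 \<le> r \<Longrightarrow> r < a \<Longrightarrow> g r = 0" "\<And>r. r \<ge> 1 \<Longrightarrow> g r = 0" "\<And>r. r1 \<le> r \<Longrightarrow> r \<le> r2 \<Longrightarrow> g r = 1"
  using assms unfolding bump_def by simp_all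

text \<open>Made from the given cutoff: the factor 1 - \<eta>(nr) opens the hole at the origin and
  \<eta>(Rr) ends the support at 1. With n = 2 R^2/d the first factor is one from R/n = d/(2R) on,
  which is below 3d/(4R), so a plateau remains; there R r < d strictly.\<close>

lemma bump_exists:
  assumes cut: "radial_cutoff \<eta>" and e01: "\<And>r. r \<ge> 0 \<Longrightarrow> 0 \<le> \<eta> r \<and> \<eta> r \<le> 1"
  obtains g a r1 r2 where "bump g a r1 r2"
proof -
  obtain d R C where "cutoff_data \<eta> d R C" by (rule radial_cutoffE[OF cut])
  note R = cutoff_dataD[OF this]
  define n where "n = 2 * R\<^sup>2 / d"
  have n: "n > 0" using R by (simp add: n_def)
  define g where "g r = (1 + (-1) * \<eta> (n * r)) * \<eta> (R * r)" for r
  have "Ck_on k {0<..} g" for k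
    unfolding g_def[abs_def]
    by (intro Ck_on_mult Ck_on_add Ck_on_const Ck_on_scale_arg radial_cutoff_Ck cut n R(2)) auto
  moreover have "0 < d / n" using R n by simp
  moreover have "0 < R / n" using R n by simp
  moreover have "R / n < 3 / 4 * (d / R)" using R by (simp add: n_def field_simps power2_eq_square)
  moreover have "3 / 4 * (d / R) \<le> 1" using R by (simp add: field_simps)
  moreover have "0 \<le> g r \<and> g r \<le> 1" if "r \<ge> 0" for r
    using e01[of "n * r"] e01[of "R * r"] that n R(2) by (auto simp: g_def intro!: mult_le_one)
  moreover have "g r = 0" if "0 \<le> r" "r < d / n" for r
    using R(3)[of "n * r"] that n by (simp add: g_def field_simps)
  moreover have "g r = 0" if "r \<ge> 1" for r
    using R(4)[of "R * r"] that R(2) by (simp add: g_def)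
  moreover have "g r = 1" if r: "R / n \<le> r" "r \<le> 3 / 4 * (d / R)" for r
  proof -
    have "R \<le> n * r" using r n by (simp add: field_simps)
    moreover have "0 \<le> r" using r(1) R n by (meson divide_nonneg_pos less_imp_le order_trans)
    moreover have "R * r < d"
    proof -
      have "R * r \<le> R * (3 / 4 * (d / R))" using r R by (intro mult_left_mono) auto
      then show ?thesis using R by simp
    qed
    ultimately show ?thesis using R(3)[of "R * r"] R(4)[of "n * r"] R(2) by (simp add: g_def)
  qed
  ultimately have "bump g (d / n) (R / n) (3 / 4 * (d / R))" unfolding bump_def by simp
  then show ?thesis by (rule that)
qed

definition Gfun :: "(real \<Rightarrow> real) \<Rightarrow> int \<Rightarrow> real \<Rightarrow> fld" where
  "Gfun g m S x = of_real (g (1 / sqrt S * norm x)) * ang m x"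

definition ann :: "real \<Rightarrow> real \<Rightarrow> (real^2) set" where
  "ann a S = {x. a * sqrt S \<le> norm x \<and> norm x \<le> sqrt S}"

lemma Gfun_tst:
  assumes m: "m = 0 \<or> m = -1" and g: "bump g a r1 r2" and S: "S > 0"
  shows "tst k (ann a S) (Gfun g m S)"
proof -
  note b = bumpD[OF g]
  have s: "sqrt S > 0" using S by simp
  define h where "h r = complex_of_real (g (1 / sqrt S * r))" for r
  have "Ck_on k {0<..} h" unfolding h_def[abs_def]
    by (intro Ck_on_of_real Ck_on_scale_arg b(1)) (use s in auto)
  moreover have "h r = 0" if "0 \<le> r" "r < a * sqrt S" for r
    using b(8)[of "1 / sqrt S * r"] that s by (simp add: h_def field_simps)
  moreover have "h r = 0" if "r \<ge> sqrt S" for r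
    using b(9)[of "1 / sqrt S * r"] that s by (simp add: h_def field_simps)
  moreover have "a * sqrt S > 0" using b(2) s by simp
  ultimately have "tst k {x. a * sqrt S \<le> norm x \<and> norm x \<le> sqrt S} (\<lambda>x. h (norm x) * ang m x)"
    by (intro tst_radial[OF m, where h=h])
  then show ?thesis by (simp add: ann_def Gfun_def[abs_def] h_def)
qed

lemma Gfun_test_funs: "m = 0 \<or> m = -1 \<Longrightarrow> bump g a r1 r2 \<Longrightarrow> S > 0 \<Longrightarrow> Gfun g m S \<in> test_funs"
  by (rule tst_imp_test_funs[OF Gfun_tst])

lemma Gfun_le_1: "bump g a r1 r2 \<Longrightarrow> S > 0 \<Longrightarrow> norm (Gfun g m S x) \<le> 1"
proof -
  assume g: "bump g a r1 r2" and S: "S > 0"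
  have "1 / sqrt S * norm x \<ge> 0" using S by simp
  then have "\<bar>g (1 / sqrt S * norm x)\<bar> \<le> 1" using bumpD(6,7)[OF g] by (simp add: abs_le_iff)
  then show ?thesis unfolding Gfun_def norm_mult norm_of_real using norm_ang[of m x] by (intro mult_le_one) auto
qed

text \<open>The operator is homogeneous of degree -2, so rescaling by sqrt S gives 1/S times a
  radial function that does not depend on S and is bounded on \<open>{a..1}\<close>.\<close>

lemma Hop_Gfun_bound:
  assumes m: "m = 0 \<or> m = -1" and g: "bump g a r1 r2"
  obtains B where "B \<ge> 0" "\<And>S x. S > 0 \<Longrightarrow> norm (Hop \<alpha> (Gfun g m S) x) \<le> B / S"
proof -
  note b = bumpD[OF g]
  define h where "h r = complex_of_real (g r)" for r
  have hC: "Ck_on k {0<..} h" for k unfolding h_def[abs_def] by (intro Ck_on_of_real b(1)) auto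
  define h' where "h' r = frechet_derivative h (at r) 1" for r
  note d1 = Ck_on_real_deriv[OF hC[of "Suc (Suc 0)"], folded h'_def[abs_def]]
  define h'' where "h'' r = frechet_derivative h' (at r) 1" for r
  note d2 = Ck_on_real_deriv[OF d1(2), folded h''_def[abs_def]]
  have h1: "(h has_vector_derivative h' r) (at r)" if "r > 0" for r using d1(1)[OF that] by (simp add: h'_def)
  have h2: "(h' has_vector_derivative h'' r) (at r)" if "r > 0" for r using d2(1)[OF that] by (simp add: h''_def)
  have c: "continuous_on {a..1} h" "continuous_on {a..1} h'" "continuous_on {a..1} h''"
    using Ck_on_imp_continuous[OF hC[of 0]] Ck_on_imp_continuous[OF d1(2)] Ck_on_imp_continuous[OF d2(2)] b(2)
    by (auto simp: h'_def[abs_def] h''_def[abs_def] elim!: continuous_on_subset)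
  define kk where "kk r = - (h'' r + h' r / of_real r - of_real ((of_int m + \<alpha>)\<^sup>2 / r\<^sup>2) * h r)" for r
  have "continuous_on {a..1} kk" unfolding kk_def[abs_def] using c b(2) by (intro continuous_intros) auto
  then have "bounded (kk ` {a..1})" by (intro compact_imp_bounded compact_continuous_image) auto
  then have "\<exists>B. \<forall>r\<in>{a..1}. norm (kk r) \<le> B" unfolding bounded_iff by auto
  then obtain B where B: "\<And>r. r \<in> {a..1} \<Longrightarrow> norm (kk r) \<le> B" by blast
  show ?thesis
  proof (rule that[of "max B 0"])
    fix S :: real and x :: "real^2" assume S: "S > 0"
    define s where "s = 1 / sqrt S"
    have s: "s > 0" "s\<^sup>2 = 1 / S" using S by (auto simp: s_def power_divide)
    show "norm (Hop \<alpha> (Gfun g m S) x) \<le> max B 0 / S"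
    proof (cases "x \<in> ann a S")
      case False
      have "tst 0 (ann a S) (Hop \<alpha> (Gfun g m S))" by (rule tst_Hop_L2[OF Gfun_tst[OF m g S]])
      then have "Hop \<alpha> (Gfun g m S) x = 0" using False by (auto simp: tst_def)
      then show ?thesis using S by simp
    next
      case True
      have "a * sqrt S > 0" using b(2) S by simp
      then have n: "norm x > 0" using True by (auto simp: ann_def)
      then have x: "x \<noteq> 0" by auto
      have sx: "s * norm x \<in> {a..1}" using True S by (auto simp: ann_def s_def field_simps)
      have e1: "((\<lambda>r. h (s * r)) has_vector_derivative s *\<^sub>R h' (s * r)) (at r)" if "r > 0" for r
        by (rule has_vector_derivative_scale_arg[OF h1]) (use that s in simp)
      have e2: "((\<lambda>r. s *\<^sub>R h' (s * r)) has_vector_derivative s *\<^sub>R s *\<^sub>R h'' (s * norm x)) (at (norm x))"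
        using has_vector_derivative_scale_arg[OF h2, of s "norm x"] s n
        by (auto intro!: derivative_eq_intros simp: has_vector_derivative_def bounded_linear_scaleR_right bounded_linear.has_derivative)
      have "Hop \<alpha> (\<lambda>y. h (s * norm y) * ang m y) x
        = - (s *\<^sub>R s *\<^sub>R h'' (s * norm x) + s *\<^sub>R h' (s * norm x) / of_real (norm x)
         - of_real ((of_int m + \<alpha>)\<^sup>2 / (norm x)\<^sup>2) * h (s * norm x)) * ang m x"
        by (rule Hop_radial[OF m x, of "\<lambda>r. h (s * r)", OF e1 e2])
      also have "\<dots> = of_real (s\<^sup>2) * kk (s * norm x) * ang m x"
      proof -
        have gen: "- (\<sigma> * (\<sigma> * A) + \<sigma> * B / n - M / n\<^sup>2 * C) * G = \<sigma>\<^sup>2 * (- (A + B / (\<sigma> * n) - M / (\<sigma> * n)\<^sup>2 * C)) * G"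
          if "\<sigma> \<noteq> 0" "n \<noteq> 0" for \<sigma> n A B C G M :: complex
          using that by (simp add: field_simps power2_eq_square)
        show ?thesis
          using gen[of "of_real s" "of_real (norm x)" "h'' (s * norm x)" "h' (s * norm x)" "of_real ((of_int m + \<alpha>)\<^sup>2)" "h (s * norm x)" "ang m x"]
            s(1) n unfolding kk_def scaleR_conv_of_real by simp
      qed
      finally have H: "Hop \<alpha> (Gfun g m S) x = of_real (s\<^sup>2) * kk (s * norm x) * ang m x"
        by (simp add: Gfun_def[abs_def] h_def s_def)
      have "norm (Hop \<alpha> (Gfun g m S) x) \<le> (1 / S * B) * 1"
        unfolding H norm_mult norm_of_real s(2) using B[OF sx] S order_trans[OF norm_ge_zero B[OF sx]]
        by (intro mult_mono norm_ang) auto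
      also have "\<dots> \<le> max B 0 / S" using S by (simp add: divide_right_mono)
      finally show ?thesis .
    qed
  qed simp
qed

text \<open>The factor in front of \<open>ln S\<close> does not vanish, because the phase \<open>\<bar>x\<bar>\<^sup>2/4t\<close> stays below \<open>1/4\<close>.\<close>

lemma main_term_lower_bound:
  assumes m: "m = 0 \<or> m = -1" and g: "bump g a r1 r2" and \<beta>: "\<beta> > 0"
    and S: "S > 0" and t: "S \<le> t" "t \<le> 2 * S"
  shows "Re (\<i> * pairing (\<lambda>x. of_real (1 / (norm x)\<^sup>2) * qfun m \<beta> t x) (Gfun g m S))
    \<ge> (1 / 8 * (r1 / 4) powr \<beta> * vol2 * ((r2 - r1) / 2)\<^sup>2) * S powr (- 1 - \<beta> / 2)"
proof -
  note b = bumpD[OF g]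
  have t0: "t > 0" using S t by simp
  define \<tau> where "\<tau> = sqrt S"
  have \<tau>: "\<tau> > 0" "\<tau>\<^sup>2 = S" using S by (auto simp: \<tau>_def)
  define F where "F x = \<i> * ((of_real (1 / (norm x)\<^sup>2) * qfun m \<beta> t x) * cnj (Gfun g m S x))" for x
  have Fi: "integrable lborel F" unfolding F_def[abs_def]
  proof (intro integrable_mult_right tst_integrable[OF tst_mult_cnj[OF _ Gfun_tst[OF m g S, of 0]]])
    have "Ck_on 0 (- {0}) (\<lambda>x. of_real (norm x powr (-2)) * qfun m \<beta> t x)"
      by (intro Ck_on_mult Ck_on_of_real Ck_on_norm_powr qfun_Ck[OF m]) auto
    then show "Ck_on 0 (- {0}) (\<lambda>x. of_real (1 / (norm x)\<^sup>2) * qfun m \<beta> t x)"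
      by (rule Ck_on_cong[rotated 2]) (auto simp: powr_minus divide_inverse)
  qed
  define w where "w x = 1 / (norm x)\<^sup>2 * (1 / 2 * (t powr (- 1 - \<beta>) * (norm x / 2) powr \<beta>)) * g (1 / sqrt S * norm x)" for x :: "real^2"
  \<comment> \<open>The conjugate angular factor of the test function cancels that of the wave, and
    the outer i compensates the -i/2 of \<open>qfun\<close>: apart from the phase the integrand is
    nonnegative.\<close>
  have ReF: "Re (F x) = w x * cos ((norm x)\<^sup>2 / (4 * t))" if x: "x \<noteq> 0" for x
  proof -
    have "ang m x * cnj (ang m x) = of_real ((norm (ang m x))\<^sup>2)" by (rule complex_norm_square[symmetric])
    then have "ang m x * cnj (ang m x) = 1" using norm_ang_eq[OF x, of m] by simp
    moreover have "F x = of_real (w x) * cis ((norm x)\<^sup>2 / (4 * t)) * (ang m x * cnj (ang m x))"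
    proof -
      have gen: "\<i> * ((I * ((- \<i> / 2) * T * E * A)) * (H * A')) = (I * (1 / 2 * T) * H) * E * (A * A')" for I T E A H A' :: complex
        by (simp add: algebra_simps)
      have rw: "complex_of_real (w x) = of_real (1 / (norm x)\<^sup>2) * (1 / 2 * of_real (t powr (- 1 - \<beta>) * (norm x / 2) powr \<beta>))
          * of_real (g (1 / sqrt S * norm x))" by (simp add: w_def)
      show ?thesis by (simp only: F_def qfun_def Gfun_def complex_cnj_mult complex_cnj_complex_of_real gen rw)
    qed
    ultimately show ?thesis by simp
  qed
  \<comment> \<open>The 1/8 is a product of three halves: from \<open>qfun\<close>, from the cosine,
    and from (2S)^(-1-\<beta>) (r1 \<tau>/2)^\<beta> = (1/2) (r1/4)^\<beta>
    S^(-1-\<beta>/2).\<close>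
  define c1 where "c1 = 1 / 8 * (r1 / 4) powr \<beta> * S powr (- 2 - \<beta> / 2)"
  \<comment> \<open>The disc with centre \<open>p\<close> and radius \<open>q\<close> lies in the
    plateau ring r1 \<tau> < |x| < r2 \<tau>.\<close>
  define p :: "real^2" where "p = ((r1 + r2) / 2 * \<tau>) *\<^sub>R axis 1 1"
  define q where "q = (r2 - r1) / 2 * \<tau>"
  have q: "q > 0" using b \<tau> by (simp add: q_def)
  have np: "norm p = (r1 + r2) / 2 * \<tau>" using b \<tau> by (simp add: p_def)
  have low: "c1 * indicator (ball p q) x \<le> Re (F x)" if x: "x \<noteq> 0" for x
  proof (cases "norm x \<le> \<tau>")
    case False
    then have "1 / sqrt S * norm x \<ge> 1" using \<tau> by (simp add: \<tau>_def field_simps)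
    then have "Re (F x) = 0" unfolding ReF[OF x] w_def using b(9) by simp
    moreover have "x \<notin> ball p q"
    proof
      assume "x \<in> ball p q"
      then have "norm (p - x) < q" by (simp add: dist_norm)
      then have "norm x < norm p + q" using norm_triangle_ineq3[of p x] by linarith
      also have "\<dots> = r2 * \<tau>" unfolding np q_def by (simp add: field_simps)
      also have "\<dots> \<le> 1 * \<tau>" using b \<tau> by (intro mult_right_mono) auto
      finally show False using False by simp
    qed
    ultimately show ?thesis by simp
  next
    case True
    have n: "norm x > 0" using x by simp
    have "(norm x)\<^sup>2 \<le> S" using True \<tau> n by (metis norm_ge_zero power_mono)
    then have y: "(norm x)\<^sup>2 / (4 * t) \<le> 1 / 4" "0 \<le> (norm x)\<^sup>2 / (4 * t)" using t t0 by (auto simp: field_simps)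
    have cosb: "cos ((norm x)\<^sup>2 / (4 * t)) \<ge> 1 / 2"
    proof -
      have "cos ((norm x)\<^sup>2 / (4 * t)) \<ge> cos (pi / 3)"
        using y pi_gt3 by (intro cos_monotone_0_pi_le) auto
      then show ?thesis by (simp add: cos_60)
    qed
    have w0: "w x \<ge> 0" unfolding w_def using b(6)[of "1 / sqrt S * norm x"] S by simp
    show ?thesis
    proof (cases "x \<in> ball p q")
      case False
      then show ?thesis unfolding ReF[OF x] using w0 cosb by simp
    next
      case inb: True
      then have "norm (p - x) < q" by (simp add: dist_norm)
      then have "norm p - q < norm x" "norm x < norm p + q"
        using norm_triangle_ineq3[of p x] norm_triangle_ineq2[of p x] by linarith+
      moreover have "norm p - q = r1 * \<tau>" "norm p + q = r2 * \<tau>" unfolding np q_def by (simp_all add: field_simps)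
      ultimately have xr: "r1 * \<tau> < norm x" "norm x < r2 * \<tau>" by simp_all
      have "g (1 / sqrt S * norm x) = 1" using xr \<tau> by (intro b(10)) (auto simp: \<tau>_def field_simps)
      then have wx: "w x = 1 / (norm x)\<^sup>2 * (1 / 2 * (t powr (- 1 - \<beta>) * (norm x / 2) powr \<beta>))" by (simp add: w_def)
      have A: "1 / S \<le> 1 / (norm x)\<^sup>2" using \<open>(norm x)\<^sup>2 \<le> S\<close> n by (simp add: frac_le)
      have "(2 * S) powr (- 1 - \<beta>) * (r1 * \<tau> / 2) powr \<beta> \<le> t powr (- 1 - \<beta>) * (norm x / 2) powr \<beta>"
        using xr b \<tau> \<beta> t t0 by (intro mult_mono powr_mono2' powr_mono2) auto
      moreover have "(2 * S) powr (- 1 - \<beta>) * (r1 * \<tau> / 2) powr \<beta> = 1 / 2 * (r1 / 4) powr \<beta> * S powr (- 1 - \<beta> / 2)"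
      proof -
        have "\<tau> = S powr (1 / 2)" using S by (simp add: \<tau>_def powr_half_sqrt)
        then have eq: "r1 * \<tau> / 2 = r1 / 4 * (2 * S powr (1 / 2))" by simp
        have gen: "(k * (2 * S powr (1 / 2))) powr \<beta> = k powr \<beta> * 2 powr \<beta> * S powr (\<beta> / 2)" if "k > 0" for k
          using that by (simp add: powr_mult powr_powr)
        have 1: "(r1 * \<tau> / 2) powr \<beta> = (r1 / 4) powr \<beta> * 2 powr \<beta> * S powr (\<beta> / 2)"
          unfolding eq by (rule gen) (use b(3) in simp)
        have 2: "(2 * S) powr (- 1 - \<beta>) = 2 powr (- 1 - \<beta>) * S powr (- 1 - \<beta>)" using S by (simp add: powr_mult)
        have "2 powr (- 1 - \<beta>) * 2 powr \<beta> = (1 / 2 :: real)" by (simp add: powr_add[symmetric] powr_minus)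
        moreover have "S powr (- 1 - \<beta>) * S powr (\<beta> / 2) = S powr (- 1 - \<beta> / 2)"
          unfolding powr_add[symmetric] by (rule arg_cong[where f="\<lambda>y. S powr y"]) simp
        ultimately have "1 / 2 * (r1 / 4) powr \<beta> * S powr (- 1 - \<beta> / 2)
          = (2 powr (- 1 - \<beta>) * 2 powr \<beta>) * (r1 / 4) powr \<beta> * (S powr (- 1 - \<beta>) * S powr (\<beta> / 2))" by simp
        then show ?thesis unfolding 1 2 by (simp only: mult_ac)
      qed
      ultimately have Bb: "1 / 2 * (r1 / 4) powr \<beta> * S powr (- 1 - \<beta> / 2) \<le> t powr (- 1 - \<beta>) * (norm x / 2) powr \<beta>" by simp
      have "c1 = 1 / S * (1 / 2 * (1 / 2 * (r1 / 4) powr \<beta> * S powr (- 1 - \<beta> / 2))) * (1 / 2)"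
      proof -
        have "S powr (- 2 - \<beta> / 2) = S powr (- 1 - \<beta> / 2) / S"
          using S powr_diff[of S "- 1 - \<beta> / 2" 1] by simp
        then show ?thesis by (simp add: c1_def)
      qed
      also have "\<dots> \<le> w x * cos ((norm x)\<^sup>2 / (4 * t))"
        unfolding wx using S by (intro mult_mono A Bb cosb mult_left_mono) auto
      finally show ?thesis unfolding ReF[OF x] using inb by simp
    qed
  qed
  have "c1 * (vol2 * q\<^sup>2) = (\<integral> x. c1 * indicator (ball p q) x \<partial>lborel)"
    using emeasure_ball_2[of q p] q vol2_pos by (simp add: measure_def)
  also have "\<dots> \<le> (\<integral> x. Re (F x) \<partial>lborel)"
  proof (rule integral_mono_AE)
    show "integrable lborel (\<lambda>x. c1 * indicator (ball p q) x)"
      using emeasure_ball_2[of q p] q by (intro integrable_mult_right integrable_real_indicator) auto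
    show "integrable lborel (\<lambda>x. Re (F x))" using Fi by simp
    show "AE x in lborel. c1 * indicator (ball p q) x \<le> Re (F x)"
      using AE_lborel_singleton[of "0::real^2"] by eventually_elim (rule low)
  qed
  also have "\<dots> = Re (\<integral> x. F x \<partial>lborel)" using Fi by simp
  also have "(\<integral> x. F x \<partial>lborel) = \<i> * pairing (\<lambda>x. of_real (1 / (norm x)\<^sup>2) * qfun m \<beta> t x) (Gfun g m S)"
    unfolding F_def pairing_def by (rule integral_mult_right_zero)
  finally have "c1 * (vol2 * q\<^sup>2) \<le> Re (\<i> * pairing (\<lambda>x. of_real (1 / (norm x)\<^sup>2) * qfun m \<beta> t x) (Gfun g m S))" .
  moreover have "c1 * (vol2 * q\<^sup>2) = (1 / 8 * (r1 / 4) powr \<beta> * vol2 * ((r2 - r1) / 2)\<^sup>2) * S powr (- 1 - \<beta> / 2)"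
  proof -
    have "S powr (- 1 - \<beta> / 2) = S powr (- 2 - \<beta> / 2) * S"
      using S powr_add[of S "- 2 - \<beta> / 2" 1] by simp
    moreover have "q\<^sup>2 = ((r2 - r1) / 2)\<^sup>2 * S" unfolding q_def power_mult_distrib \<tau>(2) ..
    ultimately show ?thesis unfolding c1_def by (simp only: mult_ac)
  qed
  ultimately show ?thesis by simp
qed

section \<open>Expansion of the logarithmic phase\<close>

lemma norm_cis_minus_le: "norm (cis \<theta> - (1 + \<i> * of_real \<theta>)) \<le> \<theta>\<^sup>2"
proof -
  have "norm (exp (\<i> * of_real \<theta>) - (\<Sum>k\<le>1. (\<i> * of_real \<theta>) ^ k / fact k)) \<le> \<bar>\<theta>\<bar> ^ Suc 1 / fact (Suc 1)"
    by (rule iexp_approx1)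
  then have "norm (cis \<theta> - (1 + \<i> * of_real \<theta>)) \<le> \<theta>\<^sup>2 / 2"
    by (simp add: cis_conv_exp power2_eq_square)
  then show ?thesis using zero_le_power2[of \<theta>] by linarith
qed

text \<open>The phase factor is expanded as 1 - i\<theta> + O(\<theta>^2), where \<theta> is of
  order A ln t with A = (|x|/2t)^\<nu>. Freezing the logarithm changes \<theta> by O(A), since ln t
  - ln S \<le> ln 2. In \<theta>^2 the factor A (ln t)^2 is at most 1 by the hypothesis
  \<open>large\<close>, so this error is O(A) as well. Both are multiplied by an amplitude of order
  A/S, and A^2/S \<le> S^(-1-\<nu>) carries no logarithm.\<close>

lemma u_ap_estimate:
  fixes lam S t \<nu> :: real and c :: complex
  assumes nu: "\<nu> > 0" and S: "S \<ge> 1" and t: "S \<le> t" "t \<le> 2 * S" and x: "x \<noteq> 0" "norm x \<le> sqrt S"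
    and \<phi>: "\<phi> ((1 / (2 * t)) *\<^sub>R x) = c * of_real ((norm x / (2 * t)) powr \<nu>) * ang m x"
    and large: "S powr (- \<nu> / 2) * (ln (2 * S))\<^sup>2 \<le> 1"
  shows "norm (u_ap lam \<phi> t x - (c * qfun m \<nu> t x
      - (\<i> * of_real lam / 2 * of_real (norm c) * c * of_real (ln S)) * qfun m (2 * \<nu>) t x))
    \<le> norm c * (\<bar>lam\<bar> * norm c + \<bar>lam\<bar>\<^sup>2 * (norm c)\<^sup>2) * S powr (- 1 - \<nu>)"
    and "norm (u_ap lam \<phi> t x) \<le> norm c * S powr (- 1 - \<nu> / 2)"
proof -
  have t0: "t > 0" "t \<ge> 1" using S t by auto
  have S0: "S > 0" using S by simp
  define \<rho> where "\<rho> = norm x / (2 * t)"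
  have n: "norm x > 0" using x by simp
  have \<rho>: "\<rho> > 0" using n t0 by (simp add: \<rho>_def)
  have \<rho>S: "\<rho> \<le> S powr (- 1 / 2)"
  proof -
    have "\<rho> \<le> sqrt S / (2 * S)" unfolding \<rho>_def using x t S0 by (intro frac_le) auto
    also have "\<dots> \<le> sqrt S / S" using S0 by (intro divide_left_mono) auto
    also have "\<dots> = S powr (- 1 / 2)"
      using S0 powr_diff[of S "1 / 2" 1] by (simp add: powr_half_sqrt)
    finally show ?thesis .
  qed
  define A where "A = \<rho> powr \<nu>"
  have A0: "A > 0" using \<rho> by (simp add: A_def)
  have AS: "A \<le> S powr (- \<nu> / 2)"
  proof -
    have "A \<le> (S powr (- 1 / 2)) powr \<nu>" unfolding A_def using \<rho> \<rho>S nu by (intro powr_mono2) auto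
    then show ?thesis by (simp add: powr_powr)
  qed
  have A2: "A\<^sup>2 \<le> S powr (- \<nu>)"
  proof -
    have "A\<^sup>2 \<le> (S powr (- \<nu> / 2))\<^sup>2" using AS A0 by (intro power_mono) auto
    then show ?thesis by (simp add: powr_sq)
  qed
  define E where "E = (- \<i> / 2) * of_real (A / t) * cis ((norm x)\<^sup>2 / (4 * t)) * ang m x"
  have pw: "t powr (- 1 - a) * (norm x / 2) powr a = \<rho> powr a / t" for a
  proof -
    have "\<rho> = (norm x / 2) / t" by (simp add: \<rho>_def)
    then have "\<rho> powr a = ((norm x / 2) / t) powr a" by (rule arg_cong)
    also have "\<dots> = (norm x / 2) powr a / t powr a" using n t0 by (subst powr_divide) auto
    finally have "\<rho> powr a = (norm x / 2) powr a / t powr a" .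
    moreover have "t powr (- 1 - a) = 1 / t / t powr a" using t0 powr_diff[of t "-1" a] by (simp add: powr_minus divide_inverse)
    ultimately show ?thesis by simp
  qed
  have q1: "qfun m \<nu> t x = E" unfolding qfun_def pw E_def A_def ..
  have q2: "qfun m (2 * \<nu>) t x = of_real A * E"
  proof -
    have "\<rho> powr (2 * \<nu>) / t = A * (A / t)" using powr_sq[of \<rho> \<nu>] by (simp add: A_def power2_eq_square)
    then show ?thesis unfolding qfun_def pw E_def by (simp only: of_real_mult mult_ac)
  qed
  define \<theta> where "\<theta> = lam / 2 * (norm c * A * ln t)"
  define \<theta>S where "\<theta>S = lam / 2 * (norm c * A * ln S)"
  have n\<phi>: "norm (\<phi> ((1 / (2 * t)) *\<^sub>R x)) = norm c * A"
    unfolding \<phi> norm_mult norm_ang_eq[OF x(1)] using A0 by (simp add: A_def \<rho>_def)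
  have uap: "u_ap lam \<phi> t x = E * c * cis (- \<theta>)"
  proof -
    have e1: "exp (\<i> * of_real ((norm x)\<^sup>2 / (4 * t))) = cis ((norm x)\<^sup>2 / (4 * t))" by (simp add: cis_conv_exp)
    have "exp (- (\<i> * of_real lam / 2) * of_real (norm c * A * ln t)) = cis (- \<theta>)"
      unfolding cis_conv_exp \<theta>_def by (rule arg_cong[where f=exp]) simp
    moreover have "1 / (2 * \<i> * of_real t) * Z * (c * of_real A * ang m x) * W = ((- \<i> / 2) * of_real (A / t) * Z * ang m x) * c * W" for Z W
      using t0 by (simp add: field_simps)
    ultimately show ?thesis unfolding u_ap_def n\<phi> e1 unfolding \<phi> E_def A_def[symmetric] \<rho>_def[symmetric] by (simp only:)
  qed
  have nE: "norm E \<le> A / S"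
  proof -
    have "norm E = 1 / 2 * (A / t)" using A0 t0 norm_ang_eq[OF x(1), of m] by (simp add: E_def norm_mult norm_divide)
    also have "\<dots> \<le> A / t"
    proof -
      have "A / t \<ge> 0" using A0 t0 by simp
      then show ?thesis by linarith
    qed
    also have "\<dots> \<le> A / S" using A0 t S0 by (intro divide_left_mono) auto
    finally show ?thesis .
  qed
  have Sdiv: "S powr (- a) / S = S powr (- 1 - a)" for a
  proof -
    have "- 1 - a = - a - 1" by simp
    then show ?thesis using S0 powr_diff[of S "- a" 1] by (simp only: powr_one)
  qed
  show "norm (u_ap lam \<phi> t x) \<le> norm c * S powr (- 1 - \<nu> / 2)"
  proof -
    have "norm (u_ap lam \<phi> t x) = norm c * norm E" unfolding uap by (simp add: norm_mult)
    also have "\<dots> \<le> norm c * (S powr (- \<nu> / 2) / S)"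
      using nE AS S0 by (intro mult_left_mono order_trans[OF nE] divide_right_mono) auto
    finally show ?thesis using Sdiv[of "\<nu> / 2"] by simp
  qed
  have lnt: "0 \<le> ln t" "ln t \<le> ln (2 * S)" "ln S \<le> ln t" "ln t - ln S \<le> 1"
  proof -
    show "0 \<le> ln t" "ln t \<le> ln (2 * S)" "ln S \<le> ln t" using t0 t S0 by auto
    then have "ln t - ln S \<le> ln (2 * S) - ln S" by simp
    also have "\<dots> = ln 2" using S0 by (simp add: ln_mult)
    also have "\<dots> \<le> 1" using ln_le_minus_one[of 2] by simp
    finally show "ln t - ln S \<le> 1" .
  qed
  have th: "\<theta>\<^sup>2 \<le> \<bar>lam\<bar>\<^sup>2 * (norm c)\<^sup>2 * A"
  proof -
    have "\<theta>\<^sup>2 = (1 / 4) * (\<bar>lam\<bar>\<^sup>2 * (norm c)\<^sup>2 * A * (A * (ln t)\<^sup>2))"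
      by (simp add: \<theta>_def power_mult_distrib power_divide power2_eq_square)
    also have "\<dots> \<le> 1 * (\<bar>lam\<bar>\<^sup>2 * (norm c)\<^sup>2 * A * 1)"
    proof (intro mult_mono mult_left_mono)
      have "A * (ln t)\<^sup>2 \<le> S powr (- \<nu> / 2) * (ln (2 * S))\<^sup>2" using AS A0 lnt by (intro mult_mono power_mono) auto
      then show "A * (ln t)\<^sup>2 \<le> 1" using large by simp
    qed (use A0 in auto)
    finally show ?thesis by simp
  qed
  have thd: "\<bar>\<theta> - \<theta>S\<bar> \<le> \<bar>lam\<bar> * norm c * A"
  proof -
    have e: "\<theta> - \<theta>S = (1 / 2) * (lam * (norm c * A) * (ln t - ln S))" by (simp add: \<theta>_def \<theta>S_def algebra_simps)
    have "\<bar>\<theta> - \<theta>S\<bar> = (1 / 2) * (\<bar>lam\<bar> * (norm c * A) * (ln t - ln S))"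
      unfolding e abs_mult using A0 lnt by simp
    also have "\<dots> \<le> 1 * (\<bar>lam\<bar> * (norm c * A) * 1)" using A0 lnt by (intro mult_mono mult_left_mono) auto
    finally show ?thesis by (simp add: mult.assoc)
  qed
  have "u_ap lam \<phi> t x - (c * qfun m \<nu> t x - (\<i> * of_real lam / 2 * of_real (norm c) * c * of_real (ln S)) * qfun m (2 * \<nu>) t x)
     = E * c * ((cis (- \<theta>) - (1 + \<i> * of_real (- \<theta>))) + (- \<i>) * of_real (\<theta> - \<theta>S))"
    unfolding uap q1 q2 \<theta>S_def by (simp add: algebra_simps)
  also have "norm \<dots> \<le> (A / S) * norm c * ((- \<theta>)\<^sup>2 + \<bar>\<theta> - \<theta>S\<bar>)"
    unfolding norm_mult[of "E * c"] norm_mult[of E c]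
  proof (intro mult_mono nE order_refl norm_triangle_mono norm_cis_minus_le)
    show "norm (- \<i> * of_real (\<theta> - \<theta>S)) \<le> \<bar>\<theta> - \<theta>S\<bar>" unfolding norm_mult norm_of_real by simp
  qed (use A0 S0 in auto)
  also have "\<dots> \<le> (A / S) * norm c * (\<bar>lam\<bar>\<^sup>2 * (norm c)\<^sup>2 * A + \<bar>lam\<bar> * norm c * A)"
    using A0 S0 th thd by (intro mult_left_mono add_mono) auto
  also have "\<dots> = norm c * (\<bar>lam\<bar> * norm c + \<bar>lam\<bar>\<^sup>2 * (norm c)\<^sup>2) * (A\<^sup>2 / S)"
    by (simp add: algebra_simps power2_eq_square add_divide_distrib)
  also have "\<dots> \<le> norm c * (\<bar>lam\<bar> * norm c + \<bar>lam\<bar>\<^sup>2 * (norm c)\<^sup>2) * (S powr (- \<nu>) / S)"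
    using A2 S0 by (intro mult_left_mono divide_right_mono) auto
  finally show "norm (u_ap lam \<phi> t x - (c * qfun m \<nu> t x
      - (\<i> * of_real lam / 2 * of_real (norm c) * c * of_real (ln S)) * qfun m (2 * \<nu>) t x))
    \<le> norm c * (\<bar>lam\<bar> * norm c + \<bar>lam\<bar>\<^sup>2 * (norm c)\<^sup>2) * S powr (- 1 - \<nu>)"
    unfolding Sdiv .
qed

section \<open>Size and support of the approximate solution\<close>

context profile
begin

lemma u_ap_f_basic:
  assumes R: "R > 0" "\<And>r. r \<ge> R \<Longrightarrow> \<eta> r = 0" and t: "t > 0"
  shows "u_ap lam f t \<in> borel_measurable borel"
    and "norm (u_ap lam f t x) \<le> (1 / (2 * t)) * (norm c * R powr \<nu>)"
    and "norm x \<ge> 2 * t * R \<Longrightarrow> u_ap lam f t x = 0"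
proof -
  have [measurable]: "(\<lambda>x. f ((1 / (2 * t)) *\<^sub>R x)) \<in> borel_measurable borel"
    by (rule measurable_compose[OF _ f_measurable]) simp
  show "u_ap lam f t \<in> borel_measurable borel" unfolding u_ap_def[abs_def] by measurable
  have "norm (exp (\<i> * complex_of_real ((norm x)\<^sup>2 / (4 * t)))) = 1" by (rule norm_exp_i_times)
  moreover have "norm (exp (- (\<i> * complex_of_real lam / 2) * of_real (norm (f ((1 / (2 * t)) *\<^sub>R x)) * ln t))) = 1"
    by simp
  ultimately have "norm (u_ap lam f t x) = (1 / (2 * t)) * norm (f ((1 / (2 * t)) *\<^sub>R x))"
    using t unfolding u_ap_def norm_mult by (simp add: norm_divide norm_mult)
  also have "\<dots> \<le> (1 / (2 * t)) * (norm c * R powr \<nu>)"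
    using t by (intro mult_left_mono f_bound(1)[OF R]) auto
  finally show "norm (u_ap lam f t x) \<le> (1 / (2 * t)) * (norm c * R powr \<nu>)" .
  assume "norm x \<ge> 2 * t * R"
  then have "norm ((1 / (2 * t)) *\<^sub>R x) \<ge> R" using t by (simp add: field_simps)
  then have "f ((1 / (2 * t)) *\<^sub>R x) = 0" using f_bound(2)[OF R] by blast
  then show "u_ap lam f t x = 0" by (simp add: u_ap_def)
qed

lemma u_ap_f_L2: "t > 0 \<Longrightarrow> u_ap lam f t \<in> L2"
proof -
  assume t: "t > 0"
  obtain d R C where "cutoff_data \<eta> d R C" by (rule radial_cutoffE[OF cut])
  note R = cutoff_dataD[OF this]
  show ?thesis
    by (rule L2_bounded_support(1)[OF u_ap_f_basic(1)[OF R(2,4) t] u_ap_f_basic(2)[OF R(2,4) t] _ u_ap_f_basic(3)[OF R(2,4) t]])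
       (use t R in auto)
qed

text \<open>The modulus is O(1/t) on a disc of area O(t^2), so the fourth power integrates to
  O(t^(-2)).\<close>

lemma u_ap_f_L4:
  obtains C0 where "C0 \<ge> 0" "\<And>t. t \<ge> 1 \<Longrightarrow> (\<integral>\<^sup>+ x. ennreal ((norm (u_ap lam f t x)) ^ 4) \<partial>lborel) \<le> ennreal C0"
proof -
  obtain d R C where "cutoff_data \<eta> d R C" by (rule radial_cutoffE[OF cut])
  note R = cutoff_dataD[OF this]
  define B where "B = norm c * R powr \<nu>"
  have B: "B \<ge> 0" by (simp add: B_def)
  define C0 where "C0 = B ^ 4 * vol2 * R\<^sup>2"
  have bd: "(\<integral>\<^sup>+ x. ennreal ((norm (u_ap lam f t x)) ^ 4) \<partial>lborel) \<le> ennreal C0" if t: "t \<ge> 1" for t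
  proof -
    have t0: "t > 0" using t by simp
    have "(\<integral>\<^sup>+ x. ennreal ((norm (u_ap lam f t x)) ^ 4) \<partial>lborel)
      \<le> (\<integral>\<^sup>+ x. ennreal (((1 / (2 * t)) * B) ^ 4) * indicator (ball (0::real^2) (2 * t * R)) x \<partial>lborel)"
    proof (rule nn_integral_mono)
      fix x :: "real^2"
      show "ennreal ((norm (u_ap lam f t x)) ^ 4) \<le> ennreal (((1 / (2 * t)) * B) ^ 4) * indicator (ball 0 (2 * t * R)) x"
      proof (cases "norm x \<ge> 2 * t * R")
        case True
        then show ?thesis using u_ap_f_basic(3)[OF R(2,4) t0, of x lam] by simp
      next
        case False
        have "(norm (u_ap lam f t x)) ^ 4 \<le> ((1 / (2 * t)) * B) ^ 4"
          unfolding B_def by (intro power_mono u_ap_f_basic(2)[OF R(2,4) t0]) auto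
        then show ?thesis using False by (simp add: ennreal_leI)
      qed
    qed
    also have "\<dots> = ennreal (((1 / (2 * t)) * B) ^ 4 * (vol2 * (2 * t * R)\<^sup>2))"
      using t0 R B vol2_pos by (subst nn_integral_cmult_indicator) (auto simp: emeasure_ball_2 ennreal_mult less_imp_le)
    also have "\<dots> \<le> ennreal C0"
    proof (rule ennreal_leI)
      have "((1 / (2 * t)) * B) ^ 4 * (vol2 * (2 * t * R)\<^sup>2) = C0 * (1 / (2 * t))\<^sup>2"
        unfolding C0_def using t0 by (simp add: field_simps eval_nat_numeral)
      also have "\<dots> \<le> C0 * 1"
      proof (rule mult_left_mono)
        have "1 / (2 * t) \<le> 1" using t by simp
        then show "(1 / (2 * t))\<^sup>2 \<le> 1" using t0 by (intro power_le_one) auto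
        show "0 \<le> C0" using B vol2_pos by (simp add: C0_def)
      qed
      finally show "((1 / (2 * t)) * B) ^ 4 * (vol2 * (2 * t * R)\<^sup>2) \<le> C0" by simp
    qed
    finally show ?thesis .
  qed
  have "C0 \<ge> 0" using B vol2_pos by (simp add: C0_def)
  then show ?thesis using that bd by blast
qed

end

section \<open>The contradiction on the time window from S to 2S\<close>

locale decay = profile + nls +
  fixes M :: real
  assumes lam0: "lam \<noteq> 0" and c0: "c \<noteq> 0" and T1: "T \<ge> 1" and M0: "M \<ge> 0"
    and r_bound: "\<And>S. S \<ge> T \<Longrightarrow> AE t in lborel. t \<ge> S \<longrightarrow> l2 (\<lambda>x. u t x - u_ap lam f t x) \<le> M * S powr (- 1 / 2 - \<nu>)"
begin

text \<open>T + 1 puts the window strictly inside the range where the weak equation may be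
  differentiated. The second condition places x/2t on the plateau of the cutoff, and the third
  absorbs the square of the logarithmic phase.\<close>

definition large :: "real \<Rightarrow> bool" where
  "large S \<longleftrightarrow> S \<ge> T + 1 \<and> (\<forall>r. 0 \<le> r \<and> r \<le> 1 / sqrt S \<longrightarrow> \<eta> r = 1) \<and> S powr (- \<nu> / 2) * (ln (2 * S))\<^sup>2 \<le> 1"

lemma eventually_large: "eventually large at_top"
proof -
  obtain d R C where "cutoff_data \<eta> d R C" by (rule radial_cutoffE[OF cut])
  note R = cutoff_dataD[OF this]
  have "((\<lambda>S::real. 1 / sqrt S) \<longlongrightarrow> 0) at_top" by real_asymp
  then have 1: "\<forall>\<^sub>F S in at_top. 1 / sqrt S < d" by (rule order_tendstoD) (rule R(1))
  have "((\<lambda>S::real. S powr (- \<nu> / 2) * (ln (2 * S))\<^sup>2) \<longlongrightarrow> 0) at_top" using nu01(1) by real_asymp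
  then have 2: "\<forall>\<^sub>F S in at_top. S powr (- \<nu> / 2) * (ln (2 * S))\<^sup>2 < 1" by (rule order_tendstoD) simp
  show ?thesis using 1 2 eventually_ge_at_top[of "T + 1"]
    by eventually_elim (use R(3) in \<open>auto simp: large_def\<close>)
qed

text \<open>
  \<open>v S\<close> is \<open>u_ap\<close> near \<open>\<bar>x\<bar> \<approx> \<surd>S\<close> with its phase expanded to first order and \<open>ln t\<close> frozen at \<open>t = S\<close>.
\<close>

definition d1 :: "real \<Rightarrow> complex" where
  "d1 S = \<i> * of_real lam / 2 * of_real (norm c) * c * of_real (ln S)"

definition v :: "real \<Rightarrow> real \<Rightarrow> fld" where
  "v S t x = c * qfun m \<nu> t x - d1 S * qfun m (2 * \<nu>) t x"

definition C3 :: real where "C3 = norm c * (\<bar>lam\<bar> * norm c + \<bar>lam\<bar>\<^sup>2 * (norm c)\<^sup>2)"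

lemma f_scaled:
  assumes "large S" "t \<ge> S" "x \<noteq> 0" "norm x \<le> sqrt S"
  shows "f ((1 / (2 * t)) *\<^sub>R x) = c * of_real ((norm x / (2 * t)) powr \<nu>) * ang m x"
proof -
  have S: "S \<ge> 1" using assms(1) T1 by (simp add: large_def)
  then have t: "t > 0" using assms(2) by linarith
  have n: "norm ((1 / (2 * t)) *\<^sub>R x) = norm x / (2 * t)" using t by simp
  have "norm x / (2 * t) \<le> sqrt S / S" using assms S by (intro frac_le) auto
  also have "\<dots> = 1 / sqrt S" using S by (simp add: real_div_sqrt field_simps)
  finally have "\<eta> (norm x / (2 * t)) = 1" using assms(1) t by (auto simp: large_def)
  moreover have "ang m ((1 / (2 * t)) *\<^sub>R x) = ang m x"
  proof -
    have "Complex ((1 / (2 * t)) * x$1) ((1 / (2 * t)) * x$2) = of_real (1 / (2 * t)) * Complex (x$1) (x$2)"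
      by (simp add: complex_eq_iff)
    then have "sgn (Complex ((1 / (2 * t)) * x$1) ((1 / (2 * t)) * x$2)) = sgn (Complex (x$1) (x$2))"
      using t by (simp only: sgn_mult sgn_of_real) simp
    then show ?thesis by (simp add: ang_def)
  qed
  ultimately show ?thesis unfolding f_def h_def n by simp
qed

lemma r_L2: "t > 0 \<Longrightarrow> (\<lambda>x. u t x - u_ap lam f t x) \<in> L2"
  by (rule L2_diff[OF uL u_ap_f_L2])

lemma S_powr:
  assumes "S > 0"
  shows "S powr (- 1 / 2 - a) * sqrt S = S powr (- a)" "S powr (- 1 - a) * S = S powr (- a)"
    "S powr (- 1 - a) * sqrt S = S powr (- 1 / 2 - a)"
  using assms by (simp_all add: powr_half_sqrt[symmetric] powr_add[symmetric] powr_mult_base algebra_simps)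

text \<open>Split u - v into u - u_ap, of L^2 size S^(-1/2-\<nu>), and u_ap - v, of pointwise size
  S^(-1-\<nu>) on an area of order S. Paired with a function bounded by \<beta> on the annulus, of
  norm O(\<beta> sqrt S), both give \<beta> S^(-\<nu>). The free \<beta> serves G with \<beta> = 1
  and HG with \<beta> = B/S.\<close>

lemma restricted_pairing:
  assumes L: "large S" and a: "a > 0" and \<psi>: "tst 0 (ann a S) \<psi>" "\<And>x. norm (\<psi> x) \<le> \<beta>" and t: "t \<in> {S..2 * S}"
    and r: "l2 (\<lambda>x. u t x - u_ap lam f t x) \<le> M * S powr (- 1 / 2 - \<nu>)"
  shows "norm (pairing (u t) \<psi> - pairing (v S t) \<psi>) \<le> \<beta> * ((2 * sqrt vol2 * M + 4 * vol2 * C3) * S powr (- \<nu>))"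
proof -
  have S: "S \<ge> 1" using L T1 by (simp add: large_def)
  then have S0: "S > 0" and t0: "t > 0" using t by auto
  have \<beta>: "\<beta> \<ge> 0" using \<psi>(2)[of 0] norm_ge_zero order_trans by blast
  have \<psi>L: "\<psi> \<in> L2" by (rule tst_L2[OF \<psi>(1)])
  have K: "\<And>x. x \<notin> ann a S \<Longrightarrow> \<psi> x = 0" "0 \<notin> ann a S" using \<psi>(1) by (auto simp: tst_def)
  \<comment> \<open>The annulus contains its outer circle, whereas \<open>L2_bounded_support\<close>
    asks for zeros on |x| \<ge> r; the radius 2 sqrt S leaves room.\<close>
  have K2: "x \<notin> ann a S" if "norm x \<ge> 2 * sqrt S" for x
  proof -
    have "sqrt S < norm x" using that real_sqrt_gt_zero[OF S0] by linarith
    then show ?thesis by (simp add: ann_def)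
  qed
  have \<psi>l: "l2 \<psi> \<le> \<beta> * (sqrt vol2 * (2 * sqrt S))"
    by (rule L2_bounded_support(2)[OF L2_measurable[OF \<psi>L] \<psi>(2)]) (use K K2 S0 in auto)
  \<comment> \<open>The expansion of the phase is valid on the annulus. Cutting off outside does not
    change the pairing, because \<psi> vanishes there.\<close>
  define w where "w x = (if x \<in> ann a S then u_ap lam f t x - v S t x else 0)" for x
  have vm: "v S t \<in> borel_measurable borel"
    unfolding v_def[abs_def] using continuous_off_0_measurable[OF Ck_on_imp_continuous[OF qfun_Ck[OF m, of 0]]]
    by (intro borel_measurable_diff borel_measurable_times borel_measurable_const) auto
  have annm: "ann a S \<in> sets borel" using \<psi>(1) by (auto simp: tst_def intro: borel_compact)
  have wm: "w \<in> borel_measurable borel"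
    unfolding w_def[abs_def] using vm L2_measurable[OF u_ap_f_L2[OF t0]] annm by (intro measurable_If_set) auto
  have C3: "C3 \<ge> 0" by (simp add: C3_def)
  have wb: "norm (w x) \<le> C3 * S powr (- 1 - \<nu>)" for x
  proof (cases "x \<in> ann a S")
    case True
    then have x: "x \<noteq> 0" "norm x \<le> sqrt S" using K(2) by (auto simp: ann_def)
    have t': "S \<le> t" "t \<le> 2 * S" using t by auto
    have lg: "S powr (- \<nu> / 2) * (ln (2 * S))\<^sup>2 \<le> 1" using L by (simp add: large_def)
    show ?thesis
      using u_ap_estimate(1)[where \<phi>=f and c=c and \<nu>=\<nu> and m=m, OF nu01(1) S t' x f_scaled[OF L t'(1) x] lg, of lam] True
      by (simp add: w_def v_def d1_def C3_def)
  qed (use C3 in \<open>simp add: w_def\<close>)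
  have w0: "w x = 0" if "norm x \<ge> 2 * sqrt S" for x using K2[OF that] by (simp add: w_def)
  have s2: "0 \<le> 2 * sqrt S" using S0 by simp
  note wL = L2_bounded_support[OF wm wb s2 w0]
  have vi: "integrable lborel (\<lambda>x. v S t x * cnj (\<psi> x))"
  proof (rule tst_integrable[OF tst_mult_cnj[OF _ \<psi>(1)]])
    have "Ck_on 0 (- {0}) (\<lambda>x. c * qfun m \<nu> t x + (- d1 S) * qfun m (2 * \<nu>) t x)"
      by (intro Ck_on_add Ck_on_mult Ck_on_const qfun_Ck[OF m]) auto
    then show "Ck_on 0 (- {0}) (v S t)" by (simp add: v_def[abs_def])
  qed
  have "pairing (u t) \<psi> - pairing (v S t) \<psi> = (\<integral> x. u t x * cnj (\<psi> x) - v S t x * cnj (\<psi> x) \<partial>lborel)"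
    unfolding pairing_def using pairing_integrable(1)[OF uL \<psi>L, of t] vi by simp
  also have "\<dots> = pairing (\<lambda>x. (u t x - u_ap lam f t x) + w x) \<psi>"
    unfolding pairing_def
    by (rule Bochner_Integration.integral_cong) (use K(1) in \<open>auto simp: w_def algebra_simps\<close>)
  also have "\<dots> = pairing (\<lambda>x. u t x - u_ap lam f t x) \<psi> + pairing w \<psi>"
    by (rule pairing_add_left[OF r_L2[OF t0] wL(1) \<psi>L])
  also have "norm \<dots> \<le> (M * S powr (- 1 / 2 - \<nu>)) * (\<beta> * (sqrt vol2 * (2 * sqrt S)))
      + (C3 * S powr (- 1 - \<nu>) * (sqrt vol2 * (2 * sqrt S))) * (\<beta> * (sqrt vol2 * (2 * sqrt S)))"
  proof (rule norm_triangle_mono)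
    have "norm (pairing (\<lambda>x. u t x - u_ap lam f t x) \<psi>) \<le> l2 (\<lambda>x. u t x - u_ap lam f t x) * l2 \<psi>"
      by (rule pairing_integrable(2)[OF r_L2[OF t0] \<psi>L])
    also have "\<dots> \<le> (M * S powr (- 1 / 2 - \<nu>)) * (\<beta> * (sqrt vol2 * (2 * sqrt S)))"
      using M0 by (intro mult_mono r \<psi>l) auto
    finally show "norm (pairing (\<lambda>x. u t x - u_ap lam f t x) \<psi>) \<le> (M * S powr (- 1 / 2 - \<nu>)) * (\<beta> * (sqrt vol2 * (2 * sqrt S)))" .
    have "norm (pairing w \<psi>) \<le> l2 w * l2 \<psi>" by (rule pairing_integrable(2)[OF wL(1) \<psi>L])
    also have "\<dots> \<le> (C3 * S powr (- 1 - \<nu>) * (sqrt vol2 * (2 * sqrt S))) * (\<beta> * (sqrt vol2 * (2 * sqrt S)))"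
      using C3 vol2_pos S0 by (intro mult_mono wL(2) \<psi>l) auto
    finally show "norm (pairing w \<psi>) \<le> (C3 * S powr (- 1 - \<nu>) * (sqrt vol2 * (2 * sqrt S))) * (\<beta> * (sqrt vol2 * (2 * sqrt S)))" .
  qed
  also have "\<dots> = \<beta> * (2 * sqrt vol2 * M * (S powr (- 1 / 2 - \<nu>) * sqrt S)
      + 4 * (sqrt vol2 * sqrt vol2) * C3 * (S powr (- 1 - \<nu>) * (sqrt S * sqrt S)))"
    by (simp add: algebra_simps)
  also have "\<dots> = \<beta> * ((2 * sqrt vol2 * M + 4 * vol2 * C3) * S powr (- \<nu>))"
  proof -
    have q: "sqrt vol2 * sqrt vol2 = vol2" "sqrt S * sqrt S = S" using vol2_pos S0 by auto
    show ?thesis unfolding q S_powr[OF S0] by (simp add: algebra_simps)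
  qed
  finally show ?thesis .
qed

text \<open>On the annulus u_ap is O(S^(-1-\<nu>/2)), hence u has local L^2 norm
  O(S^(-1/2-\<nu>/2)), the remainder decaying faster. The nonlinear pairing is quadratic in this
  norm.\<close>

lemma nonlin_pairing_small:
  assumes L: "large S" and g: "bump g a r1 r2" and t: "t \<in> {S..2 * S}"
    and r: "l2 (\<lambda>x. u t x - u_ap lam f t x) \<le> M * S powr (- 1 / 2 - \<nu>)"
  shows "norm (pairing (nonlin (u t)) (Gfun g m S)) \<le> (M + 2 * sqrt vol2 * norm c)\<^sup>2 * S powr (- 1 - \<nu>)"
proof -
  have S: "S \<ge> 1" using L T1 by (simp add: large_def)
  then have S0: "S > 0" and t0: "t > 0" using t by auto
  have G: "tst 0 (ann a S) (Gfun g m S)" by (rule Gfun_tst[OF m g S0])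
  have K: "\<And>x. x \<notin> ann a S \<Longrightarrow> Gfun g m S x = 0" "0 \<notin> ann a S" using G by (auto simp: tst_def)
  have annm [measurable]: "ann a S \<in> sets borel" using G by (auto simp: tst_def intro: borel_compact)
  note [measurable] = L2_measurable[OF uL] L2_measurable[OF u_ap_f_L2[OF t0]]
  define p where "p x = (if x \<in> ann a S then u_ap lam f t x else 0)" for x
  define q where "q x = (if x \<in> ann a S then u t x - u_ap lam f t x else 0)" for x
  define z where "z x = (if x \<in> ann a S then u t x else 0)" for x
  have pm: "p \<in> borel_measurable borel" and qm: "q \<in> borel_measurable borel"
    unfolding p_def[abs_def] q_def[abs_def] by (auto intro!: measurable_If_set)
  have pb: "norm (p x) \<le> norm c * S powr (- 1 - \<nu> / 2)" for x
  proof (cases "x \<in> ann a S")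
    case True
    then have x: "x \<noteq> 0" "norm x \<le> sqrt S" using K(2) by (auto simp: ann_def)
    have t': "S \<le> t" "t \<le> 2 * S" using t by auto
    have lg: "S powr (- \<nu> / 2) * (ln (2 * S))\<^sup>2 \<le> 1" using L by (simp add: large_def)
    show ?thesis
      using u_ap_estimate(2)[where \<phi>=f and c=c and \<nu>=\<nu> and m=m, OF nu01(1) S t' x f_scaled[OF L t'(1) x] lg, of lam] True by (simp add: p_def)
  qed (simp add: p_def)
  have p0: "p x = 0" if "norm x \<ge> 2 * sqrt S" for x
  proof -
    have "sqrt S < norm x" using that real_sqrt_gt_zero[OF S0] by linarith
    then show ?thesis by (simp add: p_def ann_def)
  qed
  have s2: "0 \<le> 2 * sqrt S" using S0 by simp
  note pL = L2_bounded_support[OF pm pb s2 p0]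
  have ri: "integrable lborel (\<lambda>x. (norm (u t x - u_ap lam f t x))\<^sup>2)" using r_L2[OF t0] by (simp add: L2_iff)
  have qi: "integrable lborel (\<lambda>x. (norm (q x))\<^sup>2)"
    by (rule Bochner_Integration.integrable_bound[OF ri]) (use qm in \<open>auto simp: q_def\<close>)
  have qL: "q \<in> L2" using qm qi by (simp add: L2_iff)
  have ql: "l2 q \<le> M * S powr (- 1 / 2 - \<nu>)"
  proof -
    have "l2 q \<le> l2 (\<lambda>x. u t x - u_ap lam f t x)"
      unfolding l2_def by (intro real_sqrt_le_mono integral_mono qi ri) (auto simp: q_def)
    then show ?thesis using r by (rule order_trans)
  qed
  have zpq: "z = (\<lambda>x. q x + p x)" by (auto simp: fun_eq_iff z_def p_def q_def)
  have zL: "z \<in> L2" unfolding zpq by (rule L2_add[OF qL pL(1)])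
  have nu2: "S powr (- 1 / 2 - \<nu>) \<le> S powr (- 1 / 2 - \<nu> / 2)" using S nu01 by (intro powr_mono) auto
  have "l2 z \<le> l2 q + l2 p" unfolding zpq by (rule l2_triangle[OF qL pL(1)])
  also have "\<dots> \<le> M * S powr (- 1 / 2 - \<nu> / 2) + norm c * S powr (- 1 - \<nu> / 2) * (sqrt vol2 * (2 * sqrt S))"
    using ql pL(2) mult_left_mono[OF nu2 M0] by linarith
  also have "\<dots> = (M + 2 * sqrt vol2 * norm c) * S powr (- 1 / 2 - \<nu> / 2)"
    unfolding S_powr(3)[OF S0, symmetric] by (simp add: algebra_simps)
  finally have zl: "l2 z \<le> (M + 2 * sqrt vol2 * norm c) * S powr (- 1 / 2 - \<nu> / 2)" .
  have "pairing (nonlin (u t)) (Gfun g m S) = pairing (nonlin z) (Gfun g m S)"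
    unfolding pairing_def by (rule Bochner_Integration.integral_cong) (use K(1) in \<open>auto simp: nonlin_def z_def\<close>)
  also have "norm \<dots> \<le> 1 * (l2 z)\<^sup>2"
    by (rule nonlin_pairing_bounded(2)[OF zL L2_measurable[OF tst_L2[OF G]] Gfun_le_1[OF g S0]])
  also have "(l2 z)\<^sup>2 \<le> ((M + 2 * sqrt vol2 * norm c) * S powr (- 1 / 2 - \<nu> / 2))\<^sup>2" by (intro power_mono zl) simp
  also have "\<dots> = (M + 2 * sqrt vol2 * norm c)\<^sup>2 * S powr (- 1 - \<nu>)"
  proof -
    have "2 * (- 1 / 2 - \<nu> / 2) = - 1 - \<nu>" by simp
    then show ?thesis by (simp only: power_mult_distrib powr_sq)
  qed
  finally show ?thesis by simp
qed

text \<open>The pairing with \<open>v S t\<close>, written through the pairings of the two waves,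
  whose time derivatives are known.\<close>

definition V :: "real \<Rightarrow> fld \<Rightarrow> real \<Rightarrow> complex" where
  "V S \<psi> t = c * pairing (qfun m \<nu> t) \<psi> - d1 S * pairing (qfun m (2 * \<nu>) t) \<psi>"

lemma V_eq:
  assumes "tst 0 K \<psi>"
  shows "V S \<psi> t = pairing (v S t) \<psi>"
proof -
  have i: "integrable lborel (\<lambda>x. qfun m b t x * cnj (\<psi> x))" for b
    by (rule tst_integrable[OF tst_mult_cnj[OF qfun_Ck[OF m] assms]])
  have "pairing (v S t) \<psi> = (\<integral> x. c * (qfun m \<nu> t x * cnj (\<psi> x)) - d1 S * (qfun m (2 * \<nu>) t x * cnj (\<psi> x)) \<partial>lborel)"
    unfolding pairing_def v_def by (rule Bochner_Integration.integral_cong) (simp_all add: algebra_simps)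
  also have "\<dots> = V S \<psi> t" unfolding V_def pairing_def using i by simp
  finally show ?thesis by simp
qed

lemma V_derivative:
  assumes "tst 0 K \<psi>" "t > 0"
  shows "(V S \<psi> has_vector_derivative (c * pairing (dqfun m \<nu> t) \<psi> - d1 S * pairing (dqfun m (2 * \<nu>) t) \<psi>)) (at t)"
  unfolding V_def[abs_def] using nu01
  by (intro has_vector_derivative_diff has_vector_derivative_mult_right qfun_pairing_derivative[OF m _ assms]) auto

lemma difference_bound:
  assumes L: "large S" and a: "a > 0" and \<psi>: "tst 0 (ann a S) \<psi>" "\<And>x. norm (\<psi> x) \<le> \<beta>" and t: "t \<in> {S..2 * S}"
  shows "norm (pairing (u t) \<psi> - V S \<psi> t) \<le> \<beta> * ((2 * sqrt vol2 * M + 4 * vol2 * C3) * S powr (- \<nu>))"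
proof (rule AE_norm_le_imp_all[where a=S and b="2 * S", OF _ _ _ t])
  have S: "S \<ge> T" "S > 0" using L T1 by (auto simp: large_def)
  show "S < 2 * S" using S by simp
  have "continuous_on {S..2 * S} (V S \<psi>)"
  proof (rule continuous_at_imp_continuous_on, rule ballI)
    fix s assume "s \<in> {S..2 * S}"
    then have "s > 0" using S by auto
    from V_derivative[OF \<psi>(1) this] show "isCont (V S \<psi>) s" by (rule has_vector_derivative_continuous)
  qed
  then show "continuous_on {S..2 * S} (\<lambda>t. pairing (u t) \<psi> - V S \<psi> t)"
    by (intro continuous_on_diff pairing_u_continuous tst_L2[OF \<psi>(1)])
  show "AE t in lborel. t \<in> {S..2 * S} \<longrightarrow> norm (pairing (u t) \<psi> - V S \<psi> t) \<le> \<beta> * ((2 * sqrt vol2 * M + 4 * vol2 * C3) * S powr (- \<nu>))"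
    using r_bound[OF S(1)]
  proof eventually_elim
    case (elim s)
    show ?case
    proof
      assume s: "s \<in> {S..2 * S}"
      then have "l2 (\<lambda>x. u s x - u_ap lam f s x) \<le> M * S powr (- 1 / 2 - \<nu>)" using elim by simp
      from restricted_pairing[OF L a \<psi> s this]
      show "norm (pairing (u s) \<psi> - V S \<psi> s) \<le> \<beta> * ((2 * sqrt vol2 * M + 4 * vol2 * C3) * S powr (- \<nu>))"
        unfolding V_eq[OF \<psi>(1)] .
    qed
  qed
qed

lemma nonlin_bound:
  assumes L: "large S" and g: "bump g a r1 r2" and t: "t \<in> {S..2 * S}"
  shows "norm (pairing (nonlin (u t)) (Gfun g m S)) \<le> (M + 2 * sqrt vol2 * norm c)\<^sup>2 * S powr (- 1 - \<nu>)"
proof (rule AE_norm_le_imp_all[where a=S and b="2 * S", OF _ _ _ t])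
  have S: "S \<ge> T" "S > 0" using L T1 by (auto simp: large_def)
  show "S < 2 * S" using S by simp
  show "continuous_on {S..2 * S} (\<lambda>t. pairing (nonlin (u t)) (Gfun g m S))"
    by (rule nonlin_u_continuous[OF L2_measurable[OF tst_L2[OF Gfun_tst[OF m g S(2)]]] Gfun_le_1[OF g S(2)]])
  show "AE t in lborel. t \<in> {S..2 * S} \<longrightarrow> norm (pairing (nonlin (u t)) (Gfun g m S)) \<le> (M + 2 * sqrt vol2 * norm c)\<^sup>2 * S powr (- 1 - \<nu>)"
    using r_bound[OF S(1)] by eventually_elim (use nonlin_pairing_small[OF L g] in auto)
qed

text \<open>The real part of \<kappa> Y changes by O(S^(-\<nu>)) across the window, by the bound at
  its ends. By the mean value theorem this change is S times the derivative at some time, where the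
  defect contributes at least a multiple of S^(-1-\<nu>) ln S and the other terms are
  O(S^(-1-\<nu>)). The common power cancels and ln S stays bounded.\<close>

lemma log_bounded:
  assumes g: "bump g a r1 r2"
  obtains W where "\<And>S. large S \<Longrightarrow>
    (3 / 2 * \<nu>\<^sup>2 * (1 / 8 * (r1 / 4) powr (2 * \<nu>) * vol2 * ((r2 - r1) / 2)\<^sup>2)) * ln S \<le> W"
proof -
  note b = bumpD[OF g]
  obtain B where B: "B \<ge> 0" "\<And>S x. S > 0 \<Longrightarrow> norm (Hop \<alpha> (Gfun g m S) x) \<le> B / S"
    using Hop_Gfun_bound[OF m g, of \<alpha>] by blast
  define k0 where "k0 = 1 / 8 * (r1 / 4) powr (2 * \<nu>) * vol2 * ((r2 - r1) / 2)\<^sup>2"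
  define C6 where "C6 = 2 * sqrt vol2 * M + 4 * vol2 * C3"
  define C5 where "C5 = (M + 2 * sqrt vol2 * norm c)\<^sup>2"
  \<comment> \<open>Normalizes the defect: \<kappa> times its coefficient -3i \<nu>^2
    \<open>d1 S\<close> equals (3/2) \<nu>^2 i ln S, so its real part has the sign given by
    \<open>main_term_lower_bound\<close>.\<close>
  define \<kappa> where "\<kappa> = \<i> / (of_real lam * of_real (norm c) * c)"
  define W where "W = norm \<kappa> * (B * C6 + \<bar>lam\<bar> * C5) + 2 * (norm \<kappa> * C6)"
  have "(3 / 2 * \<nu>\<^sup>2 * k0) * ln S \<le> W" if L: "large S" for S
  proof -
    have S: "S > 1" "S > T" "S > 0" using L T1 by (auto simp: large_def)
    define G where "G = Gfun g m S"
    define HG where "HG = Hop \<alpha> G"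
    have Gt: "tst k (ann a S) G" for k unfolding G_def by (rule Gfun_tst[OF m g S(3)])
    have HGt: "tst 0 (ann a S) HG" unfolding HG_def by (rule tst_Hop_L2[OF Gt])
    have G1: "norm (G x) \<le> 1" for x unfolding G_def by (rule Gfun_le_1[OF g S(3)])
    have HGb: "norm (HG x) \<le> B / S" for x unfolding HG_def G_def by (rule B(2)[OF S(3)])
    have Gtest: "G \<in> test_funs" unfolding G_def by (rule Gfun_test_funs[OF m g S(3)])
    have Hgr: "H_graph \<alpha> G HG" unfolding HG_def by (rule test_funs_H_graph[OF Gtest])
    define P where "P t = pairing (\<lambda>x. of_real (1 / (norm x)\<^sup>2) * qfun m (2 * \<nu>) t x) G" for t
    define N where "N t = pairing (nonlin (u t)) G" for t
    define Y where "Y t = pairing (u t) G - V S G t" for t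
    \<comment> \<open>The wave with exponent \<nu> solves the linear equation and leaves no defect;
      the one with exponent 2\<nu> leaves the factor (2\<nu>)^2 - \<nu>^2 = 3\<nu>^2.\<close>
    define D where "D t = - \<i> * (pairing (u t) HG - V S HG t) - \<i> * of_real lam * N t - \<i> * of_real (3 * \<nu>\<^sup>2) * d1 S * P t" for t
    have dY: "(Y has_vector_derivative D t) (at t)" if t: "t \<in> {S..2 * S}" for t
    proof -
      have t0: "t > T" "t > 0" using t S by auto
      have e1: "pairing (dqfun m \<nu> t) G = - \<i> * pairing (qfun m \<nu> t) HG"
        using qfun_pairing_equation[OF m nu Gt[of 2] t0(2), of \<nu>] unfolding HG_def by simp
      have e2: "pairing (dqfun m (2 * \<nu>) t) G = - \<i> * pairing (qfun m (2 * \<nu>) t) HG - \<i> * of_real (3 * \<nu>\<^sup>2) * P t"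
      proof -
        have "(2 * \<nu>)\<^sup>2 - \<nu>\<^sup>2 = 3 * \<nu>\<^sup>2" by (simp add: power2_eq_square)
        then show ?thesis
          using qfun_pairing_equation[OF m nu Gt[of 2] t0(2), of "2 * \<nu>"] unfolding HG_def P_def by (simp only:)
      qed
      have 1: "((\<lambda>t. pairing (u t) G) has_vector_derivative (- \<i> * pairing (u t) HG - \<i> * of_real lam * N t)) (at t)"
        unfolding N_def by (rule pairing_u_derivative[OF Hgr tst_L2[OF Gt] G1 tst_L2[OF HGt] t0(1)])
      have "(Y has_vector_derivative ((- \<i> * pairing (u t) HG - \<i> * of_real lam * N t)
          - (c * pairing (dqfun m \<nu> t) G - d1 S * pairing (dqfun m (2 * \<nu>) t) G))) (at t)"
        unfolding Y_def[abs_def] by (rule has_vector_derivative_diff[OF 1 V_derivative[OF Gt t0(2)]])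
      moreover have "(- \<i> * pairing (u t) HG - \<i> * of_real lam * N t)
          - (c * pairing (dqfun m \<nu> t) G - d1 S * pairing (dqfun m (2 * \<nu>) t) G) = D t"
        unfolding e1 e2 D_def V_def by (simp add: algebra_simps)
      ultimately show ?thesis by simp
    qed
    \<comment> \<open>The mean value theorem in equality form holds for real functions, so the real
      part is taken after multiplication by \<kappa>.\<close>
    have "((\<lambda>t. Re (\<kappa> * Y t)) has_real_derivative Re (\<kappa> * D t)) (at t)" if "S \<le> t" "t \<le> 2 * S" for t
    proof -
      have bl: "bounded_linear (\<lambda>z. Re (\<kappa> * z))"
        by (rule bounded_linear_compose[OF bounded_linear_Re bounded_linear_mult_right])
      from bounded_linear.has_vector_derivative[OF bl dY] that show ?thesis
        by (simp add: has_real_derivative_iff_has_vector_derivative)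
    qed
    from MVT2[OF _ this, of S "2 * S"] S obtain \<xi> where \<xi>: "S < \<xi>" "\<xi> < 2 * S"
      "Re (\<kappa> * Y (2 * S)) - Re (\<kappa> * Y S) = (2 * S - S) * Re (\<kappa> * D \<xi>)" by auto
    have \<xi>in: "\<xi> \<in> {S..2 * S}" using \<xi> by simp
    have Yb: "\<bar>Re (\<kappa> * Y t)\<bar> \<le> norm \<kappa> * (C6 * S powr (- \<nu>))" if "t \<in> {S..2 * S}" for t
    proof -
      have "norm (Y t) \<le> 1 * (C6 * S powr (- \<nu>))"
        unfolding Y_def C6_def by (rule difference_bound[OF L b(2) Gt G1 that])
      then have "norm (\<kappa> * Y t) \<le> norm \<kappa> * (C6 * S powr (- \<nu>))" unfolding norm_mult by (intro mult_left_mono) auto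
      then show ?thesis using abs_Re_le_cmod[of "\<kappa> * Y t"] by linarith
    qed
    have main: "\<kappa> * D \<xi> = \<kappa> * (- \<i> * (pairing (u \<xi>) HG - V S HG \<xi>) - \<i> * of_real lam * N \<xi>)
        + of_real (3 / 2 * \<nu>\<^sup>2 * ln S) * (\<i> * P \<xi>)"
    proof -
      have "\<kappa> * (- \<i> * of_real (3 * \<nu>\<^sup>2) * d1 S) = of_real (3 / 2 * \<nu>\<^sup>2 * ln S) * \<i>"
        unfolding \<kappa>_def d1_def using lam0 c0 by (simp add: field_simps)
      then have "\<kappa> * (- \<i> * of_real (3 * \<nu>\<^sup>2) * d1 S) * P \<xi> = of_real (3 / 2 * \<nu>\<^sup>2 * ln S) * \<i> * P \<xi>" by (simp only:)
      moreover have gen: "k * (a - b - w * p) = k * (a - b) + k * (- w) * p" for k a b w p :: complex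
        by (simp add: algebra_simps)
      moreover have "- (\<i> * of_real (3 * \<nu>\<^sup>2) * d1 S) = - \<i> * of_real (3 * \<nu>\<^sup>2) * d1 S" by simp
      ultimately show ?thesis unfolding D_def gen by (simp only: mult.assoc)
    qed
    have err: "norm (\<kappa> * (- \<i> * (pairing (u \<xi>) HG - V S HG \<xi>) - \<i> * of_real lam * N \<xi>))
        \<le> norm \<kappa> * (B * C6 + \<bar>lam\<bar> * C5) * S powr (- 1 - \<nu>)"
    proof -
      have "norm (pairing (u \<xi>) HG - V S HG \<xi>) \<le> B / S * (C6 * S powr (- \<nu>))"
        unfolding C6_def by (rule difference_bound[OF L b(2) HGt HGb \<xi>in])
      also have "\<dots> = B * C6 * S powr (- 1 - \<nu>)"
        using S_powr(2)[OF S(3), of \<nu>] S(3) by (simp add: field_simps)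
      finally have 1: "norm (pairing (u \<xi>) HG - V S HG \<xi>) \<le> B * C6 * S powr (- 1 - \<nu>)" .
      have 2: "norm (N \<xi>) \<le> C5 * S powr (- 1 - \<nu>)"
        unfolding N_def G_def C5_def by (rule nonlin_bound[OF L g \<xi>in])
      have "norm (- \<i> * (pairing (u \<xi>) HG - V S HG \<xi>) - \<i> * of_real lam * N \<xi>)
          \<le> B * C6 * S powr (- 1 - \<nu>) + \<bar>lam\<bar> * (C5 * S powr (- 1 - \<nu>))"
      proof (rule order_trans[OF norm_triangle_ineq4 add_mono])
        show "norm (- \<i> * (pairing (u \<xi>) HG - V S HG \<xi>)) \<le> B * C6 * S powr (- 1 - \<nu>)" using 1 by (simp add: norm_mult)
        show "norm (\<i> * of_real lam * N \<xi>) \<le> \<bar>lam\<bar> * (C5 * S powr (- 1 - \<nu>))"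
          using 2 by (simp add: norm_mult mult_left_mono)
      qed
      then have "norm \<kappa> * norm (- \<i> * (pairing (u \<xi>) HG - V S HG \<xi>) - \<i> * of_real lam * N \<xi>)
          \<le> norm \<kappa> * (B * C6 * S powr (- 1 - \<nu>) + \<bar>lam\<bar> * (C5 * S powr (- 1 - \<nu>)))" by (intro mult_left_mono) auto
      then show ?thesis unfolding norm_mult by (simp add: algebra_simps)
    qed
    have low: "Re (\<i> * P \<xi>) \<ge> k0 * S powr (- 1 - \<nu>)"
    proof -
      have "2 * \<nu> > 0" using nu01 by simp
      from main_term_lower_bound[OF m g this S(3), of \<xi>] \<xi> show ?thesis
        unfolding P_def G_def k0_def by simp
    qed
    have lnS: "3 / 2 * \<nu>\<^sup>2 * ln S \<ge> 0" using S by simp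
    have "Re (\<kappa> * D \<xi>) \<ge> 3 / 2 * \<nu>\<^sup>2 * ln S * (k0 * S powr (- 1 - \<nu>)) - norm \<kappa> * (B * C6 + \<bar>lam\<bar> * C5) * S powr (- 1 - \<nu>)"
    proof -
      have "Re (\<kappa> * D \<xi>) = Re (\<kappa> * (- \<i> * (pairing (u \<xi>) HG - V S HG \<xi>) - \<i> * of_real lam * N \<xi>))
          + 3 / 2 * \<nu>\<^sup>2 * ln S * Re (\<i> * P \<xi>)"
      proof -
        have gen: "Re (a + of_real r * b) = Re a + r * Re b" for a b :: complex and r by simp
        show ?thesis unfolding main gen ..
      qed
      moreover have "Re (\<kappa> * (- \<i> * (pairing (u \<xi>) HG - V S HG \<xi>) - \<i> * of_real lam * N \<xi>))
          \<ge> - (norm \<kappa> * (B * C6 + \<bar>lam\<bar> * C5) * S powr (- 1 - \<nu>))"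
        using err abs_Re_le_cmod[of "\<kappa> * (- \<i> * (pairing (u \<xi>) HG - V S HG \<xi>) - \<i> * of_real lam * N \<xi>)"] by linarith
      moreover have "3 / 2 * \<nu>\<^sup>2 * ln S * Re (\<i> * P \<xi>) \<ge> 3 / 2 * \<nu>\<^sup>2 * ln S * (k0 * S powr (- 1 - \<nu>))"
        by (rule mult_left_mono[OF low lnS])
      ultimately show ?thesis by linarith
    qed
    then have "S * Re (\<kappa> * D \<xi>) \<ge> S * (3 / 2 * \<nu>\<^sup>2 * ln S * (k0 * S powr (- 1 - \<nu>)) - norm \<kappa> * (B * C6 + \<bar>lam\<bar> * C5) * S powr (- 1 - \<nu>))"
      using S by (intro mult_left_mono) auto
    moreover have "S * (3 / 2 * \<nu>\<^sup>2 * ln S * (k0 * S powr (- 1 - \<nu>)) - norm \<kappa> * (B * C6 + \<bar>lam\<bar> * C5) * S powr (- 1 - \<nu>))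
        = (3 / 2 * \<nu>\<^sup>2 * k0 * ln S - norm \<kappa> * (B * C6 + \<bar>lam\<bar> * C5)) * S powr (- \<nu>)"
      unfolding S_powr(2)[OF S(3), of \<nu>, symmetric] by (simp add: algebra_simps)
    moreover have "S * Re (\<kappa> * D \<xi>) \<le> 2 * (norm \<kappa> * (C6 * S powr (- \<nu>)))"
      using \<xi>(3) Yb[of S] Yb[of "2 * S"] S by auto
    ultimately have "(3 / 2 * \<nu>\<^sup>2 * k0 * ln S - norm \<kappa> * (B * C6 + \<bar>lam\<bar> * C5)) * S powr (- \<nu>) \<le> 2 * (norm \<kappa> * C6) * S powr (- \<nu>)"
      by (simp add: algebra_simps)
    then have "3 / 2 * \<nu>\<^sup>2 * k0 * ln S - norm \<kappa> * (B * C6 + \<bar>lam\<bar> * C5) \<le> 2 * (norm \<kappa> * C6)"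
      by (rule mult_right_le_imp_le) (use S in simp)
    then show ?thesis unfolding W_def by linarith
  qed
  then show ?thesis using that unfolding k0_def by blast
qed

lemma contradiction: False
proof -
  obtain g a r1 r2 where g: "bump g a r1 r2" using bump_exists[OF cut eta01] by blast
  note b = bumpD[OF g]
  define w where "w = 3 / 2 * \<nu>\<^sup>2 * (1 / 8 * (r1 / 4) powr (2 * \<nu>) * vol2 * ((r2 - r1) / 2)\<^sup>2)"
  have w: "w > 0" unfolding w_def using b(3,4) vol2_pos nu01 by simp
  obtain W where W: "\<And>S. large S \<Longrightarrow> w * ln S \<le> W" using log_bounded[OF g] unfolding w_def by blast
  have "\<forall>\<^sub>F S in at_top. ln S > W / w" using ln_at_top by (simp add: filterlim_at_top_dense)
  then have "\<forall>\<^sub>F S in at_top. large S \<and> ln S > W / w" using eventually_large by eventually_elim simp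
  then obtain S where "large S" "ln S > W / w" using eventually_happens[of _ "at_top :: real filter"] by auto
  then show False using W[of S] w by (simp add: field_simps)
qed

end

section \<open>From the assumed bound to rates in time\<close>

lemma B_bound_rates:
  assumes B: "B_bound lam \<phi> b T u" and b: "b \<ge> 1 / 2 + \<nu>" and T1: "T \<ge> 1"
  obtains M M4 where "M \<ge> 0" "M4 \<ge> 0"
    "\<And>S. S \<ge> T \<Longrightarrow> AE t in lborel. t \<ge> S \<longrightarrow>
      Lp_norm 2 (\<lambda>x. u t x - u_ap lam \<phi> t x) \<le> ennreal (M * S powr (- 1 / 2 - \<nu>))"
    "(\<integral>\<^sup>+ t. Lp_norm 4 (\<lambda>x. u t x - u_ap lam \<phi> t x) ^ 4 * indicator {T..} t \<partial>lborel) \<le> ennreal M4"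
proof -
  define E where "E \<tau> = esssup (restrict_space lborel {\<tau>..}) (\<lambda>t. Lp_norm 2 (\<lambda>x. u t x - u_ap lam \<phi> t x))" for \<tau>
  define L where "L \<tau> = eLp (restrict_space lborel {\<tau>..}) 4 (\<lambda>t. Lp_norm 4 (\<lambda>x. u t x - u_ap lam \<phi> t x))" for \<tau>
  define X where "X = (SUP \<tau>\<in>{T..}. ennreal (\<tau> powr b) * (E \<tau> + L \<tau>))"
  have "X < top" using B by (simp add: B_bound_def E_def L_def X_def)
  then obtain M where M: "M \<ge> 0" "X = ennreal M" by (cases X rule: ennreal_cases) auto
  have bd: "E S + L S \<le> ennreal (M * S powr (- b))" if S: "S \<ge> T" for S
  proof -
    have S0: "S > 0" using S T1 by simp
    have "ennreal (S powr b) * (E S + L S) \<le> ennreal M"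
      unfolding M(2)[symmetric] X_def by (rule SUP_upper) (use S in simp)
    then have "ennreal (S powr (- b)) * ennreal (S powr b) * (E S + L S) \<le> ennreal (S powr (- b)) * ennreal M"
      unfolding mult.assoc by (intro mult_left_mono) auto
    also have "\<dots> = ennreal (M * S powr (- b))" using M(1) by (subst mult.commute) (simp add: ennreal_mult)
    finally have "ennreal (S powr (- b)) * ennreal (S powr b) * (E S + L S) \<le> ennreal (M * S powr (- b))" .
    moreover have "ennreal (S powr (- b)) * ennreal (S powr b) = 1"
      using S0 by (simp add: powr_minus flip: ennreal_mult)
    ultimately show ?thesis by (simp only: mult_1)
  qed
  have "AE t in lborel. t \<ge> S \<longrightarrow> Lp_norm 2 (\<lambda>x. u t x - u_ap lam \<phi> t x) \<le> ennreal (M * S powr (- 1 / 2 - \<nu>))"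
    if S: "S \<ge> T" for S
  proof -
    have "E S \<le> E S + L S" by simp
    also have "\<dots> \<le> ennreal (M * S powr (- b))" by (rule bd[OF S])
    \<comment> \<open>Since S \<ge> 1, every b at or above 1/2 + \<nu> yields the critical
      rate.\<close>
    also have "\<dots> \<le> ennreal (M * S powr (- 1 / 2 - \<nu>))"
      using b S T1 M(1) by (intro ennreal_leI mult_left_mono powr_mono) auto
    finally have ES: "E S \<le> ennreal (M * S powr (- 1 / 2 - \<nu>))" .
    have "AE t in restrict_space lborel {S..}. Lp_norm 2 (\<lambda>x. u t x - u_ap lam \<phi> t x) \<le> E S"
      unfolding E_def by (rule esssup_AE)
    then have "AE t in lborel. t \<in> {S..} \<longrightarrow> Lp_norm 2 (\<lambda>x. u t x - u_ap lam \<phi> t x) \<le> E S"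
      by (subst (asm) AE_restrict_space_iff) auto
    then show ?thesis by eventually_elim (use ES in auto)
  qed
  \<comment> \<open>The L^4 part enters without a rate; its finiteness on the half-line from T is
    all that the weak equation asks for.\<close>
  moreover have "(\<integral>\<^sup>+ t. Lp_norm 4 (\<lambda>x. u t x - u_ap lam \<phi> t x) ^ 4 * indicator {T..} t \<partial>lborel)
      \<le> ennreal ((M * T powr (- b)) ^ 4)"
  proof -
    have "L T \<le> E T + L T" by simp
    then have LT: "L T \<le> ennreal (M * T powr (- b))" using bd[of T] by (rule order_trans) simp
    have "(\<integral>\<^sup>+ t. Lp_norm 4 (\<lambda>x. u t x - u_ap lam \<phi> t x) ^ 4 * indicator {T..} t \<partial>lborel)
        = (\<integral>\<^sup>+ t. Lp_norm 4 (\<lambda>x. u t x - u_ap lam \<phi> t x) ^ 4 \<partial>restrict_space lborel {T..})"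
      by (subst nn_integral_restrict_space) auto
    also have "\<dots> = L T ^ 4" unfolding L_def by (subst eLp_power) auto
    also have "\<dots> \<le> ennreal (M * T powr (- b)) ^ 4" by (intro power_mono LT) simp
    also have "\<dots> = ennreal ((M * T powr (- b)) ^ 4)" using M(1) by (simp add: ennreal_power)
    finally show ?thesis .
  qed
  ultimately show ?thesis using that[OF M(1), of "(M * T powr (- b)) ^ 4"] by simp
qed

text \<open>Source of the factor 8 in the assumption \<open>u4\<close> of the locale
  \<open>nls\<close>, where u is split into u_ap and the remainder.\<close>

lemma power4_add_le: "(a + b) ^ 4 \<le> 8 * (a ^ 4 + b ^ 4)" for a b :: real
proof -
  have sq: "(p + q)\<^sup>2 \<le> 2 * (p\<^sup>2 + q\<^sup>2)" for p q :: real
    using zero_le_power2[of "p - q"] by (simp add: power2_eq_square algebra_simps)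
  have "((a + b)\<^sup>2)\<^sup>2 \<le> (2 * (a\<^sup>2 + b\<^sup>2))\<^sup>2" by (intro power_mono sq) simp
  also have "\<dots> = 4 * (a\<^sup>2 + b\<^sup>2)\<^sup>2" by (simp only: power_mult_distrib) simp
  also have "\<dots> \<le> 4 * (2 * ((a\<^sup>2)\<^sup>2 + (b\<^sup>2)\<^sup>2))" by (intro mult_left_mono sq) simp
  finally show ?thesis by simp
qed

context profile
begin

lemma no_decay:
  assumes gl: "global_solution \<alpha> lam u" and lam0: "lam \<noteq> 0" and c0: "c \<noteq> 0"
    and b: "b \<ge> 1 / 2 + \<nu>" and T1: "T \<ge> 1"
  shows "\<not> B_bound lam f b T u"
proof
  assume "B_bound lam f b T u"
  then obtain M M4 where M: "M \<ge> 0" "M4 \<ge> 0"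
    and r: "\<And>S. S \<ge> T \<Longrightarrow> AE t in lborel. t \<ge> S \<longrightarrow>
      Lp_norm 2 (\<lambda>x. u t x - u_ap lam f t x) \<le> ennreal (M * S powr (- 1 / 2 - \<nu>))"
    and r4: "(\<integral>\<^sup>+ t. Lp_norm 4 (\<lambda>x. u t x - u_ap lam f t x) ^ 4 * indicator {T..} t \<partial>lborel) \<le> ennreal M4"
    using B_bound_rates[OF _ b T1] by blast
  obtain C0 where C0: "C0 \<ge> 0"
    "\<And>t. t \<ge> 1 \<Longrightarrow> (\<integral>\<^sup>+ x. ennreal ((norm (u_ap lam f t x)) ^ 4) \<partial>lborel) \<le> ennreal C0"
    by (rule u_ap_f_L4[of lam]) blast
  obtain U where U: "propagator \<alpha> U" "duhamel lam U u" using gl by (auto simp: global_solution_def)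
  have uL: "u t \<in> L2" for t using gl by (simp add: global_solution_def)
  have rL: "(\<lambda>x. u t x - u_ap lam f t x) \<in> L2" if "t > 0" for t
    using L2_diff[OF uL u_ap_f_L2[OF that]] .
  define Q4 where "Q4 t = Lp_norm 4 (\<lambda>x. u t x - u_ap lam f t x) ^ 4" for t
  have Q4: "Q4 t = (\<integral>\<^sup>+ x. ennreal ((norm (u t x - u_ap lam f t x)) ^ 4) \<partial>lborel)" for t
    unfolding Q4_def Lp_norm_def by (subst eLp_power) (simp_all add: ennreal_power)
  interpret decay \<alpha> \<nu> m \<eta> c U lam T C0 M4 u Q4 M
  proof unfold_locales
    show "propagator \<alpha> U" "duhamel lam U u" by fact+
    show "u t \<in> L2" for t by (rule uL)
    show "((\<lambda>s. Lp_norm 2 (\<lambda>x. u s x - u t x)) \<longlongrightarrow> 0) (at t)" for t using gl by (simp add: global_solution_def)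
    show "T > 0" "C0 \<ge> 0" "M4 \<ge> 0" "lam \<noteq> 0" "c \<noteq> 0" "T \<ge> 1" "M \<ge> 0" using T1 C0 M lam0 c0 by auto
    show "(\<integral>\<^sup>+ s. Q4 s * indicator {T..} s \<partial>lborel) \<le> ennreal M4" unfolding Q4_def by (rule r4)
    show "(\<integral>\<^sup>+ x. ennreal ((norm (u s x)) ^ 4) \<partial>lborel) \<le> 8 * (ennreal C0 + Q4 s)" if s: "s \<ge> T" for s
    proof -
      have s1: "s \<ge> 1" "s > 0" using s T1 by auto
      have [measurable]: "u_ap lam f s \<in> borel_measurable borel" "(\<lambda>x. u s x - u_ap lam f s x) \<in> borel_measurable borel"
        using L2_measurable[OF u_ap_f_L2[OF s1(2)]] L2_measurable[OF rL[OF s1(2)]] by auto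
      have pt: "ennreal ((norm (u s x)) ^ 4) \<le>
          8 * (ennreal ((norm (u_ap lam f s x)) ^ 4) + ennreal ((norm (u s x - u_ap lam f s x)) ^ 4))" for x :: "real^2"
      proof -
        have "norm (u s x) \<le> norm (u_ap lam f s x) + norm (u s x - u_ap lam f s x)"
          using norm_triangle_ineq[of "u_ap lam f s x" "u s x - u_ap lam f s x"] by simp
        then have "(norm (u s x)) ^ 4 \<le> (norm (u_ap lam f s x) + norm (u s x - u_ap lam f s x)) ^ 4"
          by (intro power_mono) auto
        also have "\<dots> \<le> 8 * ((norm (u_ap lam f s x)) ^ 4 + (norm (u s x - u_ap lam f s x)) ^ 4)" by (rule power4_add_le)
        finally have "ennreal ((norm (u s x)) ^ 4) \<le> ennreal (8 * ((norm (u_ap lam f s x)) ^ 4 + (norm (u s x - u_ap lam f s x)) ^ 4))"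
          by (rule ennreal_leI)
        then show ?thesis by (simp add: ennreal_mult ennreal_plus)
      qed
      have "(\<integral>\<^sup>+ x. ennreal ((norm (u s x)) ^ 4) \<partial>lborel)
          \<le> (\<integral>\<^sup>+ x. 8 * (ennreal ((norm (u_ap lam f s x)) ^ 4) + ennreal ((norm (u s x - u_ap lam f s x)) ^ 4)) \<partial>lborel)"
        by (rule nn_integral_mono) (rule pt)
      also have "\<dots> = 8 * ((\<integral>\<^sup>+ x. ennreal ((norm (u_ap lam f s x)) ^ 4) \<partial>lborel) + Q4 s)"
        unfolding Q4 by (subst nn_integral_cmult, measurable, subst nn_integral_add) auto
      also have "\<dots> \<le> 8 * (ennreal C0 + Q4 s)" by (intro mult_left_mono add_right_mono C0(2) s1) simp
      finally show ?thesis .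
    qed
    show "AE t in lborel. t \<ge> S \<longrightarrow> l2 (\<lambda>x. u t x - u_ap lam f t x) \<le> M * S powr (- 1 / 2 - \<nu>)" if S: "S \<ge> T" for S
      using r[OF S]
    proof eventually_elim
      case (elim t)
      show ?case
      proof
        assume t: "t \<ge> S"
        then have "t > 0" using S T1 by simp
        from Lp_norm_l2[OF rL[OF this]] elim t
        show "l2 (\<lambda>x. u t x - u_ap lam f t x) \<le> M * S powr (- 1 / 2 - \<nu>)"
          using M(1) by (simp add: ennreal_le_iff)
      qed
    qed
  qed
  show False by (rule contradiction)
qed

text \<open>The profile is its own singular part: with its own cutoff it decomposes with \<psi> = 0,
  so its coefficient of index m is c. As |m + \<alpha>| = \<nu> \<le> 1/2, membership in
  \<open>D_sharp\<close> would force c = 0.\<close>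

lemma f_notin_D_sharp:
  assumes \<alpha>: "0 < \<alpha>" "\<alpha> < 1" and c0: "c \<noteq> 0" and nu2: "\<nu> \<le> 1 / 2"
  shows "f \<notin> D_sharp \<alpha>"
proof
  assume D: "f \<in> D_sharp \<alpha>"
  have "decomposes \<alpha> \<eta> f (\<lambda>x. 0) (if m = 0 then c else 0) (if m = 0 then 0 else c)"
  proof (cases "m = 0")
    case True
    with nu \<alpha> have "\<nu> = \<alpha>" by simp
    with True show ?thesis unfolding decomposes_def f_def h_def using zero_Y_space by (simp add: ang_def)
  next
    case False
    with m nu \<alpha> have "m = - 1" "\<nu> = 1 - \<alpha>" by auto
    then show ?thesis unfolding decomposes_def f_def h_def using zero_Y_space by simp
  qed
  from sing_coeff_eq[OF \<alpha> cut this, of m] have "sing_coeff \<alpha> m f = c" by (simp split: if_splits)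
  moreover have "sing_coeff \<alpha> m f = 0" using D m nu nu2 by (auto simp: D_sharp_def)
  ultimately show False using c0 by simp
qed

end

theorem theorem1p3:
  fixes \<alpha> lam \<nu> b\<^sub>0 \<epsilon> :: real
    and m\<^sub>\<nu> :: int
    and \<eta> :: "real \<Rightarrow> real"
    and c :: complex
    and \<phi> :: "real^2 \<Rightarrow> complex"
  assumes "0 < \<alpha>" and "\<alpha> < 1" and "\<alpha> \<noteq> 1/2"
    and "\<nu> = min \<alpha> (1 - \<alpha>)"
    and "m\<^sub>\<nu> = (if \<alpha> < 1/2 then 0 else -1)"
    and "radial_cutoff \<eta>" and "\<forall>r\<ge>0. 0 \<le> \<eta> r \<and> \<eta> r \<le> 1"
    and "\<phi> = (\<lambda>x. c * of_real (\<eta> (norm x) * norm x powr \<nu>) * ang m\<^sub>\<nu> x)"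
    and "of_real lam * c \<noteq> 0"
    and "b\<^sub>0 = 1/2 + \<nu>/2"
    and "final_state_const \<alpha> lam b\<^sub>0 \<epsilon>"
    and "Linf_norm \<phi> < ennreal \<epsilon>"
  shows "\<bar>of_int m\<^sub>\<nu> + \<alpha>\<bar> = \<nu> \<and>
    \<phi> \<in> H_dom \<alpha> - D_sharp \<alpha> \<and>
    (\<forall>u. final_state_solution \<alpha> lam b\<^sub>0 \<phi> u \<longrightarrow>
       (\<forall>b T. b \<ge> 1/2 + \<nu> \<and> T \<ge> 1 \<longrightarrow> \<not> B_bound lam \<phi> b T u)) \<and>
    \<not> (\<exists>u b T. global_solution \<alpha> lam u \<and> b \<ge> 1/2 + \<nu> \<and> T \<ge> 1 \<and> B_bound lam \<phi> b T u)"
proof -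
  have nus: "\<bar>of_int m\<^sub>\<nu> + \<alpha>\<bar> = \<nu>" "0 < \<nu>" "\<nu> \<le> 1 / 2" using assms(1-5) by (auto simp: min_def)
  interpret profile \<alpha> \<nu> m\<^sub>\<nu> \<eta> c
  proof
    show "m\<^sub>\<nu> = 0 \<or> m\<^sub>\<nu> = -1" using assms(5) by auto
    show "\<nu> < 1" using nus by simp
  qed (use nus assms(6,7) in auto)
  have \<phi>: "\<phi> = f" by (simp add: assms(8) fun_eq_iff f_def h_def)
  have lc: "lam \<noteq> 0" "c \<noteq> 0" using assms(9) by auto
  note nd = no_decay[OF _ lc]
  show ?thesis unfolding \<phi> final_state_solution_def
    using nus(1) f_H_dom f_notin_D_sharp[OF assms(1,2) lc(2) nus(3)] nd by (intro conjI allI impI notI) blast+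
qed

end
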